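(* Let $G_\sigma$ be a decomposable ordered graph on $\{1,\dots,p\}$ with edge set $E_\sigma$, such that the ordering $1<2<\dots<p$ is a perfect elimination ordering. Let $\Omega=LDL^T\in\mathbb{P}_{G_\sigma}$ follow the generalized $G$-Wishart distribution with parameters $(U,\boldsymbol\delta)$, $U$ positive definite, $\delta_i>0$. For each $j$ let $L_{I_j}=(L_{ij})_{i\in\mathcal N^{\succ j}}$ be the independent entries of the $j$-th column of $L$. Then $$L_{I_j}\mid D_j\sim N\Big(\boldsymbol e_j,\ \frac{(U^{\succ j})^{-1}}{D_j}\Big)\quad\text{and}\quad D_j\sim\mathrm{Gamma}\Big(\frac{\nu_j+\delta_j}{2}+1,\ \frac{c_j}{2}\Big)$$ (shape, rate), and $$E(\Omega)=\sum_{k<p}[(U^{\succ k})^{-1}]^0+e^T\mathcal H e.$$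
   Context: $\mathbb{P}_{G_\sigma}$: $p\times p$ symmetric positive definite $\Omega$ with $\Omega_{ij}=0$ for $i\ne j$, $(i,j)\notin E_\sigma$. $\Omega=LDL^T$ is the modified Cholesky decomposition ($L$ unit lower triangular, $D=\mathrm{diag}(D_1,\dots,D_p)$, $D_i>0$). The generalized $G$-Wishart distribution with parameters $U,\boldsymbol\delta$ has density on $\mathbb{P}_{G_\sigma}$ proportional to $\prod_j D_j^{\delta_j/2}\exp(-\tfrac12\mathrm{tr}(\Omega U))$. The ordering $1<\dots<p$ is a perfect elimination ordering if for each $j$, $\{j\}\cup\{i>j:(i,j)\in E_\sigma\}$ is a clique. Notation: $\mathcal N^{\succ j}=\{i:i>j,(i,j)\in E_\sigma\}$, $\nu_j=|\mathcal N^{\succ j}|$; $\boldsymbol U^{\succ}_{\cdot j}=(U_{ij})_{i\in\mathcal N^{\succ j}}$; $U^{\succ j}=(U_{ii'})_{i,i'\in\mathcal N^{\succ j}}$; $\boldsymbol e_j=-(U^{\succ j})^{-1}\boldsymbol U^{\succ}_{\cdot j}$ (a vector indexed by $\mathcal N^{\succ j}$ with components $e_{j,i}$); $c_j=U_{jj}-\boldsymbol U^{\succ T}_{\cdot j}(U^{\succ j})^{-1}\boldsymbol U^{\succ}_{\cdot j}>0$ (with $c_j=U_{jj}$ when $\mathcal N^{\succ j}=\emptyset$). $[(U^{\succ k})^{-1}]^0$ is the $p\times p$ matrix with $(U^{\succ k})^{-1}$ placed in rows and columns $\mathcal N^{\succ k}$ and zeros elsewhere. $\mathcal H$ is the diagonal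 matrix with $\mathcal H_{kk}=(\delta_k+\nu_k+2)/c_k$, and $e$ is the $p\times p$ matrix with $(k,j)$ entry $e_{k,j}$ if $j\in\mathcal N^{\succ k}$, $1$ if $j=k$, $0$ otherwise. *)

theory Defs
  imports "HOL-Probability.Probability" "HOL-Combinatorics.Permutations"
begin

text \<open>Matrices are functions nat => nat => real; vertices / indices are 1..p.
  E is the (symmetric, irreflexive) edge set of G_sigma on {1..p}.\<close>

type_synonym rmat = "nat \<Rightarrow> nat \<Rightarrow> real"

definition succ_nbrs :: "(nat \<times> nat) set \<Rightarrow> nat \<Rightarrow> nat set" where
  "succ_nbrs E j = {i. j < i \<and> (i, j) \<in> E}"

definition is_peo :: "nat \<Rightarrow> (nat \<times> nat) set \<Rightarrow> bool" where
  "is_peo p E \<longleftrightarrow> (\<forall>j\<in>{1..p}. \<forall>i\<in>succ_nbrs E j. \<forall>i'\<in>succ_nbrs E j. i \<noteq> i' \<longrightarrow> (i, i') \<in> E)"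

text \<open>Free coordinates of P_G: lower-triangular entries (i,j), j \<le> i, on the
  diagonal or on an edge.\<close>
definition free_idx :: "nat \<Rightarrow> (nat \<times> nat) set \<Rightarrow> (nat \<times> nat) set" where
  "free_idx p E = {(i, j). i \<in> {1..p} \<and> j \<in> {1..p} \<and> j \<le> i \<and> (i = j \<or> (i, j) \<in> E)}"

definition omega_of :: "nat \<Rightarrow> (nat \<times> nat) set \<Rightarrow> (nat \<times> nat \<Rightarrow> real) \<Rightarrow> rmat" where
  "omega_of p E x = (\<lambda>i j. if (i, j) \<in> free_idx p E then x (i, j)
                         else if (j, i) \<in> free_idx p E then x (j, i) else 0)"

definition pos_def_on :: "nat set \<Rightarrow> rmat \<Rightarrow> bool" where
  "pos_def_on S A \<longleftrightarrow> (\<forall>i\<in>S. \<forall>j\<in>S. A i j = A j i) \<and>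
     (\<forall>v. (\<exists>i\<in>S. v i \<noteq> 0) \<longrightarrow> (\<Sum>i\<in>S. \<Sum>j\<in>S. v i * A i j * v j) > 0)"

definition is_mcd :: "nat \<Rightarrow> rmat \<Rightarrow> rmat \<Rightarrow> (nat \<Rightarrow> real) \<Rightarrow> bool" where
  "is_mcd p \<Omega> L D \<longleftrightarrow>
     (\<forall>i j. L i j \<noteq> 0 \<longrightarrow> i \<in> {1..p} \<and> j \<in> {1..p} \<and> j \<le> i) \<and>
     (\<forall>i\<in>{1..p}. L i i = 1) \<and>
     (\<forall>k. D k \<noteq> 0 \<longrightarrow> k \<in> {1..p}) \<and> (\<forall>k\<in>{1..p}. D k > 0) \<and>
     (\<forall>i\<in>{1..p}. \<forall>j\<in>{1..p}. \<Omega> i j = (\<Sum>k\<in>{1..p}. L i k * D k * L j k))"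

definition mcd_L :: "nat \<Rightarrow> rmat \<Rightarrow> rmat" where
  "mcd_L p \<Omega> = fst (THE (L, D). is_mcd p \<Omega> L D)"

definition mcd_D :: "nat \<Rightarrow> rmat \<Rightarrow> nat \<Rightarrow> real" where
  "mcd_D p \<Omega> = snd (THE (L, D). is_mcd p \<Omega> L D)"

text \<open>Inverse of the submatrix of A indexed by S, padded with zeros outside S
  (so inv_on S A is [(A_S)^{-1}]^0).\<close>
definition inv_on :: "nat set \<Rightarrow> rmat \<Rightarrow> rmat" where
  "inv_on S A = (THE B. (\<forall>i j. B i j \<noteq> 0 \<longrightarrow> i \<in> S \<and> j \<in> S) \<and>
      (\<forall>i\<in>S. \<forall>j\<in>S. (\<Sum>k\<in>S. A i k * B k j) = (if i = j then 1 else 0)))"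

definition det_on :: "nat set \<Rightarrow> rmat \<Rightarrow> real" where
  "det_on S A = (\<Sum>\<pi> | \<pi> permutes S. of_int (sign \<pi>) * (\<Prod>i\<in>S. A i (\<pi> i)))"

definition e_vec :: "(nat \<times> nat) set \<Rightarrow> rmat \<Rightarrow> nat \<Rightarrow> nat \<Rightarrow> real" where
  "e_vec E U j i = - (\<Sum>l\<in>succ_nbrs E j. inv_on (succ_nbrs E j) U i l * U l j)"

definition c_const :: "(nat \<times> nat) set \<Rightarrow> rmat \<Rightarrow> nat \<Rightarrow> real" where
  "c_const E U j = U j j - (\<Sum>i\<in>succ_nbrs E j. \<Sum>l\<in>succ_nbrs E j.
                               U i j * inv_on (succ_nbrs E j) U i l * U l j)"

definition nu :: "(nat \<times> nat) set \<Rightarrow> nat \<Rightarrow> nat" where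
  "nu E j = card (succ_nbrs E j)"

definition e_mat :: "(nat \<times> nat) set \<Rightarrow> rmat \<Rightarrow> rmat" where
  "e_mat E U k j = (if j \<in> succ_nbrs E k then e_vec E U k j else if j = k then 1 else 0)"

definition H_diag :: "(nat \<times> nat) set \<Rightarrow> rmat \<Rightarrow> (nat \<Rightarrow> real) \<Rightarrow> nat \<Rightarrow> real" where
  "H_diag E U \<delta> k = (\<delta> k + real (nu E k) + 2) / c_const E U k"

definition gamma_density :: "real \<Rightarrow> real \<Rightarrow> real \<Rightarrow> real" where
  "gamma_density a b x = (if x > 0 then b powr a * x powr (a - 1) * exp (- b * x) / Gamma a else 0)"

definition mvn_density :: "nat set \<Rightarrow> (nat \<Rightarrow> real) \<Rightarrow> rmat \<Rightarrow> (nat \<Rightarrow> real) \<Rightarrow> real" where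
  "mvn_density S \<mu> \<Sigma> x = (2 * pi) powr (- real (card S) / 2) / sqrt (det_on S \<Sigma>) *
     exp (- (1/2) * (\<Sum>i\<in>S. \<Sum>l\<in>S. (x i - \<mu> i) * inv_on S \<Sigma> i l * (x l - \<mu> l)))"

definition gw_unnorm :: "nat \<Rightarrow> (nat \<times> nat) set \<Rightarrow> rmat \<Rightarrow> (nat \<Rightarrow> real) \<Rightarrow> (nat \<times> nat \<Rightarrow> real) \<Rightarrow> real" where
  "gw_unnorm p E U \<delta> x = (let \<Omega> = omega_of p E x in
     if pos_def_on {1..p} \<Omega> then
       (\<Prod>j\<in>{1..p}. mcd_D p \<Omega> j powr (\<delta> j / 2)) *
       exp (- (1/2) * (\<Sum>i\<in>{1..p}. \<Sum>k\<in>{1..p}. \<Omega> i k * U k i))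
     else 0)"

definition gw_space :: "nat \<Rightarrow> (nat \<times> nat) set \<Rightarrow> (nat \<times> nat \<Rightarrow> real) measure" where
  "gw_space p E = PiM (free_idx p E) (\<lambda>_. lborel)"

definition gw_density :: "nat \<Rightarrow> (nat \<times> nat) set \<Rightarrow> rmat \<Rightarrow> (nat \<Rightarrow> real) \<Rightarrow> (nat \<times> nat \<Rightarrow> real) \<Rightarrow> ennreal" where
  "gw_density p E U \<delta> x =
     ennreal (gw_unnorm p E U \<delta> x) / (\<integral>\<^sup>+ y. ennreal (gw_unnorm p E U \<delta> y) \<partial>gw_space p E)"

end

theory Submission
  imports Defs "Jordan_Normal_Form.Determinant"
begin

text \<open>
  Gaussian elimination replaces the free entries of \<open>\<Omega>\<close> by the unnormalised columns
  \<open>w\<^sub>i\<^sub>j = L\<^sub>i\<^sub>j D\<^sub>j\<close>. Because the ordering is a perfect elimination ordering there is no fill-in, so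
  the \<open>w\<close> live on the same index set, and \<open>\<Omega>\<^sub>i\<^sub>j = w\<^sub>i\<^sub>j + \<Sum>\<^sub>k w\<^sub>i\<^sub>k w\<^sub>j\<^sub>k / w\<^sub>k\<^sub>k\<close> (sum over \<open>k < j\<close>) is a
  triangular change of variables with Jacobian 1. In these coordinates the density is a product
  over the columns. Rescaling a column by \<open>D\<^sub>j\<close> contributes \<open>D\<^sub>j\<close> to the power \<open>\<nu>\<^sub>j\<close>, and completing the
  square turns its factor into a Gamma density times a Gaussian density. The expectation follows
  from \<open>\<Omega> = L D L\<^sup>T\<close> and the second moments of the columns, obtained by polarisation.
\<close>

section \<open>Determinants and inverses of submatrices\<close>

hide_const (open) Determinants.det

text \<open>Two obstacles shape the development. The factors \<open>mcd_L\<close> and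
  \<open>mcd_D\<close> are given by a description operator, which says nothing about measurability;
  the rational recursion \<open>elim_col\<close> takes their place. Moreover, neither integrability
  nor the value of the normalising constant is known in advance, so all integrals are of nonnegative
  functions with values in \<open>ennreal\<close>, and the law of a column is first found only up to
  a factor common to all test functions. The substitution uses w rather than (L, D) because earlier
  columns then enter an entry of \<Omega> as an additive term with coefficient 1. The multiplication
  by the pivot is postponed until a single column is integrated at a fixed pivot, where it is
  linear. Nonnegativity is also the reason for polarisation: moments are computed for D times a
  square, and mixed products of entries of L are recovered from these.\<close>

lemma det_on_cong:
  assumes "\<And>i j. i \<in> S \<Longrightarrow> j \<in> S \<Longrightarrow> A i j = B i j"
  shows "det_on S A = det_on S B"
  unfolding det_on_def
  by (intro sum.cong refl arg_cong2[where f = "(*)"] prod.cong)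
     (auto simp: assms permutes_in_image)

lemma det_on_scale: "det_on S (\<lambda>i j. c * A i j) = c ^ card S * det_on S A"
  unfolding det_on_def by (simp add: prod.distrib sum_distrib_left mult_ac)

lemma det_on_transpose:
  assumes "finite S"
  shows "det_on S (\<lambda>i j. A j i) = det_on S A"
proof -
  have "det_on S (\<lambda>i j. A j i) =
      (\<Sum>\<pi> | \<pi> permutes S. of_int (sign (inv_into UNIV \<pi>)) * (\<Prod>i\<in>S. A (inv_into UNIV \<pi> i) i))"
    unfolding det_on_def by (rule sum_permutations_inverse)
  also have "\<dots> = det_on S A"
    unfolding det_on_def
  proof (intro sum.cong refl, clarify)
    fix \<pi> assume \<pi>: "\<pi> permutes S"
    have "(\<Prod>i\<in>S. A (inv_into UNIV \<pi> i) i) = (\<Prod>i\<in>S. A (inv_into UNIV \<pi> (\<pi> i)) (\<pi> i))"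
      using prod.permute[OF \<pi>, of "\<lambda>i. A (inv_into UNIV \<pi> i) i"] by (simp add: o_def)
    moreover have "sign (inv_into UNIV \<pi>) = sign \<pi>"
      using \<pi> assms by (intro sign_inverse) (auto simp: permutation_permutes)
    ultimately show "of_int (sign (inv_into UNIV \<pi>)) * (\<Prod>i\<in>S. A (inv_into UNIV \<pi> i) i)
        = of_int (sign \<pi>) * (\<Prod>i\<in>S. A i (\<pi> i))"
      using permutes_inverses[OF \<pi>] by simp
  qed
  finally show ?thesis .
qed

lemma det_on_triangular:
  assumes "finite S" and tri: "\<And>i j. i \<in> S \<Longrightarrow> j \<in> S \<Longrightarrow> i < j \<Longrightarrow> A i j = 0"
  shows "det_on S A = (\<Prod>i\<in>S. A i i)"
proof -
  have fin: "finite {\<pi>. \<pi> permutes S}"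
    using assms(1) by (rule finite_permutations)
  have "det_on S A = (\<Sum>\<pi>\<in>{id}. of_int (sign \<pi>) * (\<Prod>i\<in>S. A i (\<pi> i)))"
    unfolding det_on_def
  proof (rule sum.mono_neutral_right[OF fin])
    show "\<forall>\<pi>\<in>{\<pi>. \<pi> permutes S} - {id}. of_int (sign \<pi>) * (\<Prod>i\<in>S. A i (\<pi> i)) = 0"
    proof
      fix \<pi> assume "\<pi> \<in> {\<pi>. \<pi> permutes S} - {id}"
      then have \<pi>: "\<pi> permutes S" "\<pi> \<noteq> id" by auto
      \<comment> \<open>A permutation that moves no index up is the identity, so any other one picks
        an entry above the diagonal.\<close>
      then obtain i where i: "i \<in> S" "\<pi> i > i"
        using permutes_natset_le[of \<pi> S] by force
      then have "(\<Prod>i\<in>S. A i (\<pi> i)) = 0"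
        using assms(1) tri[of i "\<pi> i"] permutes_in_image[OF \<pi>(1), of i] by (auto simp: prod_zero_iff)
      then show "of_int (sign \<pi>) * (\<Prod>i\<in>S. A i (\<pi> i)) = 0" by simp
    qed
  qed (auto simp: permutes_id)
  then show ?thesis by (simp add: sign_id)
qed

text \<open>The bridge to library matrices: conjugation by the enumeration \<open>f\<close> carries
  permutations of the index range to permutations of \<open>S\<close> and keeps the sign.
  Multiplicativity and invertibility are imported through it.\<close>

lemma det_on_eq_det:
  assumes f: "bij_betw f {0..<n} S"
  shows "det_on S A = det (mat n n (\<lambda>(i, j). A (f i) (f j)))"
proof -
  have fin: "finite S" using f bij_betw_finite by blast
  have inj: "inj_on f {0..<n}" and im: "f ` {0..<n} = S"
    using f by (auto simp: bij_betw_def)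
  let ?g = "map_permutation {0..<n} f"
  have bij: "bij_betw ?g {\<pi>. \<pi> permutes {0..<n}} {\<pi>. \<pi> permutes S}"
    using bij_betw_permutations[OF f] im by (simp add: map_permutation_def[abs_def] restrict_id_def o_def if_distrib cong: if_cong)
  have "det_on S A = (\<Sum>\<pi> | \<pi> permutes {0..<n}. of_int (sign (?g \<pi>)) * (\<Prod>i\<in>S. A i (?g \<pi> i)))"
    unfolding det_on_def by (rule sum.reindex_bij_betw[OF bij, symmetric])
  also have "\<dots> = (\<Sum>\<pi> | \<pi> permutes {0..<n}. signof \<pi> * (\<Prod>i\<in>{0..<n}. A (f i) (f (\<pi> i))))"
  proof (intro sum.cong refl, clarify)
    fix \<pi> :: "nat \<Rightarrow> nat" assume \<pi>: "\<pi> permutes {0..<n}"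
    have "(\<Prod>i\<in>S. A i (?g \<pi> i)) = (\<Prod>i\<in>{0..<n}. A (f i) (?g \<pi> (f i)))"
      by (rule prod.reindex_bij_betw[OF f, symmetric])
    also have "\<dots> = (\<Prod>i\<in>{0..<n}. A (f i) (f (\<pi> i)))"
      by (intro prod.cong refl) (simp add: map_permutation_apply[OF inj])
    finally show "of_int (sign (?g \<pi>)) * (\<Prod>i\<in>S. A i (?g \<pi> i)) 
      = signof \<pi> * (\<Prod>i\<in>{0..<n}. A (f i) (f (\<pi> i)))"
      using sign_map_permutation[OF inj \<pi>] by (simp add: )
  qed
  also have "\<dots> = det (mat n n (\<lambda>(i, j). A (f i) (f j)))"
    unfolding det_def by (auto intro!: sum.cong prod.cong simp: permutes_in_image)
  finally show ?thesis .
qed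

lemma ex_enum: "finite S \<Longrightarrow> \<exists>f n. bij_betw f {0..<n::nat} S"
  using ex_bij_betw_nat_finite by blast

lemma det_on_mult:
  assumes "finite S"
  shows "det_on S (\<lambda>i j. \<Sum>k\<in>S. A i k * B k j) = det_on S A * det_on S B"
proof -
  obtain f n where f: "bij_betw f {0..<n::nat} S" using ex_enum[OF assms] by blast
  let ?m = "\<lambda>A. mat n n (\<lambda>(i, j). A (f i) (f j))"
  have "?m (\<lambda>i j. \<Sum>k\<in>S. A i k * B k j) = ?m A * ?m B"
    by (rule eq_matI) (auto simp: scalar_prod_def sum.reindex_bij_betw[OF f, symmetric])
  then show ?thesis
    unfolding det_on_eq_det[OF f] by (simp add: det_mult[of _ n])
qed

text \<open>The inverse is two-sided and padded with zeros: the padding is what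
  \<open>inv_on\<close> demands, and the left inverse is what forces uniqueness in
  \<open>inv_on_eqI\<close>.\<close>

lemma ex_inverse_on:
  assumes "finite S" and "det_on S A \<noteq> 0"
  obtains B where "\<And>i j. B i j \<noteq> 0 \<Longrightarrow> i \<in> S \<and> j \<in> S"
    and "\<And>i j. i \<in> S \<Longrightarrow> j \<in> S \<Longrightarrow> (\<Sum>k\<in>S. A i k * B k j) = (if i = j then 1 else 0)"
    and "\<And>i j. i \<in> S \<Longrightarrow> j \<in> S \<Longrightarrow> (\<Sum>k\<in>S. B i k * A k j) = (if i = j then 1 else 0)"
proof -
  obtain f n where f: "bij_betw f {0..<n::nat} S" using ex_enum[OF assms(1)] by blast
  define m where "m = mat n n (\<lambda>(i, j). A (f i) (f j))"
  have m: "m \<in> carrier_mat n n" and "det m \<noteq> 0"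
    using assms(2) by (auto simp: m_def det_on_eq_det[OF f])
  then obtain b where b: "b \<in> carrier_mat n n" and bm: "b * m = 1\<^sub>m n" and mb: "m * b = 1\<^sub>m n"
    using det_non_zero_imp_unit[of m n, unfolded Units_def ring_mat_def] by auto
  define g where "g = the_inv_into {0..<n} f"
  have gf: "g (f i) = i" if "i < n" for i
    using f that by (auto simp: g_def bij_betw_def the_inv_into_f_f)
  define B where "B i j = (if i \<in> S \<and> j \<in> S then b $$ (g i, g j) else 0)" for i j
  have fS: "f i \<in> S" if "i < n" for i using f that by (auto simp: bij_betw_def)
  have S_ex: "\<exists>i'<n. i = f i'" if "i \<in> S" for i using f that by (force simp: bij_betw_def)
  have eq: "(f i = f j) = (i = j)" if "i < n" "j < n" for i j using that gf by metis
  show ?thesis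
  proof (rule that[of B])
    show "i \<in> S \<and> j \<in> S" if "B i j \<noteq> 0" for i j
      using that by (auto simp: B_def split: if_splits)
  next
    fix i j assume "i \<in> S" "j \<in> S"
    then obtain i' j' where ij: "i' < n" "i = f i'" "j' < n" "j = f j'" using S_ex by metis
    have "(\<Sum>k\<in>S. A i k * B k j) = (m * b) $$ (i', j')"
      using ij m b fS by (auto simp: sum.reindex_bij_betw[OF f, symmetric] scalar_prod_def B_def gf m_def)
    then show "(\<Sum>k\<in>S. A i k * B k j) = (if i = j then 1 else 0)"
      using ij mb by (simp add: eq)
    have "(\<Sum>k\<in>S. B i k * A k j) = (b * m) $$ (i', j')"
      using ij m b fS by (auto simp: sum.reindex_bij_betw[OF f, symmetric] scalar_prod_def B_def gf m_def)
    then show "(\<Sum>k\<in>S. B i k * A k j) = (if i = j then 1 else 0)"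
      using ij bm by (simp add: eq)
  qed
qed

section \<open>Positive definite submatrices: Schur complements and Cholesky factors\<close>

lemma pos_def_on_sym: "pos_def_on S A \<Longrightarrow> i \<in> S \<Longrightarrow> j \<in> S \<Longrightarrow> A i j = A j i"
  by (auto simp: pos_def_on_def)

lemma pos_def_on_pos:
  "pos_def_on S A \<Longrightarrow> i \<in> S \<Longrightarrow> v i \<noteq> 0 \<Longrightarrow> (\<Sum>i\<in>S. \<Sum>j\<in>S. v i * A i j * v j) > 0"
  by (auto simp: pos_def_on_def)

lemma pos_def_on_subset:
  assumes "pos_def_on S A" "T \<subseteq> S" "finite S"
  shows "pos_def_on T A"
  unfolding pos_def_on_def
proof (intro conjI ballI allI impI)
  show "A i j = A j i" if "i \<in> T" "j \<in> T" for i j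
    using pos_def_on_sym[OF assms(1)] that assms(2) by auto
  fix v :: "nat \<Rightarrow> real" assume "\<exists>i\<in>T. v i \<noteq> 0"
  then obtain i where i: "i \<in> T" "v i \<noteq> 0" by auto
  define w where "w i = (if i \<in> T then v i else 0)" for i
  have "0 < (\<Sum>i\<in>S. \<Sum>j\<in>S. w i * A i j * w j)"
    using i assms(2) by (intro pos_def_on_pos[OF assms(1), of i]) (auto simp: w_def)
  also have "\<dots> = (\<Sum>i\<in>T. \<Sum>j\<in>T. w i * A i j * w j)"
    using assms(2,3) by (intro sum.mono_neutral_cong_right) (auto simp: w_def intro!: sum.mono_neutral_cong_right)
  also have "\<dots> = (\<Sum>i\<in>T. \<Sum>j\<in>T. v i * A i j * v j)"
    by (intro sum.cong) (auto simp: w_def)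
  finally show "0 < (\<Sum>i\<in>T. \<Sum>j\<in>T. v i * A i j * v j)" .
qed

text \<open>Isolates the variable at \<open>m\<close> as a quadratic polynomial; this one expansion
  serves both the Schur complement and the completion of the square.\<close>

lemma quad_form_insert:
  fixes A :: rmat
  assumes "finite S" "m \<notin> S" and sym: "\<And>i. i \<in> S \<Longrightarrow> A i m = A m i"
  shows "(\<Sum>i\<in>insert m S. \<Sum>j\<in>insert m S. v i * A i j * v j) =
    A m m * (v m)\<^sup>2 + 2 * v m * (\<Sum>i\<in>S. A m i * v i) + (\<Sum>i\<in>S. \<Sum>j\<in>S. v i * A i j * v j)"
proof -
  have "(\<Sum>i\<in>S. v i * A i m * v m) = v m * (\<Sum>i\<in>S. A m i * v i)"
    by (simp add: sum_distrib_left mult_ac sym cong: sum.cong)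
  moreover have "(\<Sum>i\<in>S. v m * A m i * v i) = v m * (\<Sum>i\<in>S. A m i * v i)"
    by (simp add: sum_distrib_left mult_ac)
  ultimately show ?thesis
    using assms(1,2) by (simp add: sum.distrib power2_eq_square algebra_simps)
qed

lemma pos_def_on_schur:
  assumes fin: "finite S" and m: "m \<notin> S" and pd: "pos_def_on (insert m S) A"
  shows "A m m > 0" and "pos_def_on S (\<lambda>i j. A i j - A i m * A m j / A m m)"
proof -
  have sym: "A i j = A j i" if "i \<in> insert m S" "j \<in> insert m S" for i j
    using pos_def_on_sym[OF pd] that .
  note quad = quad_form_insert[OF fin m, of A, OF sym, simplified]
  \<comment> \<open>The unit vector at \<open>m\<close> tests the pivot.\<close>
  define u where "u i = (if i = m then 1 else 0 :: real)" for i
  have u0: "u i = 0" if "i \<in> S" for i using that m by (auto simp: u_def)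
  have "0 < (\<Sum>i\<in>insert m S. \<Sum>j\<in>insert m S. u i * A i j * u j)"
    by (rule pos_def_on_pos[OF pd, of m]) (auto simp: u_def)
  then show a: "A m m > 0"
    using fin m by (simp add: u0) (simp add: u_def)
  show "pos_def_on S (\<lambda>i j. A i j - A i m * A m j / A m m)"
    unfolding pos_def_on_def
  proof (intro conjI ballI allI impI)
    show "A i j - A i m * A m j / A m m = A j i - A j m * A m i / A m m" if "i \<in> S" "j \<in> S" for i j
      using sym[of i j] sym[of i m] sym[of m j] that by simp
    fix v :: "nat \<Rightarrow> real" assume "\<exists>i\<in>S. v i \<noteq> 0"
    then obtain i where i: "i \<in> S" "v i \<noteq> 0" by auto
    define s where "s = (\<Sum>i\<in>S. A m i * v i)"
    \<comment> \<open>The coordinate at \<open>m\<close> is the minimiser of the form in that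
      variable; the minimum is the Schur complement evaluated at \<open>v\<close>.\<close>
    define w where "w = v(m := - s / A m m)"
    have w: "w i = v i" if "i \<in> S" for i using that m by (auto simp: w_def)
    have "0 < (\<Sum>i\<in>insert m S. \<Sum>j\<in>insert m S. w i * A i j * w j)"
      using i by (intro pos_def_on_pos[OF pd, of i]) (auto simp: w)
    also have "\<dots> = A m m * (w m)\<^sup>2 + 2 * w m * s + (\<Sum>i\<in>S. \<Sum>j\<in>S. v i * A i j * v j)"
      using quad_form_insert[OF fin m, of A w] sym by (simp add: w s_def cong: sum.cong)
    also have "\<dots> = (\<Sum>i\<in>S. \<Sum>j\<in>S. v i * A i j * v j) - s * s / A m m"
      using a by (simp add: w_def power2_eq_square field_simps)
    also have "s * s / A m m = (\<Sum>i\<in>S. \<Sum>j\<in>S. v i * (A i m * A m j / A m m) * v j)"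
      by (simp add: s_def sum_product sum_divide_distrib sym mult_ac cong: sum.cong)
    finally show "0 < (\<Sum>i\<in>S. \<Sum>j\<in>S. v i * (A i j - A i m * A m j / A m m) * v j)"
      by (simp add: algebra_simps sum_subtractf)
  qed
qed

text \<open>The induction splits off the least index. Its column may reach all later rows, while the
  columns coming from the Schur complement are 0 in row \<open>m\<close>; this makes the factor
  lower triangular.\<close>

lemma ex_cholesky:
  assumes "finite S" "pos_def_on S A"
  shows "\<exists>C. (\<forall>i\<in>S. \<forall>k\<in>S. i < k \<longrightarrow> C i k = 0) \<and> (\<forall>k\<in>S. C k k > 0) \<and>
             (\<forall>i\<in>S. \<forall>j\<in>S. A i j = (\<Sum>k\<in>S. C i k * C j k :: real))"
  using assms
proof (induction S arbitrary: A rule: finite_linorder_min_induct)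
  case empty
  show ?case by auto
next
  case (insert m S)
  have m: "m \<notin> S" using insert.hyps by auto
  note schur = pos_def_on_schur[OF insert.hyps(1) m insert.prems]
  obtain C where C: "\<forall>i\<in>S. \<forall>k\<in>S. i < k \<longrightarrow> C i k = 0" "\<forall>k\<in>S. C k k > 0"
    "\<forall>i\<in>S. \<forall>j\<in>S. A i j - A i m * A m j / A m m = (\<Sum>k\<in>S. C i k * C j k :: real)"
    using insert.IH[OF schur(2)] by blast
  define F where "F i k = (if k = m then A i m / sqrt (A m m) else if i = m then 0 else C i k)" for i k
  have Fm: "F i m * F j m = A i m * A j m / A m m" for i j
    using schur(1) by (simp add: F_def)
  have "A i j = (\<Sum>k\<in>insert m S. F i k * F j k)" if ij: "i \<in> insert m S" "j \<in> insert m S" for i j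
  proof -
    have sym: "A j m = A m j" using pos_def_on_sym[OF insert.prems] ij by auto
    have eq: "(\<Sum>k\<in>insert m S. F i k * F j k) = A i m * A j m / A m m + (\<Sum>k\<in>S. F i k * F j k)"
      using insert.hyps(1) m by (simp add: Fm)
    show ?thesis
    proof (cases "i = m \<or> j = m")
      case True
      then have "(\<Sum>k\<in>S. F i k * F j k) = 0"
        using m by (intro sum.neutral) (auto simp: F_def)
      then show ?thesis using eq True schur(1) sym by auto
    next
      case False
      then have ij: "i \<in> S" "j \<in> S" using ij by auto
      then have "(\<Sum>k\<in>S. F i k * F j k) = (\<Sum>k\<in>S. C i k * C j k)"
        using m by (intro sum.cong) (auto simp: F_def)
      also have "\<dots> = A i j - A i m * A m j / A m m" using C(3) ij by simp
      finally show ?thesis using eq sym by simp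
    qed
  qed
  moreover have "F i k = 0" if "i \<in> insert m S" "k \<in> insert m S" "i < k" for i k
    using that insert.hyps(2) C(1) by (auto simp: F_def)
  moreover have "F k k > 0" if "k \<in> insert m S" for k
    using that schur(1) C(2) by (auto simp: F_def)
  ultimately show ?case by (intro exI[of _ F]) blast
qed

lemma det_on_cholesky:
  assumes "finite S" and "\<And>i k. i \<in> S \<Longrightarrow> k \<in> S \<Longrightarrow> i < k \<Longrightarrow> C i k = 0"
    and "\<And>i j. i \<in> S \<Longrightarrow> j \<in> S \<Longrightarrow> A i j = (\<Sum>k\<in>S. C i k * C j k)"
  shows "det_on S A = (\<Prod>k\<in>S. C k k)\<^sup>2"
proof -
  have "det_on S A = det_on S (\<lambda>i j. \<Sum>k\<in>S. C i k * (\<lambda>k j. C j k) k j)"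
    using assms(3) by (intro det_on_cong) auto
  also have "\<dots> = det_on S C * det_on S (\<lambda>k j. C j k)"
    by (rule det_on_mult[OF assms(1)])
  also have "\<dots> = (det_on S C)\<^sup>2"
    using det_on_transpose[OF assms(1), of C] by (simp add: power2_eq_square)
  also have "det_on S C = (\<Prod>k\<in>S. C k k)"
    using assms by (intro det_on_triangular) auto
  finally show ?thesis .
qed

lemma pos_def_on_det:
  assumes "finite S" "pos_def_on S A"
  shows "det_on S A > 0"
proof -
  obtain C where C: "\<forall>i\<in>S. \<forall>k\<in>S. i < k \<longrightarrow> C i k = 0" "\<forall>k\<in>S. C k k > 0"
    "\<forall>i\<in>S. \<forall>j\<in>S. A i j = (\<Sum>k\<in>S. C i k * C j k :: real)"
    using ex_cholesky[OF assms] by blast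
  have "(\<Prod>k\<in>S. C k k) > 0" using C(2) by (intro prod_pos) auto
  moreover have "det_on S A = (\<Prod>k\<in>S. C k k)\<^sup>2"
    using C by (intro det_on_cholesky[OF assms(1)]) auto
  ultimately show ?thesis by (metis zero_less_power)
qed

section \<open>Inverses of positive definite submatrices and completion of the square\<close>

lemma inv_on_eqI:
  assumes "finite S"
    and supp: "\<And>i j. B i j \<noteq> 0 \<Longrightarrow> i \<in> S \<and> j \<in> S"
    and right: "\<And>i j. i \<in> S \<Longrightarrow> j \<in> S \<Longrightarrow> (\<Sum>k\<in>S. A i k * B k j) = (if i = j then 1 else 0)"
    and left: "\<And>i j. i \<in> S \<Longrightarrow> j \<in> S \<Longrightarrow> (\<Sum>k\<in>S. B i k * A k j) = (if i = j then 1 else 0)"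
  shows "inv_on S A = B"
  unfolding inv_on_def
proof (rule the_equality, use supp right in blast)
  fix B' assume *: "(\<forall>i j. B' i j \<noteq> 0 \<longrightarrow> i \<in> S \<and> j \<in> S) \<and>
      (\<forall>i\<in>S. \<forall>j\<in>S. (\<Sum>k\<in>S. A i k * B' k j) = (if i = j then 1 else 0))"
  have "B' i j = B i j" if "i \<in> S" "j \<in> S" for i j
  proof -
    have r: "(\<Sum>l\<in>S. A k l * B' l j) = (if k = j then 1 else 0)" if "k \<in> S" for k
      using * that \<open>j \<in> S\<close> by blast
    \<comment> \<open>The chain B = B (A B') = (B A) B' = B', written in coordinates.\<close>
    have "B i j = (\<Sum>k\<in>S. B i k * (if k = j then 1 else 0))"
      using that assms(1) by (simp add: if_distrib cong: if_cong)
    also have "\<dots> = (\<Sum>k\<in>S. B i k * (\<Sum>l\<in>S. A k l * B' l j))"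
      by (intro sum.cong refl arg_cong2[where f = "(*)"] r[symmetric])
    also have "\<dots> = (\<Sum>k\<in>S. \<Sum>l\<in>S. B i k * A k l * B' l j)"
      by (simp add: sum_distrib_left mult_ac)
    also have "\<dots> = (\<Sum>l\<in>S. \<Sum>k\<in>S. B i k * A k l * B' l j)"
      by (rule sum.swap)
    also have "\<dots> = (\<Sum>l\<in>S. (\<Sum>k\<in>S. B i k * A k l) * B' l j)"
      by (simp add: sum_distrib_right)
    also have "\<dots> = (\<Sum>l\<in>S. (if i = l then 1 else 0) * B' l j)"
      by (intro sum.cong refl arg_cong2[where f = "(*)"] left \<open>i \<in> S\<close>)
    also have "\<dots> = B' i j"
      using that assms(1) by (simp add: if_distrib if_distribR cong: if_cong)
    finally show ?thesis by simp
  qed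
  moreover have "B' i j = B i j" if "\<not> (i \<in> S \<and> j \<in> S)" for i j
    using that * supp by metis
  ultimately show "B' = B" by (intro ext) blast
qed

lemma
  assumes fin: "finite S" and pd: "pos_def_on S A"
  shows inv_on_supp: "inv_on S A i j \<noteq> 0 \<Longrightarrow> i \<in> S \<and> j \<in> S"
    and inv_on_right: "i \<in> S \<Longrightarrow> j \<in> S \<Longrightarrow> (\<Sum>k\<in>S. A i k * inv_on S A k j) = (if i = j then 1 else 0)"
    and inv_on_left: "i \<in> S \<Longrightarrow> j \<in> S \<Longrightarrow> (\<Sum>k\<in>S. inv_on S A i k * A k j) = (if i = j then 1 else 0)"
    and inv_on_sym: "inv_on S A i j = inv_on S A j i"
proof -
  have nz: "det_on S A \<noteq> 0" using pos_def_on_det[OF assms] by simp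
  obtain B where B: "\<And>i j. B i j \<noteq> 0 \<Longrightarrow> i \<in> S \<and> j \<in> S"
    "\<And>i j. i \<in> S \<Longrightarrow> j \<in> S \<Longrightarrow> (\<Sum>k\<in>S. A i k * B k j) = (if i = j then 1 else 0)"
    "\<And>i j. i \<in> S \<Longrightarrow> j \<in> S \<Longrightarrow> (\<Sum>k\<in>S. B i k * A k j) = (if i = j then 1 else 0)"
    by (rule ex_inverse_on[OF fin nz]) (rule that)
  have eq: "inv_on S A = B" by (rule inv_on_eqI[OF fin B])
  have sym: "A i k = A k i" if "i \<in> S" "k \<in> S" for i k using pos_def_on_sym[OF pd that] .
  \<comment> \<open>Because \<open>A\<close> is symmetric, the transposed inverse is an inverse too;
    uniqueness then gives symmetry.\<close>
  have eq': "inv_on S A = (\<lambda>i j. B j i)"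
  proof (rule inv_on_eqI[OF fin])
    fix i j assume ij: "i \<in> S" "j \<in> S"
    have "(\<Sum>k\<in>S. A i k * B j k) = (\<Sum>k\<in>S. B j k * A k i)"
      using sym[OF ij(1)] by (intro sum.cong refl) (simp add: mult.commute)
    then show "(\<Sum>k\<in>S. A i k * B j k) = (if i = j then 1 else 0)"
      using B(3)[OF ij(2,1)] by (simp split: if_splits)
    have "(\<Sum>k\<in>S. B k i * A k j) = (\<Sum>k\<in>S. A j k * B k i)"
      using sym[OF ij(2)] by (intro sum.cong refl) (simp add: mult.commute)
    then show "(\<Sum>k\<in>S. B k i * A k j) = (if i = j then 1 else 0)"
      using B(2)[OF ij(2,1)] by (simp split: if_splits)
  qed (use B(1) in blast)
  show "inv_on S A i j \<noteq> 0 \<Longrightarrow> i \<in> S \<and> j \<in> S" using B(1) eq by auto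
  show "i \<in> S \<Longrightarrow> j \<in> S \<Longrightarrow> (\<Sum>k\<in>S. A i k * inv_on S A k j) = (if i = j then 1 else 0)"
    using B(2) eq by auto
  show "i \<in> S \<Longrightarrow> j \<in> S \<Longrightarrow> (\<Sum>k\<in>S. inv_on S A i k * A k j) = (if i = j then 1 else 0)"
    using B(3) eq by auto
  show "inv_on S A i j = inv_on S A j i"
    using fun_cong[OF fun_cong[OF eq, of j], of i] fun_cong[OF fun_cong[OF eq', of i], of j] by simp
qed

lemma inv_on_solve:
  assumes fin: "finite S" and pd: "pos_def_on S A" and i: "i \<in> S"
  shows "(\<Sum>k\<in>S. A i k * (\<Sum>l\<in>S. inv_on S A k l * v l)) = v i"
proof -
  have "(\<Sum>k\<in>S. A i k * (\<Sum>l\<in>S. inv_on S A k l * v l)) = (\<Sum>k\<in>S. \<Sum>l\<in>S. A i k * inv_on S A k l * v l)"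
    by (simp add: sum_distrib_left mult_ac)
  also have "\<dots> = (\<Sum>l\<in>S. \<Sum>k\<in>S. A i k * inv_on S A k l * v l)" by (rule sum.swap)
  also have "\<dots> = (\<Sum>l\<in>S. (\<Sum>k\<in>S. A i k * inv_on S A k l) * v l)"
    by (simp add: sum_distrib_right)
  also have "\<dots> = (\<Sum>l\<in>S. (if i = l then 1 else 0) * v l)"
    by (intro sum.cong refl arg_cong2[where f = "(*)"] inv_on_right[OF fin pd] i)
  also have "\<dots> = v i" using i fin by (simp add: if_distrib if_distribR cong: if_cong)
  finally show ?thesis .
qed

lemma inv_on_quad_nonneg:
  assumes fin: "finite S" and pd: "pos_def_on S A"
  shows "(\<Sum>i\<in>S. \<Sum>j\<in>S. v i * inv_on S A i j * v j) \<ge> 0"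
proof -
  \<comment> \<open>With w the inverse applied to v, the form becomes w^T A w, to which positive
    definiteness of \<open>A\<close> applies.\<close>
  define w where "w i = (\<Sum>j\<in>S. inv_on S A i j * v j)" for i
  have Aw: "(\<Sum>k\<in>S. A i k * w k) = v i" if i: "i \<in> S" for i
    unfolding w_def by (rule inv_on_solve[OF fin pd i])
  have "(\<Sum>i\<in>S. \<Sum>j\<in>S. v i * inv_on S A i j * v j) = (\<Sum>i\<in>S. w i * v i)"
    by (simp add: w_def sum_distrib_left mult_ac)
  also have "\<dots> = (\<Sum>i\<in>S. w i * (\<Sum>k\<in>S. A i k * w k))" by (simp add: Aw)
  also have "\<dots> = (\<Sum>i\<in>S. \<Sum>k\<in>S. w i * A i k * w k)" by (simp add: sum_distrib_left mult_ac)
  also have "\<dots> \<ge> 0"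
  proof (cases "\<exists>i\<in>S. w i \<noteq> 0")
    case True then show ?thesis using pos_def_on_pos[OF pd, of _ w] by (auto intro: less_imp_le)
  qed (auto intro!: sum_nonneg)
  finally show ?thesis .
qed

lemma det_on_inv_on:
  assumes fin: "finite S" and pd: "pos_def_on S A"
  shows "det_on S (inv_on S A) = 1 / det_on S A"
proof -
  have "det_on S A * det_on S (inv_on S A) = det_on S (\<lambda>i j. \<Sum>k\<in>S. A i k * inv_on S A k j)"
    by (rule det_on_mult[OF fin, symmetric])
  also have "\<dots> = det_on S (\<lambda>i j. if i = j then 1 else 0)"
    using inv_on_right[OF assms] by (intro det_on_cong) auto
  also have "\<dots> = 1"
    using fin by (subst det_on_triangular) auto
  finally show ?thesis using pos_def_on_det[OF assms] by (simp add: field_simps)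
qed

text \<open>\<open>mvn_density\<close> inverts its covariance, which here is itself an inverse
  divided by \<open>d\<close>; what results is the precision matrix \<open>d * A\<close>. The
  \<open>if\<close> reproduces the zero padding of \<open>inv_on\<close>.\<close>

lemma inv_on_scaled_inv_on:
  assumes fin: "finite S" and pd: "pos_def_on S A" and d: "d \<noteq> 0"
  shows "inv_on S (\<lambda>i j. inv_on S A i j / d) = (\<lambda>i j. if i \<in> S \<and> j \<in> S then d * A i j else 0)"
proof (rule inv_on_eqI[OF fin])
  fix i j assume ij: "i \<in> S" "j \<in> S"
  have "(\<Sum>k\<in>S. inv_on S A i k / d * (if k \<in> S \<and> j \<in> S then d * A k j else 0))
    = (\<Sum>k\<in>S. inv_on S A i k * A k j)"
    using d ij by (intro sum.cong) auto
  then show "(\<Sum>k\<in>S. inv_on S A i k / d * (if k \<in> S \<and> j \<in> S then d * A k j else 0))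
    = (if i = j then 1 else 0)" using inv_on_left[OF fin pd ij] by simp
  have "(\<Sum>k\<in>S. (if i \<in> S \<and> k \<in> S then d * A i k else 0) * (inv_on S A k j / d))
    = (\<Sum>k\<in>S. A i k * inv_on S A k j)"
    using d ij by (intro sum.cong) auto
  then show "(\<Sum>k\<in>S. (if i \<in> S \<and> k \<in> S then d * A i k else 0) * (inv_on S A k j / d))
    = (if i = j then 1 else 0)" using inv_on_right[OF fin pd ij] by simp
qed (auto split: if_splits)

lemma det_on_scaled_inv_on:
  assumes fin: "finite S" and pd: "pos_def_on S A"
  shows "det_on S (\<lambda>i j. inv_on S A i j / d) = 1 / (d ^ card S * det_on S A)"
proof -
  have "det_on S (\<lambda>i j. inv_on S A i j / d) = det_on S (\<lambda>i j. (1 / d) * inv_on S A i j)"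
    by simp
  then show ?thesis
    unfolding det_on_scale det_on_inv_on[OF assms] by (simp add: power_divide)
qed

text \<open>\<open>m\<close> is a column of the unit triangular factor: 1 at \<open>j\<close> and
  \<open>l\<close> on \<open>N\<close>. On \<open>N\<close>, U e is minus column \<open>j\<close> of
  U, so expanding about \<open>e\<close> absorbs the cross term; the constant left over is the Schur
  complement at \<open>j\<close>.\<close>

lemma complete_square:
  assumes fin: "finite N" and j: "j \<notin> N" and pd: "pos_def_on (insert j N) U"
    and e: "\<And>i. e i = - (\<Sum>l\<in>N. inv_on N U i l * U l j)"
    and m: "m j = 1" "\<And>i. i \<in> N \<Longrightarrow> m i = l i"
  shows "(\<Sum>i\<in>insert j N. \<Sum>k\<in>insert j N. m i * U i k * m k) =
    (U j j - (\<Sum>i\<in>N. \<Sum>l\<in>N. U i j * inv_on N U i l * U l j)) +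
    (\<Sum>i\<in>N. \<Sum>k\<in>N. (l i - e i) * U i k * (l k - e k))"
proof -
  have pdN: "pos_def_on N U" using pos_def_on_subset[OF pd] fin by auto
  have sym: "U i k = U k i" if "i \<in> insert j N" "k \<in> insert j N" for i k
    using pos_def_on_sym[OF pd that] .
  have Ue: "(\<Sum>k\<in>N. U i k * e k) = - U i j" if i: "i \<in> N" for i
    by (simp add: e sum_negf inv_on_solve[OF fin pdN i, of "\<lambda>l. U l j"])
  have c: "(\<Sum>i\<in>N. \<Sum>l\<in>N. U i j * inv_on N U i l * U l j) = - (\<Sum>i\<in>N. e i * U i j)"
    by (simp add: e sum_distrib_left sum_negf mult_ac)
  have "(\<Sum>i\<in>N. \<Sum>k\<in>N. (l i - e i) * U i k * (l k - e k)) =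
      (\<Sum>i\<in>N. \<Sum>k\<in>N. l i * U i k * l k) - (\<Sum>i\<in>N. \<Sum>k\<in>N. l i * U i k * e k)
      - (\<Sum>i\<in>N. \<Sum>k\<in>N. e i * U i k * l k) + (\<Sum>i\<in>N. \<Sum>k\<in>N. e i * U i k * e k)"
    by (simp add: algebra_simps sum_subtractf sum.distrib)
  also have "(\<Sum>i\<in>N. \<Sum>k\<in>N. l i * U i k * e k) = (\<Sum>i\<in>N. l i * (\<Sum>k\<in>N. U i k * e k))"
    by (simp add: sum_distrib_left mult_ac)
  also have "\<dots> = - (\<Sum>i\<in>N. l i * U i j)" by (simp add: Ue sum_negf)
  also have "(\<Sum>i\<in>N. \<Sum>k\<in>N. e i * U i k * l k) = (\<Sum>k\<in>N. l k * (\<Sum>i\<in>N. U k i * e i))"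
    by (subst sum.swap, unfold sum_distrib_left, intro sum.cong refl, subst sym) (simp_all add: mult_ac)
  also have "\<dots> = - (\<Sum>i\<in>N. l i * U i j)" by (simp add: Ue sum_negf)
  also have "(\<Sum>i\<in>N. \<Sum>k\<in>N. e i * U i k * e k) = (\<Sum>i\<in>N. e i * (\<Sum>k\<in>N. U i k * e k))"
    by (simp add: sum_distrib_left mult_ac)
  also have "\<dots> = - (\<Sum>i\<in>N. e i * U i j)" by (simp add: Ue sum_negf)
  finally have *: "(\<Sum>i\<in>N. \<Sum>k\<in>N. (l i - e i) * U i k * (l k - e k)) = 
    (\<Sum>i\<in>N. \<Sum>k\<in>N. l i * U i k * l k) + 2 * (\<Sum>i\<in>N. l i * U i j) - (\<Sum>i\<in>N. e i * U i j)" by simp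
  have "(\<Sum>i\<in>insert j N. \<Sum>k\<in>insert j N. m i * U i k * m k) = 
    U j j + 2 * (\<Sum>i\<in>N. l i * U i j) + (\<Sum>i\<in>N. \<Sum>k\<in>N. l i * U i k * l k)"
  proof -
    have "(\<Sum>i\<in>N. U j i * m i) = (\<Sum>i\<in>N. l i * U i j)"
      by (intro sum.cong refl) (simp add: m(2) sym[of j])
    moreover have "(\<Sum>i\<in>N. \<Sum>k\<in>N. m i * U i k * m k) = (\<Sum>i\<in>N. \<Sum>k\<in>N. l i * U i k * l k)"
      by (intro sum.cong refl) (simp add: m(2))
    moreover have "U i j = U j i" if "i \<in> N" for i using that sym by simp
    ultimately show ?thesis
      using quad_form_insert[OF fin j, of U m] m(1) by simp
  qed
  then show ?thesis unfolding * c by simp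
qed

section \<open>Modified Cholesky decomposition by elimination\<close>

context notes sum.cong [fundef_cong]
begin

text \<open>Entry \<open>i\<close> of column \<open>j\<close> of L D, that is, the column before
  division by its pivot; the column is the first index. The congruence rule \<open>sum.cong\<close>
  lets the termination proof see that \<open>k < j\<close> in the recursive calls.\<close>

function elim_col :: "rmat \<Rightarrow> nat \<Rightarrow> nat \<Rightarrow> real" where
  "elim_col A j i = A i j - (\<Sum>k\<in>{1..<j}. elim_col A k i * elim_col A k j / elim_col A k k)"
  by pat_completeness auto
termination by (relation "Wellfounded.measure (\<lambda>(A, j, i). j)") auto

end

declare elim_col.simps [simp del]

text \<open>The summand \<open>k = j\<close> is the column entry times pivot over pivot. An
  equivalence is stated because division by a zero pivot gives 0; for a nonzero pivot the right-hand
  side is trivial.\<close>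

lemma elim_col_rec:
  assumes "1 \<le> j"
  shows "A i j = (\<Sum>k\<in>{1..j}. elim_col A k i * elim_col A k j / elim_col A k k) \<longleftrightarrow>
    elim_col A j i = elim_col A j i * elim_col A j j / elim_col A j j"
proof -
  have "{1..j} = insert j {1..<j}" using assms by auto
  then show ?thesis using elim_col.simps[of A j i] by auto
qed

lemma
  assumes "is_mcd p A L D"
  shows is_mcd_L_outside: "\<not> (1 \<le> j \<and> j \<le> i \<and> i \<le> p) \<Longrightarrow> L i j = 0"
    and is_mcd_L_diag: "k \<in> {1..p} \<Longrightarrow> L k k = 1"
    and is_mcd_D_outside: "k \<notin> {1..p} \<Longrightarrow> D k = 0"
    and is_mcd_D_pos: "k \<in> {1..p} \<Longrightarrow> D k > 0"
    and is_mcd_eq: "i \<in> {1..p} \<Longrightarrow> j \<in> {1..p} \<Longrightarrow> A i j = (\<Sum>k\<in>{1..p}. L i k * D k * L j k)"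
  using assms unfolding is_mcd_def by (fastforce, blast+)

text \<open>Triangularity ends the sum for \<open>A i j\<close> at \<open>k = j\<close>, and the
  unit diagonal isolates its last term. Elimination therefore reads off the factors of any given
  decomposition, which is the source of uniqueness.\<close>

lemma is_mcd_elim_col:
  assumes mcd: "is_mcd p A L D" and "1 \<le> j" "j \<le> p" "1 \<le> i" "i \<le> p"
  shows "elim_col A j i = L i j * D j"
  using assms(2-)
proof (induction j arbitrary: i rule: less_induct)
  case (less j)
  have IH: "elim_col A k i = L i k * D k" if "k \<in> {1..<j}" "i \<in> {1..p}" for k i
    using less.IH[of k i] less.prems that by auto
  have diag: "L k k = 1" "D k \<noteq> 0" if "k \<in> {1..p}" for k
    using is_mcd_L_diag[OF mcd that] is_mcd_D_pos[OF mcd that] by auto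
  have tri: "L j k = 0" if "j < k" for k
    using is_mcd_L_outside[OF mcd] that by auto
  have "elim_col A j i = A i j - (\<Sum>k\<in>{1..<j}. L i k * D k * L j k)"
    unfolding elim_col.simps[of A j i]
    using less.prems diag by (intro arg_cong2[where f = minus] sum.cong refl) (simp add: IH)
  also have "A i j = (\<Sum>k\<in>{1..p}. L i k * D k * L j k)"
    using is_mcd_eq[OF mcd] less.prems by simp
  also have "\<dots> = (\<Sum>k\<in>insert j {1..<j}. L i k * D k * L j k)"
    using less.prems tri by (intro sum.mono_neutral_right) auto
  also have "\<dots> = L i j * D j + (\<Sum>k\<in>{1..<j}. L i k * D k * L j k)"
    using diag less.prems by simp
  finally show ?case by simp
qed

lemma is_mcd_unique:
  assumes "is_mcd p A L D" "is_mcd p A L' D'"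
  shows "L = L'" "D = D'"
proof -
  have D: "D k = D' k" for k
  proof (cases "k \<in> {1..p}")
    case True
    have "elim_col A k k = D k" if "is_mcd p A L D" for L D
      using is_mcd_elim_col[OF that, of k k] is_mcd_L_diag[OF that True] True by auto
    then show ?thesis using assms by metis
  next
    case False
    then show ?thesis using assms is_mcd_D_outside by metis
  qed
  then show "D = D'" by auto
  have "L i k = L' i k" for i k
  proof (cases "1 \<le> k \<and> k \<le> i \<and> i \<le> p")
    case True
    then have k: "k \<in> {1..p}" by auto
    have "L i k * D k = L' i k * D' k"
      using is_mcd_elim_col[OF assms(1), of k i] is_mcd_elim_col[OF assms(2), of k i] True by auto
    then show ?thesis using D is_mcd_D_pos[OF assms(1) k] by auto
  next
    case False
    then show ?thesis using assms is_mcd_L_outside by metis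
  qed
  then show "L = L'" by auto
qed

lemma is_mcd_pos_def:
  assumes mcd: "is_mcd p A L D"
  shows "pos_def_on {1..p} A"
  unfolding pos_def_on_def
proof (intro conjI ballI allI impI)
  have A: "A i j = (\<Sum>k\<in>{1..p}. L i k * D k * L j k)" if "i \<in> {1..p}" "j \<in> {1..p}" for i j
    using is_mcd_eq[OF mcd that] .
  have Dpos: "D k > 0" if "k \<in> {1..p}" for k using is_mcd_D_pos[OF mcd that] .
  show "A i j = A j i" if "i \<in> {1..p}" "j \<in> {1..p}" for i j
    using that by (simp add: A mult_ac)
  fix v :: "nat \<Rightarrow> real" assume "\<exists>i\<in>{1..p}. v i \<noteq> 0"
  then have ne: "{i\<in>{1..p}. v i \<noteq> 0} \<noteq> {}" by auto
  \<comment> \<open>At the last index where \<open>v\<close> is nonzero, the vector L^T v has the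
    entry \<open>v m\<close>, since L is unit lower triangular. This makes one of the weighted
    squares below positive.\<close>
  define m where "m = Max {i\<in>{1..p}. v i \<noteq> 0}"
  have m: "m \<in> {1..p}" "v m \<noteq> 0"
    using Max_in[OF _ ne] by (auto simp: m_def)
  have mx: "v i = 0" if "i \<in> {1..p}" "m < i" for i
    using Max_ge[of "{i\<in>{1..p}. v i \<noteq> 0}" i] that unfolding m_def by fastforce
  have "(\<Sum>i\<in>{1..p}. v i * L i m) = (\<Sum>i\<in>{m}. v i * L i m)"
  proof (rule sum.mono_neutral_right)
    show "\<forall>i\<in>{1..p} - {m}. v i * L i m = 0"
    proof
      fix i assume i: "i \<in> {1..p} - {m}"
      show "v i * L i m = 0"
      proof (cases "m < i")
        case True then show ?thesis using mx i by simp
      next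
        case False
        then have "L i m = 0" using is_mcd_L_outside[OF mcd] i by auto
        then show ?thesis by simp
      qed
    qed
  qed (use m in auto)
  also have "\<dots> = v m" using is_mcd_L_diag[OF mcd] m by simp
  finally have vm: "(\<Sum>i\<in>{1..p}. v i * L i m) = v m" .
  have "0 < (\<Sum>k\<in>{1..p}. D k * (\<Sum>i\<in>{1..p}. v i * L i k)\<^sup>2)"
  proof (rule sum_pos2[of _ m])
    show "0 < D m * (\<Sum>i\<in>{1..p}. v i * L i m)\<^sup>2"
      unfolding vm using m Dpos by simp
    show "0 \<le> D k * (\<Sum>i\<in>{1..p}. v i * L i k)\<^sup>2" if "k \<in> {1..p}" for k
      using Dpos[OF that] by simp
  qed (use m in auto)
  also have "\<dots> = (\<Sum>k\<in>{1..p}. \<Sum>i\<in>{1..p}. \<Sum>j\<in>{1..p}. v i * (L i k * D k * L j k) * v j)"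
    by (simp add: power2_eq_square sum_product sum_distrib_left mult_ac)
  also have "\<dots> = (\<Sum>i\<in>{1..p}. \<Sum>k\<in>{1..p}. \<Sum>j\<in>{1..p}. v i * (L i k * D k * L j k) * v j)"
    by (rule sum.swap)
  also have "\<dots> = (\<Sum>i\<in>{1..p}. \<Sum>j\<in>{1..p}. \<Sum>k\<in>{1..p}. v i * (L i k * D k * L j k) * v j)"
    by (rule sum.cong[OF refl], rule sum.swap)
  also have "\<dots> = (\<Sum>i\<in>{1..p}. \<Sum>j\<in>{1..p}. v i * A i j * v j)"
    by (intro sum.cong refl) (simp add: A sum_distrib_left sum_distrib_right)
  finally show "0 < (\<Sum>i\<in>{1..p}. \<Sum>j\<in>{1..p}. v i * A i j * v j)" .
qed

text \<open>The zeros outside the triangle, and those of \<open>elim_D\<close> outside the range,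
  are imposed by \<open>is_mcd\<close>; they make the factors unique as functions.\<close>

definition elim_L :: "nat \<Rightarrow> rmat \<Rightarrow> rmat" where
  "elim_L p A i j = (if 1 \<le> j \<and> j \<le> i \<and> i \<le> p then elim_col A j i / elim_col A j j else 0)"

definition elim_D :: "nat \<Rightarrow> rmat \<Rightarrow> nat \<Rightarrow> real" where
  "elim_D p A j = (if j \<in> {1..p} then elim_col A j j else 0)"

text \<open>On and below the diagonal the recursion can be undone as soon as the pivots do not
  vanish; symmetry provides the upper triangle.\<close>

lemma is_mcd_elim:
  assumes sym: "\<And>i j. i \<in> {1..p} \<Longrightarrow> j \<in> {1..p} \<Longrightarrow> A i j = A j i"
    and pos: "\<And>j. j \<in> {1..p} \<Longrightarrow> elim_col A j j > 0"
  shows "is_mcd p A (elim_L p A) (elim_D p A)"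
proof -
  have le: "A i j = (\<Sum>k\<in>{1..p}. elim_L p A i k * elim_D p A k * elim_L p A j k)"
    if "1 \<le> j" "j \<le> i" "i \<le> p" for i j
  proof -
    have "elim_col A j j \<noteq> 0" using pos[of j] that by auto
    then have "A i j = (\<Sum>k\<in>{1..j}. elim_col A k i * elim_col A k j / elim_col A k k)"
      using that by (subst elim_col_rec) auto
    also have "\<dots> = (\<Sum>k\<in>{1..j}. elim_L p A i k * elim_D p A k * elim_L p A j k)"
      using that pos by (intro sum.cong refl) (force simp: elim_L_def elim_D_def)
    also have "\<dots> = (\<Sum>k\<in>{1..p}. elim_L p A i k * elim_D p A k * elim_L p A j k)"
      using that by (intro sum.mono_neutral_left) (auto simp: elim_L_def)
    finally show ?thesis .
  qed
  have "A i j = (\<Sum>k\<in>{1..p}. elim_L p A i k * elim_D p A k * elim_L p A j k)"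
    if ij: "i \<in> {1..p}" "j \<in> {1..p}" for i j
  proof (cases "j \<le> i")
    case True then show ?thesis using le ij by auto
  next
    case False
    then show ?thesis using le[of i j] sym[OF ij] ij by (simp add: mult_ac)
  qed
  then show ?thesis
    using pos unfolding is_mcd_def
    by (auto simp: elim_L_def elim_D_def split: if_splits) (metis less_irrefl atLeastAtMost_iff One_nat_def)+
qed

lemma pos_def_imp_ex_mcd:
  assumes "pos_def_on {1..p} A"
  shows "\<exists>L D. is_mcd p A L D"
proof -
  obtain C where C: "\<forall>i\<in>{1..p}. \<forall>k\<in>{1..p}. i < k \<longrightarrow> C i k = 0" "\<forall>k\<in>{1..p}. C k k > 0"
    "\<forall>i\<in>{1..p}. \<forall>j\<in>{1..p}. A i j = (\<Sum>k\<in>{1..p}. C i k * C j k :: real)"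
    using ex_cholesky[OF _ assms] by auto
  \<comment> \<open>Dividing each Cholesky column by its diagonal entry turns C C^T into L D L^T,
    with the squared diagonal entries as pivots.\<close>
  define L where "L i k = (if i \<in> {1..p} \<and> k \<in> {1..p} then C i k / C k k else 0)" for i k
  define D where "D k = (if k \<in> {1..p} then (C k k)\<^sup>2 else 0)" for k
  have nz: "C k k \<noteq> 0" if "k \<in> {1..p}" for k using C(2) that by force
  have "is_mcd p A L D"
    unfolding is_mcd_def
  proof (intro conjI)
    show "\<forall>i j. L i j \<noteq> 0 \<longrightarrow> i \<in> {1..p} \<and> j \<in> {1..p} \<and> j \<le> i"
      using C(1) by (auto simp: L_def split: if_splits) (meson atLeastAtMost_iff not_le)
    show "\<forall>i\<in>{1..p}. L i i = 1" using nz by (auto simp: L_def)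
    show "\<forall>k. D k \<noteq> 0 \<longrightarrow> k \<in> {1..p}" by (auto simp: D_def)
    show "\<forall>k\<in>{1..p}. 0 < D k" using C(2) by (auto simp: D_def)
    show "\<forall>i\<in>{1..p}. \<forall>j\<in>{1..p}. A i j = (\<Sum>k\<in>{1..p}. L i k * D k * L j k)"
    proof (intro ballI)
      fix i j assume ij: "i \<in> {1..p}" "j \<in> {1..p}"
      have "A i j = (\<Sum>k\<in>{1..p}. C i k * C j k)" using C(3) ij by blast
      also have "\<dots> = (\<Sum>k\<in>{1..p}. L i k * D k * L j k)"
      proof (rule sum.cong)
        fix k assume k: "k \<in> {1..p}"
        then show "C i k * C j k = L i k * D k * L j k"
          using ij nz[OF k] unfolding L_def D_def by (simp add: power2_eq_square)
      qed simp
      finally show "A i j = (\<Sum>k\<in>{1..p}. L i k * D k * L j k)" .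
    qed
  qed
  then show ?thesis by blast
qed

text \<open>The pivot criterion replaces a condition on all vectors by finitely many inequalities,
  which is what makes positive definiteness a measurable event.\<close>

lemma pos_def_iff_elim_col:
  assumes sym: "\<And>i j. i \<in> {1..p} \<Longrightarrow> j \<in> {1..p} \<Longrightarrow> A i j = A j i"
  shows "pos_def_on {1..p} A \<longleftrightarrow> (\<forall>j\<in>{1..p}. elim_col A j j > 0)"
proof
  assume "pos_def_on {1..p} A"
  then obtain L D where mcd: "is_mcd p A L D" using pos_def_imp_ex_mcd by blast
  show "\<forall>j\<in>{1..p}. elim_col A j j > 0"
  proof
    fix j assume j: "j \<in> {1..p}"
    then show "elim_col A j j > 0"
      using is_mcd_elim_col[OF mcd, of j j] is_mcd_L_diag[OF mcd j] is_mcd_D_pos[OF mcd j] by simp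
  qed
next
  assume "\<forall>j\<in>{1..p}. elim_col A j j > 0"
  then show "pos_def_on {1..p} A"
    by (intro is_mcd_pos_def[OF is_mcd_elim] sym) auto
qed

lemma The_mcd:
  assumes sym: "\<And>i j. i \<in> {1..p} \<Longrightarrow> j \<in> {1..p} \<Longrightarrow> A i j = A j i"
  shows "(THE (L, D). is_mcd p A L D) =
    (if \<forall>j\<in>{1..p}. elim_col A j j > 0 then (elim_L p A, elim_D p A) else (THE _. False))"
proof (cases "\<forall>j\<in>{1..p}. elim_col A j j > 0")
  case True
  then have "is_mcd p A (elim_L p A) (elim_D p A)"
    by (intro is_mcd_elim sym) auto
  then have "(THE (L, D). is_mcd p A L D) = (elim_L p A, elim_D p A)"
    using is_mcd_unique[of p A] by (intro the_equality) auto
  then show ?thesis using True by simp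
next
  case False
  then have "\<not> is_mcd p A L D" for L D
    using is_mcd_pos_def[of p A L D] pos_def_iff_elim_col[of p A] sym by blast
  then have "(\<lambda>(L, D). is_mcd p A L D) = (\<lambda>_. False)" by auto
  then show ?thesis using False by auto
qed

lemma omega_of_sym: "omega_of p E x i j = omega_of p E x j i"
  by (auto simp: omega_of_def free_idx_def)

text \<open>On matrices that are not positive definite, the modified Cholesky factors are
  a fixed junk value; this is what makes them measurable on all of \<^const>\<open>gw_space\<close>.\<close>

lemma mcd_omega_of:
  defines "P p E x \<equiv> \<forall>j\<in>{1..p}. elim_col (omega_of p E x) j j > 0"
  shows "mcd_L p (omega_of p E x) = (if P p E x then elim_L p (omega_of p E x) else fst (THE _ :: rmat \<times> (nat \<Rightarrow> real). False))"
    and "mcd_D p (omega_of p E x) = (if P p E x then elim_D p (omega_of p E x) else snd (THE _ :: rmat \<times> (nat \<Rightarrow> real). False))"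
    and "pos_def_on {1..p} (omega_of p E x) \<longleftrightarrow> P p E x"
  unfolding mcd_L_def mcd_D_def P_def
proof -
  have sym: "\<And>i j. i \<in> {1..p} \<Longrightarrow> j \<in> {1..p} \<Longrightarrow> omega_of p E x i j = omega_of p E x j i"
    by (rule omega_of_sym)
  show "fst (THE (L, D). is_mcd p (omega_of p E x) L D) =
    (if \<forall>j\<in>{1..p}. 0 < elim_col (omega_of p E x) j j then elim_L p (omega_of p E x)
     else fst (THE _ :: rmat \<times> (nat \<Rightarrow> real). False))"
    unfolding The_mcd[of p "omega_of p E x", OF omega_of_sym] by simp
  show "snd (THE (L, D). is_mcd p (omega_of p E x) L D) =
    (if \<forall>j\<in>{1..p}. 0 < elim_col (omega_of p E x) j j then elim_D p (omega_of p E x)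
     else snd (THE _ :: rmat \<times> (nat \<Rightarrow> real). False))"
    unfolding The_mcd[of p "omega_of p E x", OF omega_of_sym] by simp
  show "pos_def_on {1..p} (omega_of p E x) \<longleftrightarrow> (\<forall>j\<in>{1..p}. 0 < elim_col (omega_of p E x) j j)"
    by (rule pos_def_iff_elim_col[of p "omega_of p E x", OF sym])
qed

section \<open>Triangular changes of variables\<close>

interpretation lborel_prod: product_sigma_finite "\<lambda>_. lborel :: real measure"
  by standard

text \<open>Fubini, removing a coordinate of largest rank: no shift depends on it, so the inner
  integral is a one-dimensional affine substitution. Shifts depend on strictly smaller ranks, so
  ties are harmless. The rank will be the column for elimination coordinates, the reversed index for
  Gaussian integrals, and arbitrary for a pure scaling.\<close>

lemma nn_integral_PiM_triangular:
  fixes f :: "('i \<Rightarrow> real) \<Rightarrow> ennreal" and r :: "'i \<Rightarrow> 'r::linorder"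
  assumes "finite I" and "f \<in> borel_measurable (PiM I (\<lambda>_. lborel))"
    and "\<And>k. k \<in> I \<Longrightarrow> b k \<in> borel_measurable (PiM I (\<lambda>_. lborel))"
    and "\<And>k x y. k \<in> I \<Longrightarrow> (\<And>i. i \<in> I \<Longrightarrow> r i < r k \<Longrightarrow> x i = y i) \<Longrightarrow> b k x = b k y"
    and "\<And>k. k \<in> I \<Longrightarrow> a k \<noteq> (0::real)"
  shows "(\<integral>\<^sup>+ x. f x \<partial>PiM I (\<lambda>_. lborel)) =
    ennreal (\<Prod>k\<in>I. \<bar>a k\<bar>) * (\<integral>\<^sup>+ x. f (\<lambda>k\<in>I. a k * x k + b k x) \<partial>PiM I (\<lambda>_. lborel))"
  using assms
proof (induction "card I" arbitrary: I f)
  case 0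
  then have "I = {}" by (metis card_0_eq)
  then show ?case by (simp add: PiM_empty nn_integral_count_space_finite)
next
  case (Suc n)
  note fin = Suc.prems(1) and b = Suc.prems(3) and dep = Suc.prems(4) and a = Suc.prems(5)
  have ne: "I \<noteq> {}" using Suc.hyps(2) by auto
  then have "Max (r ` I) \<in> r ` I" using fin by (intro Max_in) auto
  then obtain m where m: "m \<in> I" "r m = Max (r ` I)" by auto
  have mx: "r i \<le> r m" if "i \<in> I" for i using m fin that by simp
  define J where "J = I - {m}"
  have I: "I = insert m J" and mJ: "m \<notin> J" and finJ: "finite J" using m fin by (auto simp: J_def)
  have cardJ: "n = card J" using Suc.hyps(2) mJ finJ by (simp add: I)
  have [measurable]: "f \<in> borel_measurable (PiM (insert m J) (\<lambda>_. lborel))"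
    using Suc.prems(2) by (simp add: I)
  \<comment> \<open>By strictness, even \<open>b m\<close> ignores coordinate
    \<open>m\<close>.\<close>
  have bJ: "b k (x(m := t)) = b k x" if "k \<in> I" for k x t
    using mx[OF that] by (intro dep[OF that]) auto
  have [measurable]: "b k \<in> borel_measurable (PiM J (\<lambda>_. lborel))" if "k \<in> I" for k
  proof -
    \<comment> \<open>Freezing coordinate \<open>m\<close> at 0 transfers measurability from the
      product over \<open>I\<close> to that over \<open>J\<close>.\<close>
    have "(\<lambda>x. b k (x(m := 0))) \<in> borel_measurable (PiM J (\<lambda>_. lborel))"
      using b[OF that] by (intro measurable_compose[OF _ b[OF that]]) (simp add: I)
    then show ?thesis by (simp add: bJ that)
  qed
  let ?g = "\<lambda>x. \<integral>\<^sup>+ t. f (x(m := t)) \<partial>lborel"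
  let ?TJ = "\<lambda>x. \<lambda>k\<in>J. a k * x k + b k x"
  have TJ [measurable]: "?TJ \<in> measurable (PiM J (\<lambda>_. lborel)) (PiM J (\<lambda>_. lborel))"
    by (rule measurable_restrict) (auto simp: I)
  have T [measurable]: "(\<lambda>x. \<lambda>k\<in>insert m J. a k * x k + b k x) 
      \<in> measurable (PiM (insert m J) (\<lambda>_. lborel)) (PiM (insert m J) (\<lambda>_. lborel))"
    using b by (intro measurable_restrict) (auto simp: I)
  have "(\<integral>\<^sup>+ x. f x \<partial>PiM I (\<lambda>_. lborel)) = (\<integral>\<^sup>+ x. ?g x \<partial>PiM J (\<lambda>_. lborel))"
    unfolding I by (rule lborel_prod.product_nn_integral_insert[OF finJ mJ]) measurable
  also have "\<dots> = ennreal (\<Prod>k\<in>J. \<bar>a k\<bar>) * (\<integral>\<^sup>+ x. ?g (?TJ x) \<partial>PiM J (\<lambda>_. lborel))"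
  proof (rule Suc.hyps(1)[OF cardJ finJ])
    show "?g \<in> borel_measurable (PiM J (\<lambda>_. lborel))" by measurable
    show "b k x = b k y" if "k \<in> J" "\<And>i. i \<in> J \<Longrightarrow> r i < r k \<Longrightarrow> x i = y i" for k x y
      using that mx[of k] by (intro dep) (auto simp: I)
  qed (auto simp: I a)
  also have "(\<integral>\<^sup>+ x. ?g (?TJ x) \<partial>PiM J (\<lambda>_. lborel)) =
     (\<integral>\<^sup>+ x. \<bar>a m\<bar> * (\<integral>\<^sup>+ t. f (\<lambda>k\<in>I. a k * (x(m := t)) k + b k (x(m := t))) \<partial>lborel) \<partial>PiM J (\<lambda>_. lborel))"
  proof (rule nn_integral_cong)
    fix x assume x: "x \<in> space (PiM J (\<lambda>_. lborel :: real measure))"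
    have [measurable]: "(\<lambda>t. f ((?TJ x)(m := t))) \<in> borel_measurable borel"
      using measurable_space[OF TJ x] by measurable
    have *: "?g (?TJ x) = \<bar>a m\<bar> * (\<integral>\<^sup>+ t. f ((?TJ x)(m := b m x + a m * t)) \<partial>lborel)"
      using a m by (intro nn_integral_real_affine) auto
    have eq: "(?TJ x)(m := b m x + a m * t) = (\<lambda>k\<in>I. a k * (x(m := t)) k + b k (x(m := t)))" for t
      using mJ m bJ by (auto simp: I fun_eq_iff restrict_def)
    show "?g (?TJ x) = 
      \<bar>a m\<bar> * (\<integral>\<^sup>+ t. f (\<lambda>k\<in>I. a k * (x(m := t)) k + b k (x(m := t))) \<partial>lborel)"
      using * unfolding eq .
  qed
  also have "\<dots> = \<bar>a m\<bar> * (\<integral>\<^sup>+ x. (\<integral>\<^sup>+ t. f (\<lambda>k\<in>I. a k * (x(m := t)) k + b k (x(m := t))) \<partial>lborel) \<partial>PiM J (\<lambda>_. lborel))"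
    unfolding I by (rule nn_integral_cmult) measurable
  also have "(\<integral>\<^sup>+ x. (\<integral>\<^sup>+ t. f (\<lambda>k\<in>I. a k * (x(m := t)) k + b k (x(m := t))) \<partial>lborel) \<partial>PiM J (\<lambda>_. lborel)) 
     = (\<integral>\<^sup>+ x. f (\<lambda>k\<in>I. a k * x k + b k x) \<partial>PiM I (\<lambda>_. lborel))"
    unfolding I by (rule lborel_prod.product_nn_integral_insert[OF finJ mJ, symmetric]) measurable
  also have "ennreal (\<Prod>k\<in>J. \<bar>a k\<bar>) * (ennreal \<bar>a m\<bar> * X) = ennreal (\<Prod>k\<in>I. \<bar>a k\<bar>) * X" for X
    using finJ mJ by (simp add: I ennreal_mult' prod_nonneg mult_ac)
  finally show ?case .
qed

text \<open>Renaming coordinates preserves product Lebesgue measure, as is checked on boxes. It will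
  turn the pairs that index one column into row indices.\<close>

lemma nn_integral_PiM_reindex:
  fixes f :: "('j \<Rightarrow> real) \<Rightarrow> ennreal"
  assumes fin: "finite N" and inj: "inj_on h N"
    and g: "\<And>i. i \<in> N \<Longrightarrow> g (h i) = i"
    and [measurable]: "f \<in> borel_measurable (PiM (h ` N) (\<lambda>_. lborel))"
  shows "(\<integral>\<^sup>+ x. f x \<partial>PiM (h ` N) (\<lambda>_. lborel)) =
    (\<integral>\<^sup>+ x. f (\<lambda>k\<in>h ` N. x (g k)) \<partial>PiM N (\<lambda>_. lborel))"
proof -
  have meas [measurable]: "(\<lambda>x. \<lambda>k\<in>h ` N. x (g k)) \<in> measurable (PiM N (\<lambda>_. lborel :: real measure)) (PiM (h ` N) (\<lambda>_. lborel))"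
    by (rule measurable_restrict) (auto simp: g)
  have "distr (PiM N (\<lambda>_. lborel)) (PiM (h ` N) (\<lambda>_. lborel)) (\<lambda>x. \<lambda>k\<in>h ` N. x (g k)) = PiM (h ` N) (\<lambda>_. lborel :: real measure)"
  proof (rule lborel_prod.PiM_eqI)
    fix A :: "'j \<Rightarrow> real set" assume A: "\<And>i. i \<in> h ` N \<Longrightarrow> A i \<in> sets lborel"
    have "emeasure (distr (PiM N (\<lambda>_. lborel)) (PiM (h ` N) (\<lambda>_. lborel)) (\<lambda>x. \<lambda>k\<in>h ` N. x (g k))) (Pi\<^sub>E (h ` N) A)
      = emeasure (PiM N (\<lambda>_. lborel)) ((\<lambda>x. \<lambda>k\<in>h ` N. x (g k)) -` Pi\<^sub>E (h ` N) A \<inter> space (PiM N (\<lambda>_. lborel :: real measure)))"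
      using A fin by (intro emeasure_distr meas sets_PiM_I_finite) auto
    also have "(\<lambda>x. \<lambda>k\<in>h ` N. x (g k)) -` Pi\<^sub>E (h ` N) A \<inter> space (PiM N (\<lambda>_. lborel :: real measure)) = Pi\<^sub>E N (\<lambda>i. A (h i))"
      by (auto simp: space_PiM PiE_iff g)
    also have "emeasure (PiM N (\<lambda>_. lborel)) (Pi\<^sub>E N (\<lambda>i. A (h i))) = (\<Prod>i\<in>N. emeasure lborel (A (h i)))"
      using A fin by (intro lborel_prod.emeasure_PiM) auto
    also have "\<dots> = (\<Prod>i\<in>h ` N. emeasure lborel (A i))"
      by (simp add: prod.reindex[OF inj])
    finally show "emeasure (distr (PiM N (\<lambda>_. lborel)) (PiM (h ` N) (\<lambda>_. lborel)) (\<lambda>x. \<lambda>k\<in>h ` N. x (g k))) (Pi\<^sub>E (h ` N) A)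
      = (\<Prod>i\<in>h ` N. emeasure lborel (A i))" .
  qed (use fin in auto)
  then have "(\<integral>\<^sup>+ x. f x \<partial>PiM (h ` N) (\<lambda>_. lborel)) = 
    (\<integral>\<^sup>+ x. f x \<partial>distr (PiM N (\<lambda>_. lborel)) (PiM (h ` N) (\<lambda>_. lborel)) (\<lambda>x. \<lambda>k\<in>h ` N. x (g k)))"
    by simp
  also have "\<dots> = (\<integral>\<^sup>+ x. f (\<lambda>k\<in>h ` N. x (g k)) \<partial>PiM N (\<lambda>_. lborel))"
    by (rule nn_integral_distr[OF meas]) measurable
  finally show ?thesis .
qed

section \<open>Second moments of standard normal vectors\<close>

lemma std_normal_second_moment:
  "(\<integral>\<^sup>+ t. ennreal ((c + u * t)\<^sup>2 * std_normal_density t) \<partial>lborel) = ennreal (c\<^sup>2 + u\<^sup>2)"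
proof -
  have "has_bochner_integral lborel (\<lambda>t. c\<^sup>2 * std_normal_density t + 2 * c * u * (std_normal_density t * t) + u\<^sup>2 * (std_normal_density t * t\<^sup>2)) (c\<^sup>2 * 1 + 2 * c * u * 0 + u\<^sup>2 * 1)"
    using std_normal_moment_even[of 0] std_normal_moment_odd[of 0] std_normal_moment_even[of 1]
    by (intro has_bochner_integral_add has_bochner_integral_mult_right) (auto simp: fact_numeral)
  then have *: "has_bochner_integral lborel (\<lambda>t. (c + u * t)\<^sup>2 * std_normal_density t) (c\<^sup>2 + u\<^sup>2)"
    by (simp add: power2_eq_square algebra_simps)
  then show ?thesis
    by (subst nn_integral_eq_integral) (auto simp: has_bochner_integral_iff)
qed

lemma std_normal_total: "(\<integral>\<^sup>+ t. ennreal (std_normal_density t) \<partial>lborel) = 1"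
  using std_normal_second_moment[of 1 0] by simp

lemma std_normal_PiM_total:
  assumes "finite S"
  shows "(\<integral>\<^sup>+ z. ennreal (\<Prod>k\<in>S. std_normal_density (z k)) \<partial>PiM S (\<lambda>_. lborel)) = 1"
  using lborel_prod.product_nn_integral_prod[OF assms, of "\<lambda>_ t. ennreal (std_normal_density t)"]
  by (simp add: prod_ennreal std_normal_total)

text \<open>The coordinates not yet integrated act as the shift in the one-dimensional moment, so
  every coordinate contributes just its \<open>(u k)\<^sup>2\<close>.\<close>

lemma std_normal_PiM_second_moment:
  assumes "finite S"
  shows "(\<integral>\<^sup>+ z. ennreal ((c + (\<Sum>k\<in>S. u k * z k))\<^sup>2 * (\<Prod>k\<in>S. std_normal_density (z k))) \<partial>PiM S (\<lambda>_. lborel))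
    = ennreal (c\<^sup>2 + (\<Sum>k\<in>S. (u k)\<^sup>2))"
  using assms
proof (induction S arbitrary: c)
  case empty
  show ?case by (simp add: PiM_empty nn_integral_count_space_finite)
next
  case (insert m S)
  let ?\<phi> = "\<lambda>z. \<Prod>k\<in>S. std_normal_density (z k)"
  have "(\<integral>\<^sup>+ z. ennreal ((c + (\<Sum>k\<in>insert m S. u k * z k))\<^sup>2 * (\<Prod>k\<in>insert m S. std_normal_density (z k))) \<partial>PiM (insert m S) (\<lambda>_. lborel))
    = (\<integral>\<^sup>+ z. \<integral>\<^sup>+ t. ennreal ((c + (\<Sum>k\<in>insert m S. u k * (z(m := t)) k))\<^sup>2 * (\<Prod>k\<in>insert m S. std_normal_density ((z(m := t)) k))) \<partial>lborel \<partial>PiM S (\<lambda>_. lborel))"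
    by (rule lborel_prod.product_nn_integral_insert[OF insert.hyps]) measurable
  also have "\<dots> = (\<integral>\<^sup>+ z. \<integral>\<^sup>+ t. ennreal (?\<phi> z) * ennreal (((c + (\<Sum>k\<in>S. u k * z k)) + u m * t)\<^sup>2 * std_normal_density t) \<partial>lborel \<partial>PiM S (\<lambda>_. lborel))"
  proof (intro nn_integral_cong)
    fix z :: "'a \<Rightarrow> real" and t
    have "(\<Sum>k\<in>S. u k * (z(m := t)) k) = (\<Sum>k\<in>S. u k * z k)"
      "(\<Prod>k\<in>S. std_normal_density ((z(m := t)) k)) = ?\<phi> z"
      using insert.hyps by (auto intro!: sum.cong prod.cong)
    then show "ennreal ((c + (\<Sum>k\<in>insert m S. u k * (z(m := t)) k))\<^sup>2 * (\<Prod>k\<in>insert m S. std_normal_density ((z(m := t)) k)))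
      = ennreal (?\<phi> z) * ennreal (((c + (\<Sum>k\<in>S. u k * z k)) + u m * t)\<^sup>2 * std_normal_density t)"
      using insert.hyps by (simp add: ennreal_mult'[symmetric] prod_nonneg mult_ac add_ac)
  qed
  also have "\<dots> = (\<integral>\<^sup>+ z. ennreal (?\<phi> z) * ennreal ((c + (\<Sum>k\<in>S. u k * z k))\<^sup>2 + (u m)\<^sup>2) \<partial>PiM S (\<lambda>_. lborel))"
    by (subst nn_integral_cmult) (auto simp: std_normal_second_moment)
  also have "\<dots> = (\<integral>\<^sup>+ z. ennreal ((c + (\<Sum>k\<in>S. u k * z k))\<^sup>2 * ?\<phi> z) + ennreal ((u m)\<^sup>2) * ennreal (?\<phi> z) \<partial>PiM S (\<lambda>_. lborel))"
    by (intro nn_integral_cong) (simp add: ennreal_mult'[symmetric] ennreal_plus[symmetric] prod_nonneg algebra_simps del: ennreal_plus)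
  also have "\<dots> = ennreal (c\<^sup>2 + (\<Sum>k\<in>S. (u k)\<^sup>2)) + ennreal ((u m)\<^sup>2)"
    by (subst nn_integral_add) (auto simp: nn_integral_cmult insert.IH std_normal_PiM_total[OF insert.hyps(1)])
  also have "\<dots> = ennreal (c\<^sup>2 + (\<Sum>k\<in>insert m S. (u k)\<^sup>2))"
    using insert.hyps by (simp add: ennreal_plus[symmetric] sum_nonneg add_ac del: ennreal_plus)
  finally show ?case .
qed

section \<open>Gaussian and Gamma integrals\<close>

text \<open>Under the Gaussian density with precision matrix \<open>A = C C\<^sup>T\<close>, the coordinates of
  \<open>C\<^sup>T (x - \<mu>)\<close> are independent standard normal.\<close>

lemma nn_integral_gauss_whiten:
  fixes A C :: rmat and \<mu> :: "nat \<Rightarrow> real"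
  assumes fin: "finite S"
    and C0: "\<And>i k. i \<in> S \<Longrightarrow> k \<in> S \<Longrightarrow> i < k \<Longrightarrow> C i k = 0"
    and Cpos: "\<And>k. k \<in> S \<Longrightarrow> C k k > 0"
    and A: "\<And>i j. i \<in> S \<Longrightarrow> j \<in> S \<Longrightarrow> A i j = (\<Sum>k\<in>S. C i k * C j k)"
    and q [measurable]: "q \<in> borel_measurable (PiM S (\<lambda>_. lborel))"
    and q_nonneg: "\<And>z. q z \<ge> 0"
  defines "T x \<equiv> \<lambda>k\<in>S. \<Sum>i\<in>S. C i k * (x i - \<mu> i)"
  shows "(\<integral>\<^sup>+ x. ennreal (q (T x) * ((2 * pi) powr (- real (card S) / 2) * sqrt (det_on S A) *
        exp (- (1/2) * (\<Sum>i\<in>S. \<Sum>l\<in>S. (x i - \<mu> i) * A i l * (x l - \<mu> l))))) \<partial>PiM S (\<lambda>_. lborel))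
    = (\<integral>\<^sup>+ z. ennreal (q z * (\<Prod>k\<in>S. std_normal_density (z k))) \<partial>PiM S (\<lambda>_. lborel))"
proof -
  \<comment> \<open>Coordinate \<open>k\<close> of the whitened point is affine in
    \<open>x k\<close> with slope \<open>C k k\<close>; \<open>b\<close> collects the remaining
    terms.\<close>
  define b where "b k x = (\<Sum>i\<in>S - {k}. C i k * x i) - (\<Sum>i\<in>S. C i k * \<mu> i)" for k and x :: "nat \<Rightarrow> real"
  have T: "T x = (\<lambda>k\<in>S. C k k * x k + b k x)" for x
    by (auto simp: T_def b_def fun_eq_iff restrict_def sum.remove[OF fin] right_diff_distrib sum_subtractf)
  have Tm [measurable]: "T \<in> measurable (PiM S (\<lambda>_. lborel)) (PiM S (\<lambda>_. lborel))"
    unfolding T_def[abs_def] by (rule measurable_restrict) measurable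
  have [measurable]: "(\<lambda>x. T x k) \<in> borel_measurable (PiM S (\<lambda>_. lborel))" if "k \<in> S" for k
    using measurable_compose[OF Tm measurable_component_singleton[OF that]] by simp
  have prodpos: "(\<Prod>k\<in>S. C k k) > 0" using Cpos by (intro prod_pos) auto
  \<comment> \<open>The root of the determinant of the precision is the Jacobian of whitening, which
    is why it disappears on the normal side.\<close>
  have det: "sqrt (det_on S A) = (\<Prod>k\<in>S. C k k)"
    using det_on_cholesky[OF fin, of C A] C0 A prodpos by simp
  have quad: "(\<Sum>k\<in>S. (T x k)\<^sup>2) = (\<Sum>i\<in>S. \<Sum>l\<in>S. (x i - \<mu> i) * A i l * (x l - \<mu> l))" for x
  proof -
    have "(\<Sum>k\<in>S. (T x k)\<^sup>2) = (\<Sum>k\<in>S. \<Sum>i\<in>S. \<Sum>l\<in>S. (x i - \<mu> i) * (C i k * C l k) * (x l - \<mu> l))"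
      by (simp add: T_def power2_eq_square sum_product mult_ac)
    also have "\<dots> = (\<Sum>i\<in>S. \<Sum>k\<in>S. \<Sum>l\<in>S. (x i - \<mu> i) * (C i k * C l k) * (x l - \<mu> l))"
      by (rule sum.swap)
    also have "\<dots> = (\<Sum>i\<in>S. \<Sum>l\<in>S. \<Sum>k\<in>S. (x i - \<mu> i) * (C i k * C l k) * (x l - \<mu> l))"
      by (rule sum.cong[OF refl], rule sum.swap)
    also have "\<dots> = (\<Sum>i\<in>S. \<Sum>l\<in>S. (x i - \<mu> i) * A i l * (x l - \<mu> l))"
      by (intro sum.cong refl) (simp add: A sum_distrib_left sum_distrib_right)
    finally show ?thesis .
  qed
  have prod: "(\<Prod>k\<in>S. std_normal_density (z k)) = 
      (2 * pi) powr (- real (card S) / 2) * exp (- (1/2) * (\<Sum>k\<in>S. (z k)\<^sup>2))" for z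
  proof -
    have "std_normal_density t = (2 * pi) powr (-1/2) * exp (- (1/2) * t\<^sup>2)" for t
      by (simp add: std_normal_density_def powr_minus powr_half_sqrt divide_simps)
    then have "(\<Prod>k\<in>S. std_normal_density (z k)) = ((2 * pi) powr (-1/2)) ^ card S * exp (\<Sum>k\<in>S. - (1/2) * (z k)\<^sup>2)"
      using fin by (simp add: prod.distrib exp_sum)
    also have "((2 * pi) powr (-1/2)) ^ card S = (2 * pi) powr (- real (card S) / 2)"
      by (subst powr_realpow[symmetric]) (auto simp: powr_powr)
    finally show ?thesis by (simp add: sum_distrib_left sum_negf)
  qed
  have "(\<integral>\<^sup>+ z. ennreal (q z * (\<Prod>k\<in>S. std_normal_density (z k))) \<partial>PiM S (\<lambda>_. lborel)) =
    ennreal (\<Prod>k\<in>S. \<bar>C k k\<bar>) * (\<integral>\<^sup>+ x. ennreal (q (\<lambda>k\<in>S. C k k * x k + b k x) * 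
      (\<Prod>k\<in>S. std_normal_density ((\<lambda>k\<in>S. C k k * x k + b k x) k))) \<partial>PiM S (\<lambda>_. lborel))"
  \<comment> \<open>Coordinate \<open>k\<close> of C^T x involves only rows \<open>i\<close> with
    \<open>i \<ge> k\<close>, so dependence runs towards larger indices; negation makes the index a
    rank.\<close>
  proof (rule nn_integral_PiM_triangular[OF fin, where r = "\<lambda>i. - int i"])
    show "b k \<in> borel_measurable (PiM S (\<lambda>_. lborel))" if "k \<in> S" for k
      unfolding b_def[abs_def] by measurable
    show "b k x = b k y" if "k \<in> S" and eq: "\<And>i. i \<in> S \<Longrightarrow> - int i < - int k \<Longrightarrow> x i = y i" for k x y
    proof -
      have "C i k * x i = C i k * y i" if "i \<in> S - {k}" for i
        using C0[of i k] \<open>k \<in> S\<close> eq[of i] that by (cases "i < k") auto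
      then have "(\<Sum>i\<in>S - {k}. C i k * x i) = (\<Sum>i\<in>S - {k}. C i k * y i)"
        by (intro sum.cong refl)
      then show ?thesis unfolding b_def by simp
    qed
    show "C k k \<noteq> 0" if "k \<in> S" for k using Cpos[OF that] by simp
  qed measurable
  also have "\<dots> = (\<integral>\<^sup>+ x. ennreal (\<Prod>k\<in>S. C k k) * ennreal (q (T x) * 
      (\<Prod>k\<in>S. std_normal_density (T x k))) \<partial>PiM S (\<lambda>_. lborel))"
  proof -
    have "(\<Prod>k\<in>S. \<bar>C k k\<bar>) = (\<Prod>k\<in>S. C k k)" using Cpos by (intro prod.cong refl abs_of_pos)
    moreover have "(\<lambda>x. ennreal (q (T x) * (\<Prod>k\<in>S. std_normal_density (T x k))))
        \<in> borel_measurable (PiM S (\<lambda>_. lborel))"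
      by measurable
    ultimately show ?thesis unfolding T[symmetric]
      by (simp add: nn_integral_cmult)
  qed
  also have "\<dots> = (\<integral>\<^sup>+ x. ennreal (q (T x) * ((2 * pi) powr (- real (card S) / 2) * sqrt (det_on S A) *
        exp (- (1/2) * (\<Sum>i\<in>S. \<Sum>l\<in>S. (x i - \<mu> i) * A i l * (x l - \<mu> l))))) \<partial>PiM S (\<lambda>_. lborel))"
    unfolding prod quad det using prodpos
    by (intro nn_integral_cong) (simp add: ennreal_mult'[symmetric] mult_ac)
  finally show ?thesis ..
qed

text \<open>Expresses the density through the precision \<open>d * U\<close>, the form that
  \<open>nn_integral_gauss_whiten\<close> accepts; the determinant moves from the denominator to the
  numerator.\<close>

lemma mvn_density_inv_on:
  assumes fin: "finite S" and pd: "pos_def_on S U" and d: "d > 0"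
  shows "mvn_density S \<mu> (\<lambda>i i'. inv_on S U i i' / d) x =
    (2 * pi) powr (- real (card S) / 2) * sqrt (det_on S (\<lambda>i j. d * U i j)) *
        exp (- (1/2) * (\<Sum>i\<in>S. \<Sum>l\<in>S. (x i - \<mu> i) * (d * U i l) * (x l - \<mu> l)))"
proof -
  have "(\<Sum>i\<in>S. \<Sum>l\<in>S. (x i - \<mu> i) * (if i \<in> S \<and> l \<in> S then d * U i l else 0) * (x l - \<mu> l)) =
    (\<Sum>i\<in>S. \<Sum>l\<in>S. (x i - \<mu> i) * (d * U i l) * (x l - \<mu> l))"
    by (intro sum.cong refl) simp
  moreover have "inv_on S (\<lambda>i j. inv_on S U i j / d) = (\<lambda>i j. if i \<in> S \<and> j \<in> S then d * U i j else 0)"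
    using d by (intro inv_on_scaled_inv_on[OF fin pd]) simp
  ultimately show ?thesis
    unfolding mvn_density_def det_on_scaled_inv_on[OF fin pd] det_on_scale
    by (simp add: real_sqrt_divide)
qed

lemma pos_def_on_scale:
  assumes "pos_def_on S U" "d > 0"
  shows "pos_def_on S (\<lambda>i j. d * U i j)"
  unfolding pos_def_on_def
proof (intro conjI ballI allI impI)
  show "d * U i j = d * U j i" if "i \<in> S" "j \<in> S" for i j
    using pos_def_on_sym[OF assms(1) that] by simp
  fix v :: "nat \<Rightarrow> real" assume "\<exists>i\<in>S. v i \<noteq> 0"
  then have "0 < d * (\<Sum>i\<in>S. \<Sum>j\<in>S. v i * U i j * v j)"
    using assms by (auto simp: pos_def_on_def)
  then show "0 < (\<Sum>i\<in>S. \<Sum>j\<in>S. v i * (d * U i j) * v j)"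
    by (simp add: sum_distrib_left mult_ac)
qed

lemma mvn_density_nonneg:
  assumes fin: "finite S" and pd: "pos_def_on S U" and d: "d > 0"
  shows "mvn_density S \<mu> (\<lambda>i i'. inv_on S U i i' / d) x \<ge> 0"
  using pos_def_on_det[OF fin pos_def_on_scale[OF pd d]] unfolding mvn_density_inv_on[OF assms] by simp

lemma mvn_total:
  assumes fin: "finite S" and pd: "pos_def_on S U" and d: "d > 0"
  shows "(\<integral>\<^sup>+ x. ennreal (mvn_density S \<mu> (\<lambda>i i'. inv_on S U i i' / d) x) \<partial>PiM S (\<lambda>_. lborel)) = 1"
proof -
  let ?A = "\<lambda>i j. d * U i j"
  obtain C where C: "\<forall>i\<in>S. \<forall>k\<in>S. i < k \<longrightarrow> C i k = 0" "\<forall>k\<in>S. C k k > 0"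
    "\<forall>i\<in>S. \<forall>j\<in>S. ?A i j = (\<Sum>k\<in>S. C i k * C j k :: real)"
    using ex_cholesky[OF fin pos_def_on_scale[OF pd d]] by blast
  have "(\<integral>\<^sup>+ x. ennreal (mvn_density S \<mu> (\<lambda>i i'. inv_on S U i i' / d) x) \<partial>PiM S (\<lambda>_. lborel)) 
    = (\<integral>\<^sup>+ z. ennreal (\<Prod>k\<in>S. std_normal_density (z k)) \<partial>PiM S (\<lambda>_. lborel))"
    using nn_integral_gauss_whiten[OF fin, of C ?A "\<lambda>_. 1" \<mu>] C
    by (simp add: mvn_density_inv_on[OF assms])
  then show ?thesis using std_normal_PiM_total[OF fin] by simp
qed

lemma mvn_second_moment:
  assumes fin: "finite S" and pd: "pos_def_on S U" and d: "d > 0"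
  shows "(\<integral>\<^sup>+ x. ennreal ((c + (\<Sum>i\<in>S. v i * x i))\<^sup>2 * mvn_density S \<mu> (\<lambda>i i'. inv_on S U i i' / d) x)
      \<partial>PiM S (\<lambda>_. lborel)) =
    ennreal ((c + (\<Sum>i\<in>S. v i * \<mu> i))\<^sup>2 + (\<Sum>i\<in>S. \<Sum>j\<in>S. v i * inv_on S U i j * v j) / d)"
proof -
  let ?A = "\<lambda>i j. d * U i j"
  define B where "B i j = inv_on S U i j / d" for i j
  obtain C where C: "\<forall>i\<in>S. \<forall>k\<in>S. i < k \<longrightarrow> C i k = 0" "\<forall>k\<in>S. C k k > 0"
    "\<forall>i\<in>S. \<forall>j\<in>S. ?A i j = (\<Sum>k\<in>S. C i k * C j k :: real)"
    using ex_cholesky[OF fin pos_def_on_scale[OF pd d]] by blast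
  define w where "w i = (\<Sum>j\<in>S. B i j * v j)" for i
  \<comment> \<open>\<open>u\<close> solves C u = v. Hence the functional \<open>v\<close> of the
    centred vector is the functional \<open>u\<close> of the whitened one, and the squared length of
    \<open>u\<close> is the variance.\<close>
  define u where "u k = (\<Sum>i\<in>S. C i k * w i)" for k
  have Cu: "(\<Sum>k\<in>S. C i k * u k) = v i" if i: "i \<in> S" for i
  proof -
    have "(\<Sum>k\<in>S. C i k * u k) = (\<Sum>k\<in>S. \<Sum>j\<in>S. C i k * C j k * w j)"
      by (simp add: u_def sum_distrib_left mult_ac)
    also have "\<dots> = (\<Sum>j\<in>S. \<Sum>k\<in>S. C i k * C j k * w j)" by (rule sum.swap)
    also have "\<dots> = (\<Sum>j\<in>S. d * U i j * w j)"
      using C(3) i by (simp add: sum_distrib_right)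
    also have "\<dots> = (\<Sum>j\<in>S. U i j * (\<Sum>l\<in>S. inv_on S U j l * v l))"
      using d by (simp add: w_def B_def sum_divide_distrib[symmetric])
    also have "\<dots> = v i" by (rule inv_on_solve[OF fin pd i])
    finally show ?thesis .
  qed
  have uu: "(\<Sum>k\<in>S. (u k)\<^sup>2) = (\<Sum>i\<in>S. \<Sum>j\<in>S. v i * inv_on S U i j * v j) / d"
  proof -
    have "(\<Sum>k\<in>S. (u k)\<^sup>2) = (\<Sum>k\<in>S. \<Sum>i\<in>S. u k * (C i k * w i))"
      by (simp add: power2_eq_square u_def sum_distrib_left)
    also have "\<dots> = (\<Sum>i\<in>S. \<Sum>k\<in>S. u k * (C i k * w i))" by (rule sum.swap)
    also have "\<dots> = (\<Sum>i\<in>S. (\<Sum>k\<in>S. C i k * u k) * w i)"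
      by (simp add: sum_distrib_left sum_distrib_right mult_ac)
    also have "\<dots> = (\<Sum>i\<in>S. v i * w i)" by (simp add: Cu)
    finally show ?thesis by (simp add: w_def B_def sum_distrib_left sum_divide_distrib mult_ac)
  qed
  define m where "m = c + (\<Sum>i\<in>S. v i * \<mu> i)"
  have vx: "c + (\<Sum>i\<in>S. v i * x i) = m + (\<Sum>k\<in>S. u k * (\<lambda>k\<in>S. \<Sum>i\<in>S. C i k * (x i - \<mu> i)) k)" for x
  proof -
    have "(\<Sum>k\<in>S. u k * (\<lambda>k\<in>S. \<Sum>i\<in>S. C i k * (x i - \<mu> i)) k) 
      = (\<Sum>k\<in>S. \<Sum>i\<in>S. u k * C i k * (x i - \<mu> i))"
      by (simp add: sum_distrib_left mult_ac)
    also have "\<dots> = (\<Sum>i\<in>S. \<Sum>k\<in>S. u k * C i k * (x i - \<mu> i))" by (rule sum.swap)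
    also have "\<dots> = (\<Sum>i\<in>S. (\<Sum>k\<in>S. C i k * u k) * (x i - \<mu> i))"
      by (simp add: sum_distrib_left sum_distrib_right mult_ac)
    also have "\<dots> = (\<Sum>i\<in>S. v i * x i) - (\<Sum>i\<in>S. v i * \<mu> i)"
      by (simp add: Cu right_diff_distrib sum_subtractf)
    finally show ?thesis by (simp add: m_def)
  qed
  have "(\<integral>\<^sup>+ x. ennreal ((c + (\<Sum>i\<in>S. v i * x i))\<^sup>2 * mvn_density S \<mu> (\<lambda>i i'. inv_on S U i i' / d) x)
      \<partial>PiM S (\<lambda>_. lborel)) =
    (\<integral>\<^sup>+ z. ennreal ((m + (\<Sum>k\<in>S. u k * z k))\<^sup>2 * (\<Prod>k\<in>S. std_normal_density (z k))) \<partial>PiM S (\<lambda>_. lborel))"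
    unfolding vx mvn_density_inv_on[OF assms]
    by (rule nn_integral_gauss_whiten[OF fin, of C ?A "\<lambda>z. (m + (\<Sum>k\<in>S. u k * z k))\<^sup>2" \<mu>]) (use C in \<open>auto\<close>)
  also have "\<dots> = ennreal (m\<^sup>2 + (\<Sum>k\<in>S. (u k)\<^sup>2))"
    by (rule std_normal_PiM_second_moment[OF fin])
  finally show ?thesis unfolding uu m_def .
qed

section \<open>Gamma integrals\<close>

lemma gamma_density_total:
  assumes a: "a > 0" and b: "b > 0"
  shows "(\<integral>\<^sup>+ x. ennreal (gamma_density a b x) \<partial>lborel) = 1"
proof -
  have G: "Gamma a > 0" using a by (rule Gamma_real_pos)
  let ?f = "\<lambda>t. ennreal (gamma_density a 1 t)"
  have "(\<integral>\<^sup>+ x. ennreal (gamma_density a 1 x) \<partial>lborel) =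
    (\<integral>\<^sup>+ t. ennreal (indicator {0..} t * t powr (a - 1) / exp t) / ennreal (Gamma a) \<partial>lborel)"
  proof (intro nn_integral_cong)
    fix x :: real
    show "ennreal (gamma_density a 1 x) = ennreal (indicator {0..} x * x powr (a - 1) / exp x) / ennreal (Gamma a)"
      using G by (subst divide_ennreal) (auto simp: gamma_density_def indicator_def exp_minus field_simps)
  qed
  also have "\<dots> = (\<integral>\<^sup>+ t. ennreal (indicator {0..} t * t powr (a - 1) / exp t) \<partial>lborel) / ennreal (Gamma a)"
    by (rule nn_integral_divide) measurable
  also have "(\<integral>\<^sup>+ t. ennreal (indicator {0..} t * t powr (a - 1) / exp t) \<partial>lborel) = ennreal (Gamma a)"
    using Gamma_conv_nn_integral_real[OF a] by simp
  also have "ennreal (Gamma a) / ennreal (Gamma a) = 1"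
    using G by (subst divide_ennreal) auto
  finally have 1: "(\<integral>\<^sup>+ x. ennreal (gamma_density a 1 x) \<partial>lborel) = 1" .
  have [measurable]: "gamma_density a c \<in> borel_measurable borel" for c
    unfolding gamma_density_def[abs_def] by measurable
  \<comment> \<open>Euler's integral covers rate 1; substituting \<open>b * x\<close> gives the
    general rate.\<close>
  have "(\<integral>\<^sup>+ x. ennreal (gamma_density a 1 x) \<partial>lborel) = \<bar>b\<bar> * (\<integral>\<^sup>+ x. ennreal (gamma_density a 1 (0 + b * x)) \<partial>lborel)"
    using b by (intro nn_integral_real_affine) auto
  also have "\<dots> = (\<integral>\<^sup>+ x. ennreal b * ennreal (gamma_density a 1 (b * x)) \<partial>lborel)"
    using b by (subst nn_integral_cmult) auto
  also have "\<dots> = (\<integral>\<^sup>+ x. ennreal (gamma_density a b x) \<partial>lborel)"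
  proof (intro nn_integral_cong)
    fix x :: real
    have "b * gamma_density a 1 (b * x) = gamma_density a b x"
      using b powr_mult[of b x "a - 1"] powr_add[of b 1 "a - 1"]
      by (auto simp: gamma_density_def zero_less_mult_iff)
    then show "ennreal b * ennreal (gamma_density a 1 (b * x)) = ennreal (gamma_density a b x)"
      using b by (metis ennreal_mult' less_imp_le)
  qed
  finally show ?thesis using 1 by simp
qed

lemma gamma_density_measurable [measurable]: "gamma_density a b \<in> borel_measurable borel"
  unfolding gamma_density_def[abs_def] by measurable

text \<open>By the functional equation of the Gamma function, multiplication by \<open>x\<close>
  raises the shape by one at the cost of the factor \<open>a / b\<close>.\<close>

lemma gamma_density_mean:
  assumes a: "a > 0" and b: "b > 0"
  shows "(\<integral>\<^sup>+ x. ennreal (gamma_density a b x * x) \<partial>lborel) = ennreal (a / b)"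
proof -
  have G: "Gamma (1 + a) = a * Gamma a"
    using Gamma_plus1[of a] a by (auto simp: nonpos_Ints_def add.commute)
  have "(\<integral>\<^sup>+ x. ennreal (gamma_density a b x * x) \<partial>lborel) = 
    (\<integral>\<^sup>+ x. ennreal (a / b) * ennreal (gamma_density (a + 1) b x) \<partial>lborel)"
  proof (intro nn_integral_cong)
    fix x :: real
    have "gamma_density a b x * x = (a / b) * gamma_density (a + 1) b x"
      using a b Gamma_real_pos[OF a] powr_add[of b a 1] powr_add[of x "a - 1" 1]
      by (auto simp: gamma_density_def G field_simps)
    then show "ennreal (gamma_density a b x * x) = ennreal (a / b) * ennreal (gamma_density (a + 1) b x)"
      using a b by (metis ennreal_mult' divide_nonneg_nonneg less_imp_le)
  qed
  also have "\<dots> = ennreal (a / b)"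
    using gamma_density_total[of "a + 1" b] a b by (subst nn_integral_cmult) auto
  finally show ?thesis .
qed

section \<open>Elimination coordinates\<close>

locale peo_graph =
  fixes p :: nat and E :: "(nat \<times> nat) set"
  assumes E_sub: "E \<subseteq> {1..p} \<times> {1..p}"
    and E_irrefl: "\<And>i. (i, i) \<notin> E"
    and peo: "is_peo p E"
begin

lemma succ_nbrs_subset: "succ_nbrs E j \<subseteq> {1..p}"
  using E_sub by (auto simp: succ_nbrs_def)

lemma finite_succ_nbrs [simp]: "finite (succ_nbrs E j)"
  using succ_nbrs_subset finite_subset by blast

lemma not_in_succ_nbrs [simp]: "j \<notin> succ_nbrs E j"
  by (simp add: succ_nbrs_def)

lemma finite_free_idx [simp]: "finite (free_idx p E)"
proof (rule finite_subset)
  show "free_idx p E \<subseteq> {1..p} \<times> {1..p}" by (auto simp: free_idx_def)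
qed simp

lemma free_idx_iff: "(i, j) \<in> free_idx p E \<longleftrightarrow> j \<in> {1..p} \<and> i \<in> insert j (succ_nbrs E j)"
  using E_sub E_irrefl by (auto simp: free_idx_def succ_nbrs_def le_less)

text \<open>The combinatorial reason for the absence of fill-in, and the place where the perfect
  elimination ordering enters.\<close>

lemma free_idx_common_nbr:
  assumes "(i, k) \<in> free_idx p E" "(j, k) \<in> free_idx p E" "k < j" "j \<le> i"
  shows "(i, j) \<in> free_idx p E"
proof (cases "i = j")
  case True
  then show ?thesis using assms E_sub by (auto simp: free_idx_def)
next
  case False
  have "(i, j) \<in> E"
    using peo assms False unfolding is_peo_def free_idx_iff by auto
  then show ?thesis using assms E_sub by (auto simp: free_idx_def)
qed

definition ext_mat :: "(nat \<times> nat \<Rightarrow> real) \<Rightarrow> rmat" where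
  "ext_mat w i j = (if (i, j) \<in> free_idx p E then w (i, j) else 0)"

definition fill :: "nat \<times> nat \<Rightarrow> (nat \<times> nat \<Rightarrow> real) \<Rightarrow> real" where
  "fill = (\<lambda>(i, j) w. \<Sum>k\<in>{1..<j}. ext_mat w i k * ext_mat w j k / ext_mat w k k)"

text \<open>Inverse of elimination on the free coordinates. The factor \<open>1 *\<close> and the
  restriction match the map in \<open>nn_integral_PiM_triangular\<close>, with \<open>fill\<close>
  as the shift.\<close>

definition unelim :: "(nat \<times> nat \<Rightarrow> real) \<Rightarrow> (nat \<times> nat \<Rightarrow> real)" where
  "unelim w = (\<lambda>ij\<in>free_idx p E. 1 * w ij + fill ij w)"

text \<open>This holds without any condition on the pivots, since adding and subtracting the fill
  divide by the same, possibly zero, numbers. Off the free indices the matrix entry is 0 and, by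
  \<open>free_idx_common_nbr\<close>, so is every term of the fill.\<close>

lemma elim_col_unelim:
  assumes "1 \<le> j" "j \<le> i" "i \<le> p"
  shows "elim_col (omega_of p E (unelim w)) j i = ext_mat w i j"
  using assms
proof (induction j arbitrary: i rule: less_induct)
  case (less j)
  let ?A = "omega_of p E (unelim w)"
  have IH: "elim_col ?A k i = ext_mat w i k" if "k \<in> {1..<j}" "k \<le> i" "i \<le> p" for k i
    using less.IH[of k i] that by auto
  have "elim_col ?A j i = ?A i j - (\<Sum>k\<in>{1..<j}. elim_col ?A k i * elim_col ?A k j / elim_col ?A k k)"
    by (rule elim_col.simps)
  also have "(\<Sum>k\<in>{1..<j}. elim_col ?A k i * elim_col ?A k j / elim_col ?A k k) = fill (i, j) w"
    unfolding fill_def prod.case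
  proof (rule sum.cong[OF refl])
    fix k assume k: "k \<in> {1..<j}"
    then show "elim_col ?A k i * elim_col ?A k j / elim_col ?A k k = ext_mat w i k * ext_mat w j k / ext_mat w k k"
      using less.prems IH[OF k, of i] IH[OF k, of j] IH[OF k, of k] by simp
  qed
  also have "?A i j - fill (i, j) w = ext_mat w i j"
  proof (cases "(i, j) \<in> free_idx p E")
    case True
    then show ?thesis by (simp add: omega_of_def unelim_def ext_mat_def)
  next
    case False
    then have "i \<noteq> j" using less.prems by (auto simp: free_idx_def)
    then have "(j, i) \<notin> free_idx p E" using less.prems by (auto simp: free_idx_def)
    moreover have "fill (i, j) w = 0"
      unfolding fill_def prod.case
    proof (rule sum.neutral, rule ballI)
      fix k assume "k \<in> {1..<j}"
      then have "ext_mat w i k = 0 \<or> ext_mat w j k = 0"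
        using free_idx_common_nbr[of i k j] False less.prems by (auto simp: ext_mat_def)
      then show "ext_mat w i k * ext_mat w j k / ext_mat w k k = 0" by auto
    qed
    ultimately show ?thesis using False by (simp add: omega_of_def ext_mat_def)
  qed
  finally show ?case .
qed

lemma ext_mat_measurable [measurable]: "(\<lambda>w. ext_mat w i j) \<in> borel_measurable (PiM (free_idx p E) (\<lambda>_. lborel))"
proof (cases "(i, j) \<in> free_idx p E")
  case True
  then show ?thesis unfolding ext_mat_def by simp
qed (simp add: ext_mat_def)

lemma omega_of_measurable [measurable]: "(\<lambda>x. omega_of p E x i j) \<in> borel_measurable (gw_space p E)"
proof -
  have "omega_of p E x i j = (if (i, j) \<in> free_idx p E then ext_mat x i j else ext_mat x j i)" for x
    by (simp add: omega_of_def ext_mat_def)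
  then show ?thesis unfolding gw_space_def by simp
qed

lemma elim_col_measurable [measurable]:
  "(\<lambda>x. elim_col (omega_of p E x) j i) \<in> borel_measurable (gw_space p E)"
proof (induction j arbitrary: i rule: less_induct)
  case (less j)
  have [measurable]: "(\<lambda>x. elim_col (omega_of p E x) k i) \<in> borel_measurable (gw_space p E)"
    if "k \<in> {1..<j}" for k i using less that by simp
  show ?case by (subst elim_col.simps) measurable
qed

lemma elim_D_measurable [measurable]:
  "(\<lambda>x. elim_D p (omega_of p E x) j) \<in> borel_measurable (gw_space p E)"
  unfolding elim_D_def by measurable

lemma elim_L_measurable [measurable]:
  "(\<lambda>x. elim_L p (omega_of p E x) i j) \<in> borel_measurable (gw_space p E)"
  unfolding elim_L_def by measurable

lemma pos_def_measurable [measurable]: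
  "Measurable.pred (gw_space p E) (\<lambda>x. pos_def_on {1..p} (omega_of p E x))"
  unfolding mcd_omega_of(3) by measurable

lemma mcd_D_measurable [measurable]:
  "(\<lambda>x. mcd_D p (omega_of p E x) j) \<in> borel_measurable (gw_space p E)"
  unfolding mcd_omega_of(2) if_distrib[where f = "\<lambda>D. D j"] by measurable

lemma mcd_L_measurable [measurable]:
  "(\<lambda>x. mcd_L p (omega_of p E x) i j) \<in> borel_measurable (gw_space p E)"
  unfolding mcd_omega_of(1) if_distrib[where f = "\<lambda>L. L i j"] by measurable

lemma fill_measurable [measurable]: "fill k \<in> borel_measurable (PiM (free_idx p E) (\<lambda>_. lborel))"
  unfolding fill_def by (cases k) simp

lemma unelim_measurable [measurable]:
  "unelim \<in> measurable (PiM (free_idx p E) (\<lambda>_. lborel)) (PiM (free_idx p E) (\<lambda>_. lborel))"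
  unfolding unelim_def[abs_def] by (rule measurable_restrict) simp

section \<open>The unnormalised density in elimination coordinates\<close>

lemma nn_integral_unelim:
  assumes "f \<in> borel_measurable (gw_space p E)"
  shows "(\<integral>\<^sup>+ x. f x \<partial>gw_space p E) = (\<integral>\<^sup>+ w. f (unelim w) \<partial>gw_space p E)"
proof -
  have "(\<integral>\<^sup>+ x. f x \<partial>PiM (free_idx p E) (\<lambda>_. lborel)) =
    ennreal (\<Prod>k\<in>free_idx p E. \<bar>1\<bar>) * (\<integral>\<^sup>+ x. f (\<lambda>k\<in>free_idx p E. 1 * x k + fill k x) \<partial>PiM (free_idx p E) (\<lambda>_. lborel))"
  \<comment> \<open>The rank is the column: \<open>fill\<close> at \<open>(i, j)\<close> sees only
    columns \<open>k < j\<close>.\<close>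
  proof (rule nn_integral_PiM_triangular[where r = snd])
    show "fill k x = fill k y"
      if "k \<in> free_idx p E" and eq: "\<And>i. i \<in> free_idx p E \<Longrightarrow> snd i < snd k \<Longrightarrow> x i = y i" for k x y
    proof -
      have "ext_mat x i l = ext_mat y i l" if "l < snd k" for i l
        using eq[of "(i, l)"] that by (simp add: ext_mat_def)
      then show ?thesis by (cases k) (simp add: fill_def)
    qed
  qed (use assms in \<open>auto simp: gw_space_def\<close>)
  then show ?thesis by (simp add: gw_space_def unelim_def)
qed

text \<open>The diagonal coordinates are the pivots, so the cone of positive definite matrices
  becomes a product of half-lines with unconstrained off-diagonal coordinates.\<close>

lemma pos_def_unelim:
  "pos_def_on {1..p} (omega_of p E (unelim w)) \<longleftrightarrow> (\<forall>j\<in>{1..p}. w (j, j) > 0)"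
  unfolding mcd_omega_of(3) by (auto simp: elim_col_unelim ext_mat_def free_idx_def)

lemma mcd_unelim:
  assumes "\<forall>j\<in>{1..p}. w (j, j) > 0" and "j \<in> {1..p}"
  shows "mcd_D p (omega_of p E (unelim w)) j = w (j, j)"
    and "mcd_L p (omega_of p E (unelim w)) i j = ext_mat w i j / w (j, j)"
proof -
  have P: "\<forall>j\<in>{1..p}. elim_col (omega_of p E (unelim w)) j j > 0"
    using pos_def_unelim assms(1) unfolding mcd_omega_of(3) by blast
  have jj: "(j, j) \<in> free_idx p E" using assms(2) by (auto simp: free_idx_def)
  show "mcd_D p (omega_of p E (unelim w)) j = w (j, j)"
    using assms(2) P jj by (simp add: mcd_omega_of elim_D_def elim_col_unelim ext_mat_def)
  have "ext_mat w i j = 0" if "\<not> (j \<le> i \<and> i \<le> p)"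
    using that by (auto simp: ext_mat_def free_idx_def)
  then show "mcd_L p (omega_of p E (unelim w)) i j = ext_mat w i j / w (j, j)"
    using assms(2) P jj by (auto simp: mcd_omega_of elim_L_def elim_col_unelim ext_mat_def[of w j j])
qed

definition col_quad :: "rmat \<Rightarrow> nat \<Rightarrow> (nat \<times> nat \<Rightarrow> real) \<Rightarrow> real" where
  "col_quad U j w = (\<Sum>i\<in>insert j (succ_nbrs E j). \<Sum>k\<in>insert j (succ_nbrs E j). w (i, j) * U i k * w (k, j))"

text \<open>The factor of column \<open>j\<close> in the density. \<open>col_quad\<close> contains
  the pivot twice, so one division leaves the pivot times the form of \<open>U\<close> at the column
  of L. The value 0 off the half-line encodes positive definiteness.\<close>

definition col_weight :: "rmat \<Rightarrow> (nat \<Rightarrow> real) \<Rightarrow> nat \<Rightarrow> (nat \<times> nat \<Rightarrow> real) \<Rightarrow> real" where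
  "col_weight U \<delta> j w = (if w (j, j) > 0
     then w (j, j) powr (\<delta> j / 2) * exp (- (1/2) * (col_quad U j w / w (j, j))) else 0)"

lemma col_weight_nonneg: "col_weight U \<delta> j w \<ge> 0"
  by (simp add: col_weight_def)

text \<open>The trace of L D L^T U is the sum over the columns of L of the pivot times the form of
  \<open>U\<close>. For columns already multiplied by the pivot, the pivot moves to the
  denominator.\<close>

lemma trace_unelim:
  assumes pos: "\<forall>j\<in>{1..p}. w (j, j) > 0"
  shows "(\<Sum>i\<in>{1..p}. \<Sum>k\<in>{1..p}. omega_of p E (unelim w) i k * U k i) =
    (\<Sum>j\<in>{1..p}. col_quad U j w / w (j, j))"
proof -
  let ?A = "omega_of p E (unelim w)" and ?I = "{1..p}"
  have "is_mcd p ?A (elim_L p ?A) (elim_D p ?A)"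
    using pos_def_unelim pos unfolding mcd_omega_of(3) by (intro is_mcd_elim omega_of_sym) blast
  then have "is_mcd p ?A (mcd_L p ?A) (mcd_D p ?A)"
    using pos_def_unelim pos unfolding mcd_omega_of by auto
  note mcd = is_mcd_eq[OF this]
  have A: "?A i k = (\<Sum>j\<in>?I. ext_mat w i j * ext_mat w k j / w (j, j))" if "i \<in> ?I" "k \<in> ?I" for i k
    unfolding mcd[OF that]
  proof (rule sum.cong[OF refl])
    fix j assume j: "j \<in> ?I"
    then have "w (j, j) \<noteq> 0" using pos by force
    then show "mcd_L p ?A i j * mcd_D p ?A j * mcd_L p ?A k j = ext_mat w i j * ext_mat w k j / w (j, j)"
      unfolding mcd_unelim[OF pos j] by simp
  qed
  have "(\<Sum>i\<in>?I. \<Sum>k\<in>?I. ?A i k * U k i) =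
      (\<Sum>i\<in>?I. \<Sum>k\<in>?I. \<Sum>j\<in>?I. ext_mat w k j * U k i * ext_mat w i j / w (j, j))"
    by (intro sum.cong refl) (simp add: A sum_distrib_left mult_ac)
  also have "\<dots> = (\<Sum>i\<in>?I. \<Sum>j\<in>?I. \<Sum>k\<in>?I. ext_mat w k j * U k i * ext_mat w i j / w (j, j))"
    by (rule sum.cong[OF refl], rule sum.swap)
  also have "\<dots> = (\<Sum>j\<in>?I. \<Sum>i\<in>?I. \<Sum>k\<in>?I. ext_mat w k j * U k i * ext_mat w i j / w (j, j))"
    by (rule sum.swap)
  also have "\<dots> = (\<Sum>j\<in>?I. \<Sum>k\<in>?I. \<Sum>i\<in>?I. ext_mat w k j * U k i * ext_mat w i j / w (j, j))"
    by (rule sum.cong[OF refl], rule sum.swap)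
  also have "\<dots> = (\<Sum>j\<in>?I. col_quad U j w / w (j, j))"
  proof (rule sum.cong[OF refl])
    fix j assume j: "j \<in> ?I"
    let ?J = "insert j (succ_nbrs E j)"
    have J: "?J \<subseteq> ?I" using j succ_nbrs_subset by auto
    have ext: "ext_mat w i j = (if i \<in> ?J then w (i, j) else 0)" for i
      using j by (auto simp: ext_mat_def free_idx_iff)
    have "(\<Sum>k\<in>?I. \<Sum>i\<in>?I. ext_mat w k j * U k i * ext_mat w i j / w (j, j)) =
      (\<Sum>k\<in>?J. \<Sum>i\<in>?I. ext_mat w k j * U k i * ext_mat w i j / w (j, j))"
      using J by (intro sum.mono_neutral_right) (auto simp: ext)
    also have "\<dots> = (\<Sum>k\<in>?J. \<Sum>i\<in>?J. ext_mat w k j * U k i * ext_mat w i j / w (j, j))"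
      using J by (intro sum.cong refl sum.mono_neutral_right) (auto simp: ext)
    also have "\<dots> = (\<Sum>k\<in>?J. \<Sum>i\<in>?J. w (k, j) * U k i * w (i, j) / w (j, j))"
      by (intro sum.cong refl) (simp add: ext)
    finally show "(\<Sum>k\<in>?I. \<Sum>i\<in>?I. ext_mat w k j * U k i * ext_mat w i j / w (j, j)) = col_quad U j w / w (j, j)"
      unfolding col_quad_def sum_divide_distrib .
  qed
  finally show ?thesis .
qed

lemma gw_unnorm_unelim: "gw_unnorm p E U \<delta> (unelim w) = (\<Prod>j\<in>{1..p}. col_weight U \<delta> j w)"
proof (cases "\<forall>j\<in>{1..p}. w (j, j) > 0")
  case True
  have "exp (- (1/2) * (\<Sum>j\<in>{1..p}. col_quad U j w / w (j, j))) = (\<Prod>j\<in>{1..p}. exp (- (1/2) * (col_quad U j w / w (j, j))))"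
    by (subst exp_sum[symmetric]) (simp_all add: sum_distrib_left sum_negf)
  moreover have "(\<Prod>j\<in>{1..p}. mcd_D p (omega_of p E (unelim w)) j powr (\<delta> j / 2)) = (\<Prod>j\<in>{1..p}. w (j, j) powr (\<delta> j / 2))"
    by (intro prod.cong refl) (simp only: mcd_unelim(1)[OF True])
  moreover have "(\<Prod>j\<in>{1..p}. col_weight U \<delta> j w) =
      (\<Prod>j\<in>{1..p}. w (j, j) powr (\<delta> j / 2) * exp (- (1/2) * (col_quad U j w / w (j, j))))"
    using True by (intro prod.cong refl) (simp add: col_weight_def)
  moreover have "pos_def_on {1..p} (omega_of p E (unelim w))"
    using True unfolding pos_def_unelim .
  ultimately show ?thesis
    unfolding gw_unnorm_def Let_def trace_unelim[OF True] by (simp only: if_True prod.distrib)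
next
  case False
  \<comment> \<open>A nonpositive pivot annihilates one factor, in agreement with the zero of the
    density off the cone.\<close>
  then obtain j where "j \<in> {1..p}" "col_weight U \<delta> j w = 0" by (auto simp: col_weight_def)
  then have "(\<Prod>j\<in>{1..p}. col_weight U \<delta> j w) = 0" by (intro prod_zero) auto
  then show ?thesis
    using False unfolding gw_unnorm_def Let_def pos_def_unelim by (simp only: if_False)
qed

lemma gw_unnorm_measurable [measurable]: "gw_unnorm p E U \<delta> \<in> borel_measurable (gw_space p E)"
  unfolding gw_unnorm_def[abs_def] Let_def by measurable

end

section \<open>Isolating and integrating a single column\<close>

context peo_graph
begin

definition col_idx :: "nat \<Rightarrow> (nat \<times> nat) set" where
  "col_idx j = insert (j, j) ((\<lambda>i. (i, j)) ` succ_nbrs E j)"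

lemma finite_col_idx [simp]: "finite (col_idx j)"
  by (simp add: col_idx_def)

lemma col_idx_subset: "j \<in> {1..p} \<Longrightarrow> col_idx j \<subseteq> free_idx p E"
  by (auto simp: col_idx_def free_idx_iff)

lemma col_idx_iff: "k \<in> col_idx j \<longleftrightarrow> (\<exists>i. k = (i, j) \<and> i \<in> insert j (succ_nbrs E j))"
  by (auto simp: col_idx_def)

lemma col_weight_cong:
  assumes "\<And>i. i \<in> insert j (succ_nbrs E j) \<Longrightarrow> w (i, j) = w' (i, j)"
  shows "col_weight U \<delta> j w = col_weight U \<delta> j w'"
  using assms by (simp add: col_weight_def col_quad_def cong: sum.cong)

lemma col_weight_measurable:
  assumes "col_idx j \<subseteq> K"
  shows "col_weight U \<delta> j \<in> borel_measurable (PiM K (\<lambda>_. lborel))"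
proof -
  have [measurable]: "(\<lambda>w. w (i, j)) \<in> borel_measurable (PiM K (\<lambda>_. lborel :: real measure))" if "i \<in> insert j (succ_nbrs E j)" for i
    using measurable_component_singleton[of "(i, j)" K "\<lambda>_. lborel :: real measure"] assms that
    by (auto simp: col_idx_def)
  show ?thesis unfolding col_weight_def[abs_def] col_quad_def by measurable
qed

text \<open>Different columns occupy disjoint coordinates, so the integral factors once
  \<open>g\<close> looks at column \<open>j\<close> alone. The first factor does not involve
  \<open>g\<close>, which is all that will be used about it.\<close>

lemma nn_integral_split_column:
  assumes j: "j \<in> {1..p}"
    and g: "\<And>w w'. (\<And>k. k \<in> col_idx j \<Longrightarrow> w k = w' k) \<Longrightarrow> g w = g w'"
    and gm: "g \<in> borel_measurable (gw_space p E)"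
    and gm' [measurable]: "g \<in> borel_measurable (PiM (col_idx j) (\<lambda>_. lborel))"
  shows "(\<integral>\<^sup>+ w. ennreal (\<Prod>k\<in>{1..p}. col_weight U \<delta> k w) * g w \<partial>gw_space p E) =
    (\<integral>\<^sup>+ y. ennreal (\<Prod>k\<in>{1..p} - {j}. col_weight U \<delta> k y) \<partial>PiM (free_idx p E - col_idx j) (\<lambda>_. lborel)) *
    (\<integral>\<^sup>+ x. ennreal (col_weight U \<delta> j x) * g x \<partial>PiM (col_idx j) (\<lambda>_. lborel))"
proof -
  let ?C = "col_idx j" and ?R = "free_idx p E - col_idx j"
  have F: "free_idx p E = ?C \<union> ?R" using col_idx_subset[OF j] by auto
  have rest: "col_idx k \<subseteq> ?R" if "k \<in> {1..p} - {j}" for k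
    using col_idx_subset[of k] that by (auto simp: col_idx_iff)
  have [measurable]: "col_weight U \<delta> j \<in> borel_measurable (PiM ?C (\<lambda>_. lborel))"
    by (rule col_weight_measurable) simp
  have [measurable]: "col_weight U \<delta> k \<in> borel_measurable (PiM ?R (\<lambda>_. lborel))" if "k \<in> {1..p} - {j}" for k
    by (rule col_weight_measurable[OF rest[OF that]])
  have m: "(\<lambda>w. ennreal (\<Prod>k\<in>{1..p}. col_weight U \<delta> k w) * g w) \<in> borel_measurable (PiM (?C \<union> ?R) (\<lambda>_. lborel))"
  proof -
    have [measurable]: "col_weight U \<delta> k \<in> borel_measurable (PiM (?C \<union> ?R) (\<lambda>_. lborel))" if "k \<in> {1..p}" for k
      using col_idx_subset[OF that] F by (intro col_weight_measurable) auto
    have [measurable]: "g \<in> borel_measurable (PiM (?C \<union> ?R) (\<lambda>_. lborel))"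
      using gm unfolding gw_space_def F[symmetric] .
    show ?thesis by measurable
  qed
  have "(\<integral>\<^sup>+ w. ennreal (\<Prod>k\<in>{1..p}. col_weight U \<delta> k w) * g w \<partial>PiM (?C \<union> ?R) (\<lambda>_. lborel)) =
    (\<integral>\<^sup>+ x. \<integral>\<^sup>+ y. ennreal (\<Prod>k\<in>{1..p}. col_weight U \<delta> k (merge ?C ?R (x, y))) * g (merge ?C ?R (x, y))
      \<partial>PiM ?R (\<lambda>_. lborel) \<partial>PiM ?C (\<lambda>_. lborel))"
    by (rule lborel_prod.product_nn_integral_fold[OF _ _ _ m]) auto
  also have "\<dots> = (\<integral>\<^sup>+ x. \<integral>\<^sup>+ y. ennreal (col_weight U \<delta> j x) * g x * ennreal (\<Prod>k\<in>{1..p} - {j}. col_weight U \<delta> k y)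
      \<partial>PiM ?R (\<lambda>_. lborel) \<partial>PiM ?C (\<lambda>_. lborel))"
  proof (intro nn_integral_cong)
    fix x y :: "nat \<times> nat \<Rightarrow> real"
    let ?w = "merge ?C ?R (x, y)"
    have "col_weight U \<delta> j ?w = col_weight U \<delta> j x"
      by (intro col_weight_cong) (auto simp: merge_def col_idx_iff)
    moreover have "g ?w = g x" by (intro g) (auto simp: merge_def)
    moreover have "(\<Prod>k\<in>{1..p} - {j}. col_weight U \<delta> k ?w) = (\<Prod>k\<in>{1..p} - {j}. col_weight U \<delta> k y)"
    proof (rule prod.cong[OF refl])
      fix k assume k: "k \<in> {1..p} - {j}"
      show "col_weight U \<delta> k ?w = col_weight U \<delta> k y"
      proof (rule col_weight_cong)
        fix i assume "i \<in> insert k (succ_nbrs E k)"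
        then have "(i, k) \<in> col_idx k" by (simp add: col_idx_iff)
        then have "(i, k) \<in> ?R" using rest[OF k] by blast
        then show "?w (i, k) = y (i, k)" by (auto simp: merge_def)
      qed
    qed
    ultimately show "ennreal (\<Prod>k\<in>{1..p}. col_weight U \<delta> k ?w) * g ?w =
      ennreal (col_weight U \<delta> j x) * g x * ennreal (\<Prod>k\<in>{1..p} - {j}. col_weight U \<delta> k y)"
      by (simp only: prod.remove[OF finite_atLeastAtMost j])
         (simp add: ennreal_mult' col_weight_nonneg mult_ac)
  qed
  also have "\<dots> = (\<integral>\<^sup>+ x. ennreal (col_weight U \<delta> j x) * g x * 
      (\<integral>\<^sup>+ y. ennreal (\<Prod>k\<in>{1..p} - {j}. col_weight U \<delta> k y) \<partial>PiM ?R (\<lambda>_. lborel)) \<partial>PiM ?C (\<lambda>_. lborel))"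
    by (intro nn_integral_cong nn_integral_cmult) measurable
  also have "\<dots> = (\<integral>\<^sup>+ x. ennreal (col_weight U \<delta> j x) * g x \<partial>PiM ?C (\<lambda>_. lborel)) * 
      (\<integral>\<^sup>+ y. ennreal (\<Prod>k\<in>{1..p} - {j}. col_weight U \<delta> k y) \<partial>PiM ?R (\<lambda>_. lborel))"
    by (rule nn_integral_multc) measurable
  finally show ?thesis
    unfolding gw_space_def F[symmetric] by (simp add: mult.commute)
qed

text \<open>The pivot is integrated outermost because the off-diagonal entries are later rescaled at
  a fixed pivot \<open>d\<close>.\<close>

lemma nn_integral_column:
  fixes f :: "(nat \<times> nat \<Rightarrow> real) \<Rightarrow> ennreal"
  assumes f [measurable]: "f \<in> borel_measurable (PiM (col_idx j) (\<lambda>_. lborel))"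
  shows "(\<integral>\<^sup>+ x. f x \<partial>PiM (col_idx j) (\<lambda>_. lborel)) =
    (\<integral>\<^sup>+ d. \<integral>\<^sup>+ l. f (\<lambda>k\<in>col_idx j. if k = (j, j) then d else l (fst k)) \<partial>PiM (succ_nbrs E j) (\<lambda>_. lborel) \<partial>lborel)"
proof -
  let ?N = "(\<lambda>i. (i, j)) ` succ_nbrs E j"
  have nj: "(j, j) \<notin> ?N" by auto
  have [measurable]: "f \<in> borel_measurable (PiM (insert (j, j) ?N) (\<lambda>_. lborel))"
    using f by (simp add: col_idx_def)
  have eq: "(\<lambda>k\<in>?N. l (fst k))((j, j) := d) = (\<lambda>k\<in>col_idx j. if k = (j, j) then d else l (fst k))" for l d
    by (auto simp: col_idx_def fun_eq_iff restrict_def)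
  have "(\<integral>\<^sup>+ x. f x \<partial>PiM (col_idx j) (\<lambda>_. lborel)) = (\<integral>\<^sup>+ d. \<integral>\<^sup>+ x. f (x((j, j) := d)) \<partial>PiM ?N (\<lambda>_. lborel) \<partial>lborel)"
    unfolding col_idx_def using lborel_prod.product_nn_integral_insert_rev[of ?N "(j, j)" f] nj by simp
  also have "\<dots> = (\<integral>\<^sup>+ d. \<integral>\<^sup>+ l. f ((\<lambda>k\<in>?N. l (fst k))((j, j) := d)) \<partial>PiM (succ_nbrs E j) (\<lambda>_. lborel) \<partial>lborel)"
    by (intro nn_integral_cong nn_integral_PiM_reindex) (auto intro!: inj_onI)
  also have "\<dots> = (\<integral>\<^sup>+ d. \<integral>\<^sup>+ l. f (\<lambda>k\<in>col_idx j. if k = (j, j) then d else l (fst k)) \<partial>PiM (succ_nbrs E j) (\<lambda>_. lborel) \<partial>lborel)"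
    unfolding eq ..
  finally show ?thesis .
qed

end

section \<open>The law of a column\<close>

lemma measurable_affine_PiM:
  fixes a b :: "'i \<Rightarrow> real"
  shows "(\<lambda>x. \<lambda>k\<in>I. a k * x k + b k) \<in> measurable (PiM I (\<lambda>_. lborel)) (PiM I (\<lambda>_. lborel))"
  by (rule measurable_restrict) measurable

locale gwishart = peo_graph +
  fixes U :: rmat and \<delta> :: "nat \<Rightarrow> real"
  assumes U_pd: "pos_def_on {1..p} U"
    and \<delta>_pos: "\<And>i. i \<in> {1..p} \<Longrightarrow> \<delta> i > 0"
begin

abbreviation "shape j \<equiv> (real (nu E j) + \<delta> j) / 2 + 1"
abbreviation "rate j \<equiv> c_const E U j / 2"

lemma pos_def_succ_nbrs: "pos_def_on (succ_nbrs E j) U"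
  by (rule pos_def_on_subset[OF U_pd succ_nbrs_subset]) simp

lemma pos_def_insert_succ_nbrs: "j \<in> {1..p} \<Longrightarrow> pos_def_on (insert j (succ_nbrs E j)) U"
  using succ_nbrs_subset by (intro pos_def_on_subset[OF U_pd]) auto

lemma column_complete_square:
  assumes "j \<in> {1..p}" and "m j = 1" "\<And>i. i \<in> succ_nbrs E j \<Longrightarrow> m i = l i"
  shows "(\<Sum>i\<in>insert j (succ_nbrs E j). \<Sum>k\<in>insert j (succ_nbrs E j). m i * U i k * m k) =
    c_const E U j + (\<Sum>i\<in>succ_nbrs E j. \<Sum>k\<in>succ_nbrs E j. (l i - e_vec E U j i) * U i k * (l k - e_vec E U j k))"
  unfolding c_const_def using assms
  by (intro complete_square pos_def_insert_succ_nbrs) (auto simp: e_vec_def)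

text \<open>At the vector with 1 at \<open>j\<close> and \<open>e_vec\<close> on the neighbours the
  completed square vanishes, so the constant is a value of the positive definite form.\<close>

lemma c_const_pos:
  assumes j: "j \<in> {1..p}"
  shows "c_const E U j > 0"
proof -
  define m where "m i = (if i = j then 1 else e_vec E U j i)" for i
  have "0 < (\<Sum>i\<in>insert j (succ_nbrs E j). \<Sum>k\<in>insert j (succ_nbrs E j). m i * U i k * m k)"
    by (rule pos_def_on_pos[OF pos_def_insert_succ_nbrs[OF j], of j]) (auto simp: m_def)
  also have "\<dots> = c_const E U j"
    by (subst column_complete_square[OF j, of _ "e_vec E U j"]) (auto simp: m_def)
  finally show ?thesis .
qed

lemma shape_pos: "j \<in> {1..p} \<Longrightarrow> shape j > 0"
  using \<delta>_pos[of j] by (simp add: add_pos_nonneg add_nonneg_pos)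

text \<open>The conditional Gaussian density freed of inverses of matrices depending on
  \<open>d\<close>, so that joint measurability in \<open>l\<close> and \<open>d\<close> is evident.
  The identification with \<open>mvn_density\<close> is made for \<open>d > 0\<close> only.\<close>

definition cond_density :: "nat \<Rightarrow> real \<Rightarrow> (nat \<Rightarrow> real) \<Rightarrow> real" where
  "cond_density j d l = (2 * pi) powr (- real (nu E j) / 2) * sqrt (d ^ nu E j * det_on (succ_nbrs E j) U) *
     exp (- (1/2) * (d * (\<Sum>i\<in>succ_nbrs E j. \<Sum>k\<in>succ_nbrs E j.
        (l i - e_vec E U j i) * U i k * (l k - e_vec E U j k))))"

lemma mvn_eq_cond_density:
  assumes "d > 0"
  shows "mvn_density (succ_nbrs E j) (e_vec E U j) (\<lambda>i i'. inv_on (succ_nbrs E j) U i i' / d) l = cond_density j d l"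
  unfolding mvn_density_inv_on[OF finite_succ_nbrs pos_def_succ_nbrs assms] det_on_scale cond_density_def nu_def
  by (simp add: sum_distrib_left mult_ac)

lemma cond_density_nonneg: "d > 0 \<Longrightarrow> cond_density j d l \<ge> 0"
  using mvn_density_nonneg[OF finite_succ_nbrs pos_def_succ_nbrs] by (simp add: mvn_eq_cond_density[symmetric])

text \<open>Where the conditional factors could differ, that is for \<open>d \<le> 0\<close>, the
  Gamma factor is 0.\<close>

lemma joint_density_eq:
  "gamma_density a b d * mvn_density (succ_nbrs E j) (e_vec E U j) (\<lambda>i i'. inv_on (succ_nbrs E j) U i i' / d) l
   = gamma_density a b d * cond_density j d l"
  by (cases "d > 0") (simp_all add: mvn_eq_cond_density gamma_density_def)

lemma cond_density_measurable [measurable]: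
  "(\<lambda>(l, d). cond_density j d l) \<in> borel_measurable (PiM (succ_nbrs E j) (\<lambda>_. lborel) \<Otimes>\<^sub>M lborel)"
  unfolding cond_density_def split_beta' by measurable

lemma cond_density_measurable1 [measurable]:
  "(\<lambda>l. cond_density j d l) \<in> borel_measurable (PiM (succ_nbrs E j) (\<lambda>_. lborel))"
  unfolding cond_density_def by measurable

text \<open>The reciprocal of the product of two normalising constants: that of the Gamma density
  and that of the Gaussian one without its power of \<open>d\<close>.\<close>

definition col_const :: "nat \<Rightarrow> real" where
  "col_const j = Gamma (shape j) /
    (rate j powr shape j * ((2 * pi) powr (- real (nu E j) / 2) * sqrt (det_on (succ_nbrs E j) U)))"

text \<open>\<open>d ^ nu E j\<close> is the Jacobian of passing from w to L within the column. Half
  of this power normalises the Gaussian; the other half and the exponent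
  \<open>\<delta> j / 2\<close> add up to \<open>shape j - 1\<close>.\<close>

lemma col_weight_scaled:
  assumes j: "j \<in> {1..p}" and d: "d > 0"
  defines "w l \<equiv> \<lambda>k\<in>col_idx j. if k = (j, j) then d else d * l (fst k)"
  shows "d ^ nu E j * col_weight U \<delta> j (w l) = col_const j * (gamma_density (shape j) (rate j) d * cond_density j d l)"
proof -
  let ?N = "succ_nbrs E j"
  define q where "q = (\<Sum>i\<in>?N. \<Sum>k\<in>?N. (l i - e_vec E U j i) * U i k * (l k - e_vec E U j k))"
  define m where "m i = (if i = j then 1 else l i)" for i
  have w: "w l (i, j) = d * m i" if "i \<in> insert j ?N" for i
    using that by (auto simp: w_def m_def col_idx_iff)
  have "col_quad U j (w l) = (\<Sum>i\<in>insert j ?N. \<Sum>k\<in>insert j ?N. d * d * (m i * U i k * m k))"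
    unfolding col_quad_def using w by (intro sum.cong refl) (simp add: mult_ac)
  also have "\<dots> = d * d * (c_const E U j + q)"
    unfolding sum_distrib_left[symmetric] q_def
    by (subst column_complete_square[OF j, of m l]) (auto simp: m_def)
  finally have quad: "col_quad U j (w l) = d * d * (c_const E U j + q)" .
  have wj: "w l (j, j) = d" using w[of j] by (simp add: m_def)
  have weight: "col_weight U \<delta> j (w l) = d powr (\<delta> j / 2) * exp (- (rate j * d)) * exp (- (d * q / 2))"
    using d by (simp add: col_weight_def wj quad exp_add[symmetric] field_simps)
  have det: "det_on ?N U > 0" by (rule pos_def_on_det[OF finite_succ_nbrs pos_def_succ_nbrs])
  have sq: "sqrt (d ^ nu E j) = d powr (real (nu E j) / 2)"
    using d by (simp add: powr_half_sqrt[symmetric] powr_realpow[symmetric] powr_powr)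
  have dn: "d ^ nu E j = d powr (real (nu E j) / 2) * d powr (real (nu E j) / 2)"
    using d by (simp add: powr_add[symmetric] powr_realpow)
  have ds: "d powr (shape j - 1) = d powr (real (nu E j) / 2) * d powr (\<delta> j / 2)"
    by (simp add: powr_add[symmetric] add_divide_distrib)
  have "Gamma (shape j) > 0" "rate j powr shape j > 0"
    using shape_pos[OF j] c_const_pos[OF j] Gamma_real_pos by auto
  then show ?thesis
    unfolding weight col_const_def gamma_density_def cond_density_def real_sqrt_mult sq dn q_def[symmetric] ds
    using d det by (simp add: field_simps)
qed

lemma nn_integral_col_weight:
  assumes j: "j \<in> {1..p}"
    and g [measurable]: "g \<in> borel_measurable (PiM (succ_nbrs E j) (\<lambda>_. lborel) \<Otimes>\<^sub>M lborel)"
  shows "(\<integral>\<^sup>+ x. ennreal (col_weight U \<delta> j x) * g (\<lambda>i\<in>succ_nbrs E j. x (i, j) / x (j, j), x (j, j)) \<partial>PiM (col_idx j) (\<lambda>_. lborel))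
    = ennreal (col_const j) * (\<integral>\<^sup>+ d. \<integral>\<^sup>+ l. ennreal (gamma_density (shape j) (rate j) d * cond_density j d l) * g (l, d)
       \<partial>PiM (succ_nbrs E j) (\<lambda>_. lborel) \<partial>lborel)"
proof -
  let ?N = "succ_nbrs E j"
  define G where "G x = ennreal (col_weight U \<delta> j x) * g (\<lambda>i\<in>?N. x (i, j) / x (j, j), x (j, j))" for x
  have [measurable]: "col_weight U \<delta> j \<in> borel_measurable (PiM (col_idx j) (\<lambda>_. lborel))"
    by (rule col_weight_measurable) simp
  have comp: "(\<lambda>x. x (i, j)) \<in> borel_measurable (PiM (col_idx j) (\<lambda>_. lborel :: real measure))" if "i \<in> insert j ?N" for i
    using measurable_component_singleton[of "(i, j)" "col_idx j" "\<lambda>_. lborel :: real measure"] that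
    by (auto simp: col_idx_iff)
  have [measurable]: "(\<lambda>x. x (j, j)) \<in> borel_measurable (PiM (col_idx j) (\<lambda>_. lborel :: real measure))"
    by (rule comp) simp
  have [measurable]: "(\<lambda>x. \<lambda>i\<in>?N. x (i, j) / x (j, j)) \<in> measurable (PiM (col_idx j) (\<lambda>_. lborel)) (PiM ?N (\<lambda>_. lborel :: real measure))"
    using comp by (intro measurable_restrict) simp
  have "(\<lambda>x. x (j, j)) \<in> measurable (PiM (col_idx j) (\<lambda>_. lborel)) (lborel :: real measure)"
    by simp
  then have [measurable]: "(\<lambda>x. (\<lambda>i\<in>?N. x (i, j) / x (j, j), x (j, j))) \<in> 
      measurable (PiM (col_idx j) (\<lambda>_. lborel)) (PiM ?N (\<lambda>_. lborel) \<Otimes>\<^sub>M (lborel :: real measure))"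
    by measurable
  have Gm [measurable]: "G \<in> borel_measurable (PiM (col_idx j) (\<lambda>_. lborel))"
    unfolding G_def[abs_def] by measurable
  let ?w = "\<lambda>d l. \<lambda>k\<in>col_idx j. if k = (j, j) then d else l (fst k) :: real"
  have wm: "(\<lambda>l. ?w d l) \<in> measurable (PiM ?N (\<lambda>_. lborel)) (PiM (col_idx j) (\<lambda>_. lborel))" for d
  proof (rule measurable_restrict)
    fix k assume "k \<in> col_idx j"
    then show "(\<lambda>l. if k = (j, j) then d else l (fst k)) \<in> measurable (PiM ?N (\<lambda>_. lborel)) lborel"
      using measurable_component_singleton[of "fst k" ?N "\<lambda>_. lborel :: real measure"]
      by (cases "k = (j, j)") (auto simp: col_idx_iff)
  qed
  have K: "col_const j \<ge> 0"
    using shape_pos[OF j] pos_def_on_det[OF finite_succ_nbrs pos_def_succ_nbrs[of j]]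
    by (auto simp: col_const_def intro!: divide_nonneg_nonneg less_imp_le[OF Gamma_real_pos])
  have inner: "(\<integral>\<^sup>+ l. G (?w d l) \<partial>PiM ?N (\<lambda>_. lborel)) =
      ennreal (col_const j) * (\<integral>\<^sup>+ l. ennreal (gamma_density (shape j) (rate j) d * cond_density j d l) * g (l, d) \<partial>PiM ?N (\<lambda>_. lborel))" for d
  proof (cases "d > 0")
    \<comment> \<open>A nonpositive pivot gives 0 on both sides, so the rescaling is confined to
      \<open>d > 0\<close>.\<close>
    case False
    then have "col_weight U \<delta> j (?w d l) = 0" for l by (simp add: col_weight_def col_idx_def)
    moreover have "gamma_density (shape j) (rate j) d = 0" using False by (simp add: gamma_density_def)
    ultimately show ?thesis
      by (simp only: G_def ennreal_0 mult_zero_left mult_zero_right nn_integral_const)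
  next
    case True
    have Gw: "(\<lambda>l. G (?w d l)) \<in> borel_measurable (PiM ?N (\<lambda>_. lborel))"
      by (rule measurable_compose[OF wm Gm])
    note Gw' = measurable_compose[OF measurable_affine_PiM[where I = ?N and a = "\<lambda>_. d" and b = "\<lambda>_. 0"] Gw]
    \<comment> \<open>A pure scaling has zero shifts, so any rank will do.\<close>
    have "(\<integral>\<^sup>+ l. G (?w d l) \<partial>PiM ?N (\<lambda>_. lborel)) = ennreal (\<Prod>k\<in>?N. \<bar>d\<bar>) *
        (\<integral>\<^sup>+ l. G (?w d (\<lambda>k\<in>?N. d * l k + 0)) \<partial>PiM ?N (\<lambda>_. lborel))"
      by (rule nn_integral_PiM_triangular[where r = id, OF _ Gw]) (use True in auto)
    also have "\<dots> = (\<integral>\<^sup>+ l. ennreal (\<Prod>k\<in>?N. \<bar>d\<bar>) * G (?w d (\<lambda>k\<in>?N. d * l k + 0)) \<partial>PiM ?N (\<lambda>_. lborel))"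
      by (rule nn_integral_cmult[OF Gw', symmetric])
    also have "\<dots> = (\<integral>\<^sup>+ l. ennreal (col_const j) * (ennreal (gamma_density (shape j) (rate j) d * cond_density j d l) * g (l, d)) \<partial>PiM ?N (\<lambda>_. lborel))"
    proof (rule nn_integral_cong)
      fix l assume l: "l \<in> space (PiM ?N (\<lambda>_. lborel :: real measure))"
      define w where "w = (\<lambda>k\<in>col_idx j. if k = (j, j) then d else d * l (fst k))"
      have w: "?w d (\<lambda>k\<in>?N. d * l k + 0) = w"
        by (auto simp: w_def fun_eq_iff restrict_def col_idx_iff)
      \<comment> \<open>Equality as functions, not only on \<open>?N\<close>: points of the product
        space are \<open>undefined\<close> outside their index set.\<close>
      have "(\<lambda>i\<in>?N. w (i, j) / w (j, j)) = l"
        using l True by (auto simp: w_def fun_eq_iff restrict_def col_idx_iff space_PiM PiE_def extensional_def)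
      moreover have "w (j, j) = d" by (simp add: w_def col_idx_def)
      moreover have "ennreal (\<Prod>k\<in>?N. \<bar>d\<bar>) * ennreal (col_weight U \<delta> j w) =
          ennreal (col_const j) * ennreal (gamma_density (shape j) (rate j) d * cond_density j d l)"
        using col_weight_scaled[OF j True, of l] True K
        by (simp add: w_def ennreal_mult'[symmetric] nu_def)
      ultimately show "ennreal (\<Prod>k\<in>?N. \<bar>d\<bar>) * G (?w d (\<lambda>k\<in>?N. d * l k + 0)) =
        ennreal (col_const j) * (ennreal (gamma_density (shape j) (rate j) d * cond_density j d l) * g (l, d))"
        unfolding w G_def by (simp add: mult.assoc[symmetric])
    qed
    also have "\<dots> = ennreal (col_const j) * (\<integral>\<^sup>+ l. ennreal (gamma_density (shape j) (rate j) d * cond_density j d l) * g (l, d) \<partial>PiM ?N (\<lambda>_. lborel))"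
      by (rule nn_integral_cmult) measurable
    finally show ?thesis .
  qed
  interpret N: sigma_finite_measure "PiM ?N (\<lambda>_. lborel :: real measure)"
    by (rule lborel_prod.sigma_finite) simp
  \<comment> \<open>Measurability is known in the order \<open>(l, d)\<close>, whereas the inner
    integral runs over \<open>l\<close>; the components are swapped to apply Fubini.\<close>
  have "(\<lambda>x. (snd x, fst x)) \<in> measurable (lborel \<Otimes>\<^sub>M PiM ?N (\<lambda>_. lborel)) (PiM ?N (\<lambda>_. lborel) \<Otimes>\<^sub>M (lborel :: real measure))"
    by measurable
  note swap = measurable_compose[OF this]
  have "(\<lambda>(d, l). ennreal (gamma_density (shape j) (rate j) d * cond_density j d l) * g (l, d)) \<in> 
    borel_measurable (lborel \<Otimes>\<^sub>M PiM ?N (\<lambda>_. lborel))"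
    using swap[of "\<lambda>(l, d). ennreal (gamma_density (shape j) (rate j) d * cond_density j d l) * g (l, d)" borel]
    by (simp add: split_beta')
  then have m [measurable]: "(\<lambda>d. \<integral>\<^sup>+ l. ennreal (gamma_density (shape j) (rate j) d * cond_density j d l) * g (l, d) \<partial>PiM ?N (\<lambda>_. lborel)) \<in> borel_measurable lborel"
    by (rule N.borel_measurable_nn_integral)
  show ?thesis
    unfolding G_def[symmetric] nn_integral_column[OF Gm] inner by (rule nn_integral_cmult[OF m])
qed

end

section \<open>Joint law of a column of L and its pivot\<close>

context gwishart
begin

definition chol_col :: "nat \<Rightarrow> (nat \<times> nat \<Rightarrow> real) \<Rightarrow> (nat \<Rightarrow> real) \<times> real" where
  "chol_col j x = (\<lambda>i\<in>succ_nbrs E j. mcd_L p (omega_of p E x) i j, mcd_D p (omega_of p E x) j)"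

lemma chol_col_measurable [measurable]:
  "chol_col j \<in> measurable (gw_space p E) (PiM (succ_nbrs E j) (\<lambda>_. lborel) \<Otimes>\<^sub>M lborel)"
proof -
  have "(\<lambda>x. \<lambda>i\<in>succ_nbrs E j. mcd_L p (omega_of p E x) i j) \<in> measurable (gw_space p E) (PiM (succ_nbrs E j) (\<lambda>_. lborel))"
    by (rule measurable_restrict) measurable
  moreover have "(\<lambda>x. mcd_D p (omega_of p E x) j) \<in> measurable (gw_space p E) lborel"
    by measurable
  ultimately show ?thesis unfolding chol_col_def[abs_def] by (rule measurable_Pair)
qed

text \<open>The order of the quantifiers is the point: a single \<open>R\<close>, made of the other
  columns and \<open>col_const\<close>, serves all \<open>g\<close>, so one test function determines
  it.\<close>

lemma nn_integral_gw_unnorm: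
  assumes j: "j \<in> {1..p}"
  shows "\<exists>R. \<forall>g \<in> borel_measurable (PiM (succ_nbrs E j) (\<lambda>_. lborel) \<Otimes>\<^sub>M lborel).
    (\<integral>\<^sup>+ x. ennreal (gw_unnorm p E U \<delta> x) * g (chol_col j x) \<partial>gw_space p E) =
    R * (\<integral>\<^sup>+ d. \<integral>\<^sup>+ l. ennreal (gamma_density (shape j) (rate j) d * cond_density j d l) * g (l, d)
       \<partial>PiM (succ_nbrs E j) (\<lambda>_. lborel) \<partial>lborel)"
proof (intro exI ballI)
  let ?N = "succ_nbrs E j"
  fix g :: "(nat \<Rightarrow> real) \<times> real \<Rightarrow> ennreal"
  assume g [measurable]: "g \<in> borel_measurable (PiM ?N (\<lambda>_. lborel) \<Otimes>\<^sub>M lborel)"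
  define h where "h w = (\<lambda>i\<in>?N. w (i, j) / w (j, j), w (j, j))" for w :: "nat \<times> nat \<Rightarrow> real"
  have hm: "h \<in> measurable (PiM K (\<lambda>_. lborel)) (PiM ?N (\<lambda>_. lborel) \<Otimes>\<^sub>M lborel)"
    if K: "col_idx j \<subseteq> K" for K
  proof -
    have comp: "(\<lambda>x. x (i, j)) \<in> borel_measurable (PiM K (\<lambda>_. lborel :: real measure))" if "i \<in> insert j ?N" for i
      using measurable_component_singleton[of "(i, j)" K "\<lambda>_. lborel :: real measure"] that K
      by (auto simp: col_idx_def)
    have "(\<lambda>x. \<lambda>i\<in>?N. x (i, j) / x (j, j)) \<in> measurable (PiM K (\<lambda>_. lborel)) (PiM ?N (\<lambda>_. lborel :: real measure))"
      using comp by (intro measurable_restrict) simp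
    moreover have "(\<lambda>x. x (j, j)) \<in> measurable (PiM K (\<lambda>_. lborel)) (lborel :: real measure)"
      using comp[of j] by simp
    ultimately show ?thesis unfolding h_def[abs_def] by (rule measurable_Pair)
  qed
  have gc: "(\<lambda>x. g (chol_col j x)) \<in> borel_measurable (gw_space p E)" by measurable
  have "(\<integral>\<^sup>+ x. ennreal (gw_unnorm p E U \<delta> x) * g (chol_col j x) \<partial>gw_space p E) =
    (\<integral>\<^sup>+ w. ennreal (gw_unnorm p E U \<delta> (unelim w)) * g (chol_col j (unelim w)) \<partial>gw_space p E)"
    using gc by (intro nn_integral_unelim) measurable
  also have "\<dots> = (\<integral>\<^sup>+ w. ennreal (\<Prod>k\<in>{1..p}. col_weight U \<delta> k w) * g (h w) \<partial>gw_space p E)"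
  proof (rule nn_integral_cong)
    fix w
    show "ennreal (gw_unnorm p E U \<delta> (unelim w)) * g (chol_col j (unelim w)) =
      ennreal (\<Prod>k\<in>{1..p}. col_weight U \<delta> k w) * g (h w)"
    \<comment> \<open>Coordinates and Cholesky factors are matched for positive pivots only;
      elsewhere the weight is 0 and the value of \<open>g\<close> does not matter.\<close>
    proof (cases "\<forall>k\<in>{1..p}. w (k, k) > 0")
      case True
      have "ext_mat w i j = w (i, j)" if "i \<in> ?N" for i
        using that j by (simp add: ext_mat_def free_idx_iff)
      then have "chol_col j (unelim w) = h w"
        unfolding chol_col_def h_def mcd_unelim[OF True j] by (auto simp: fun_eq_iff restrict_def)
      then show ?thesis by (simp add: gw_unnorm_unelim)
    next
      case False
      then obtain k where "k \<in> {1..p}" "col_weight U \<delta> k w = 0" by (auto simp: col_weight_def)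
      then have zero: "(\<Prod>j\<in>{1..p}. col_weight U \<delta> j w) = 0" by (intro prod_zero) auto
      show ?thesis unfolding gw_unnorm_unelim zero by simp
    qed
  qed
  also have "\<dots> = (\<integral>\<^sup>+ y. ennreal (\<Prod>k\<in>{1..p} - {j}. col_weight U \<delta> k y) \<partial>PiM (free_idx p E - col_idx j) (\<lambda>_. lborel)) *
    (\<integral>\<^sup>+ x. ennreal (col_weight U \<delta> j x) * g (h x) \<partial>PiM (col_idx j) (\<lambda>_. lborel))"
  proof (rule nn_integral_split_column[OF j])
    show "g (h w) = g (h w')" if "\<And>k. k \<in> col_idx j \<Longrightarrow> w k = w' k" for w w'
    proof -
      have "h w = h w'" using that by (auto simp: h_def col_idx_def fun_eq_iff restrict_def)
      then show ?thesis by simp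
    qed
    show "(\<lambda>w. g (h w)) \<in> borel_measurable (gw_space p E)"
      unfolding gw_space_def by (rule measurable_compose[OF hm[OF col_idx_subset[OF j]] g])
    show "(\<lambda>w. g (h w)) \<in> borel_measurable (PiM (col_idx j) (\<lambda>_. lborel))"
      by (rule measurable_compose[OF hm[OF order_refl] g])
  qed
  also have "(\<integral>\<^sup>+ x. ennreal (col_weight U \<delta> j x) * g (h x) \<partial>PiM (col_idx j) (\<lambda>_. lborel)) =
    ennreal (col_const j) * (\<integral>\<^sup>+ d. \<integral>\<^sup>+ l. ennreal (gamma_density (shape j) (rate j) d * cond_density j d l) * g (l, d)
       \<partial>PiM ?N (\<lambda>_. lborel) \<partial>lborel)"
    unfolding h_def by (rule nn_integral_col_weight[OF j g])
  finally show "(\<integral>\<^sup>+ x. ennreal (gw_unnorm p E U \<delta> x) * g (chol_col j x) \<partial>gw_space p E) =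
    ((\<integral>\<^sup>+ y. ennreal (\<Prod>k\<in>{1..p} - {j}. col_weight U \<delta> k y) \<partial>PiM (free_idx p E - col_idx j) (\<lambda>_. lborel)) * ennreal (col_const j))
      * (\<integral>\<^sup>+ d. \<integral>\<^sup>+ l. ennreal (gamma_density (shape j) (rate j) d * cond_density j d l) * g (l, d)
       \<partial>PiM ?N (\<lambda>_. lborel) \<partial>lborel)"
    by (simp only: mult.assoc)
qed

text \<open>\<open>H\<close> plays the part of the conditional expectation of \<open>G\<close> given
  the pivot. The assumptions are confined to \<open>d > 0\<close>, since the Gamma factor removes
  all other pivots.\<close>

lemma nn_integral_joint:
  assumes G: "\<And>d. d > 0 \<Longrightarrow> G d \<in> borel_measurable (PiM (succ_nbrs E j) (\<lambda>_. lborel))"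
    and I: "\<And>d. d > 0 \<Longrightarrow> (\<integral>\<^sup>+ l. ennreal (mvn_density (succ_nbrs E j) (e_vec E U j) (\<lambda>i i'. inv_on (succ_nbrs E j) U i i' / d) l) * G d l \<partial>PiM (succ_nbrs E j) (\<lambda>_. lborel)) = H d"
  shows "(\<integral>\<^sup>+ d. \<integral>\<^sup>+ l. ennreal (gamma_density (shape j) (rate j) d * cond_density j d l) * G d l
       \<partial>PiM (succ_nbrs E j) (\<lambda>_. lborel) \<partial>lborel) = (\<integral>\<^sup>+ d. ennreal (gamma_density (shape j) (rate j) d) * H d \<partial>lborel)"
proof (rule nn_integral_cong)
  fix d :: real
  let ?N = "succ_nbrs E j"
  show "(\<integral>\<^sup>+ l. ennreal (gamma_density (shape j) (rate j) d * cond_density j d l) * G d l \<partial>PiM ?N (\<lambda>_. lborel)) =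
    ennreal (gamma_density (shape j) (rate j) d) * H d"
  proof (cases "d > 0")
    case True
    have [measurable]: "G d \<in> borel_measurable (PiM ?N (\<lambda>_. lborel))" by (rule G[OF True])
    have "(\<integral>\<^sup>+ l. ennreal (gamma_density (shape j) (rate j) d * cond_density j d l) * G d l \<partial>PiM ?N (\<lambda>_. lborel)) =
      (\<integral>\<^sup>+ l. ennreal (gamma_density (shape j) (rate j) d) * (ennreal (cond_density j d l) * G d l) \<partial>PiM ?N (\<lambda>_. lborel))"
      using cond_density_nonneg[OF True] by (intro nn_integral_cong) (simp add: ennreal_mult'' mult.assoc)
    also have "\<dots> = ennreal (gamma_density (shape j) (rate j) d) * (\<integral>\<^sup>+ l. ennreal (cond_density j d l) * G d l \<partial>PiM ?N (\<lambda>_. lborel))"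
      by (rule nn_integral_cmult) measurable
    finally show ?thesis using I[OF True] by (simp add: mvn_eq_cond_density[OF True])
  next
    case False
    then have "gamma_density (shape j) (rate j) d = 0" by (simp add: gamma_density_def)
    then show ?thesis by simp
  qed
qed

lemma joint_total:
  assumes j: "j \<in> {1..p}"
  shows "(\<integral>\<^sup>+ d. \<integral>\<^sup>+ l. ennreal (gamma_density (shape j) (rate j) d * cond_density j d l) * 1
       \<partial>PiM (succ_nbrs E j) (\<lambda>_. lborel) \<partial>lborel) = 1"
proof -
  have "(\<integral>\<^sup>+ d. \<integral>\<^sup>+ l. ennreal (gamma_density (shape j) (rate j) d * cond_density j d l) * 1
       \<partial>PiM (succ_nbrs E j) (\<lambda>_. lborel) \<partial>lborel) = (\<integral>\<^sup>+ d. ennreal (gamma_density (shape j) (rate j) d) * 1 \<partial>lborel)"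
    using mvn_total[OF finite_succ_nbrs pos_def_succ_nbrs]
    by (intro nn_integral_joint[where G = "\<lambda>_ _. 1"]) simp_all
  also have "\<dots> = 1"
    using gamma_density_total[OF shape_pos[OF j]] c_const_pos[OF j] by simp
  finally show ?thesis .
qed

end

locale gwishart_rv = gwishart + prob_space M for M :: "'s measure" +
  fixes X :: "'s \<Rightarrow> (nat \<times> nat \<Rightarrow> real)"
  assumes distr_X: "distributed M (gw_space p E) X (gw_density p E U \<delta>)"
begin

lemma X_measurable [measurable]: "X \<in> measurable M (gw_space p E)"
  using distr_X by (rule distributed_measurable)

text \<open>The normalising constant is never computed: whatever factor the other columns
  contribute, it must be 1 because \<^term>\<open>M\<close> has total mass 1.\<close>

lemma nn_integral_chol_col:
  assumes j: "j \<in> {1..p}"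
    and g [measurable]: "g \<in> borel_measurable (PiM (succ_nbrs E j) (\<lambda>_. lborel) \<Otimes>\<^sub>M lborel)"
  shows "(\<integral>\<^sup>+ \<omega>. g (chol_col j (X \<omega>)) \<partial>M) =
    (\<integral>\<^sup>+ d. \<integral>\<^sup>+ l. ennreal (gamma_density (shape j) (rate j) d * cond_density j d l) * g (l, d)
       \<partial>PiM (succ_nbrs E j) (\<lambda>_. lborel) \<partial>lborel)"
proof -
  let ?MM = "PiM (succ_nbrs E j) (\<lambda>_. lborel) \<Otimes>\<^sub>M lborel :: ((nat \<Rightarrow> real) \<times> real) measure"
  let ?Z = "\<integral>\<^sup>+ y. ennreal (gw_unnorm p E U \<delta> y) \<partial>gw_space p E"
  let ?J = "\<lambda>g. \<integral>\<^sup>+ d. \<integral>\<^sup>+ l. ennreal (gamma_density (shape j) (rate j) d * cond_density j d l) * g (l, d)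
       \<partial>PiM (succ_nbrs E j) (\<lambda>_. lborel) \<partial>lborel"
  obtain R where R: "\<And>g. g \<in> borel_measurable ?MM \<Longrightarrow>
    (\<integral>\<^sup>+ x. ennreal (gw_unnorm p E U \<delta> x) * g (chol_col j x) \<partial>gw_space p E) = R * ?J g"
    using nn_integral_gw_unnorm[OF j] by blast
  have *: "(\<integral>\<^sup>+ \<omega>. g (chol_col j (X \<omega>)) \<partial>M) = inverse ?Z * R * ?J g"
    if [measurable]: "g \<in> borel_measurable ?MM" for g
  proof -
    have m: "(\<lambda>x. g (chol_col j x)) \<in> borel_measurable (gw_space p E)" by measurable
    have "(\<integral>\<^sup>+ \<omega>. g (chol_col j (X \<omega>)) \<partial>M) = (\<integral>\<^sup>+ x. gw_density p E U \<delta> x * g (chol_col j x) \<partial>gw_space p E)"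
      by (rule distributed_nn_integral[OF distr_X m, symmetric])
    also have "\<dots> = (\<integral>\<^sup>+ x. inverse ?Z * (ennreal (gw_unnorm p E U \<delta> x) * g (chol_col j x)) \<partial>gw_space p E)"
      by (simp add: gw_density_def divide_ennreal_def mult_ac)
    also have "\<dots> = inverse ?Z * (\<integral>\<^sup>+ x. ennreal (gw_unnorm p E U \<delta> x) * g (chol_col j x) \<partial>gw_space p E)"
      using m by (intro nn_integral_cmult) measurable
    finally show ?thesis using R[OF that] by (simp add: mult.assoc)
  qed
  have "inverse ?Z * R = 1"
    using *[of "\<lambda>_. 1"] joint_total[OF j] emeasure_space_1 by simp
  then show ?thesis using *[OF g] by simp
qed

lemma distributed_chol_col:
  assumes j: "j \<in> {1..p}"
  shows "distributed M (PiM (succ_nbrs E j) (\<lambda>_. lborel) \<Otimes>\<^sub>M lborel) (\<lambda>\<omega>. chol_col j (X \<omega>))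
    (\<lambda>(l, d). ennreal (gamma_density (shape j) (rate j) d *
       mvn_density (succ_nbrs E j) (e_vec E U j) (\<lambda>i i'. inv_on (succ_nbrs E j) U i i' / d) l))"
  \<comment> \<open>Passing to \<open>cond_density\<close> first makes measurability of the joint
    density automatic.\<close>
  unfolding distributed_def joint_density_eq
proof (intro conjI)
  let ?N = "succ_nbrs E j"
  let ?MM = "PiM ?N (\<lambda>_. lborel) \<Otimes>\<^sub>M lborel :: ((nat \<Rightarrow> real) \<times> real) measure"
  let ?f = "\<lambda>(l, d). ennreal (gamma_density (shape j) (rate j) d * cond_density j d l)"
  show fm [measurable]: "?f \<in> borel_measurable ?MM" by measurable
  show m: "(\<lambda>\<omega>. chol_col j (X \<omega>)) \<in> measurable M ?MM" by measurable
  interpret N: sigma_finite_measure "PiM ?N (\<lambda>_. lborel :: real measure)"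
    by (rule lborel_prod.sigma_finite) simp
  interpret pair_sigma_finite "PiM ?N (\<lambda>_. lborel :: real measure)" "lborel :: real measure" ..
  show "distr M ?MM (\<lambda>\<omega>. chol_col j (X \<omega>)) = density ?MM ?f"
  proof (rule measure_eqI)
    fix A assume "A \<in> sets (distr M ?MM (\<lambda>\<omega>. chol_col j (X \<omega>)))"
    then have A [measurable]: "A \<in> sets ?MM" by simp
    have "emeasure (distr M ?MM (\<lambda>\<omega>. chol_col j (X \<omega>))) A = (\<integral>\<^sup>+ y. indicator A y \<partial>distr M ?MM (\<lambda>\<omega>. chol_col j (X \<omega>)))"
      using A by simp
    also have "\<dots> = (\<integral>\<^sup>+ \<omega>. indicator A (chol_col j (X \<omega>)) \<partial>M)"
      by (rule nn_integral_distr[OF m]) measurable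
    also have "\<dots> = (\<integral>\<^sup>+ d. \<integral>\<^sup>+ l. ?f (l, d) * indicator A (l, d) \<partial>PiM ?N (\<lambda>_. lborel) \<partial>lborel)"
      by (subst nn_integral_chol_col[OF j]) simp_all
    also have "\<dots> = (\<integral>\<^sup>+ y. ?f y * indicator A y \<partial>?MM)"
      by (rule nn_integral_snd) measurable
    also have "\<dots> = emeasure (density ?MM ?f) A"
      by (rule emeasure_density[OF fm A, symmetric])
    finally show "emeasure (distr M ?MM (\<lambda>\<omega>. chol_col j (X \<omega>))) A = emeasure (density ?MM ?f) A" .
  qed simp
qed

lemma distributed_mcd_D:
  assumes j: "j \<in> {1..p}"
  shows "distributed M lborel (\<lambda>\<omega>. mcd_D p (omega_of p E (X \<omega>)) j) (\<lambda>d. ennreal (gamma_density (shape j) (rate j) d))"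
  unfolding distributed_def
proof (intro conjI)
  let ?D = "\<lambda>\<omega>. mcd_D p (omega_of p E (X \<omega>)) j"
  let ?f = "\<lambda>d. ennreal (gamma_density (shape j) (rate j) d)"
  show fm: "?f \<in> borel_measurable lborel" by measurable
  show m: "?D \<in> measurable M lborel" by measurable
  show "distr M lborel ?D = density lborel ?f"
  proof (rule measure_eqI)
    fix A assume "A \<in> sets (distr M lborel ?D)"
    then have A: "A \<in> sets lborel" by simp
    have [measurable]: "A \<in> sets borel" using A by simp
    have "emeasure (distr M lborel ?D) A = (\<integral>\<^sup>+ y. indicator A y \<partial>distr M lborel ?D)"
      using A by simp
    also have "\<dots> = (\<integral>\<^sup>+ \<omega>. indicator A (snd (chol_col j (X \<omega>))) \<partial>M)"
      by (subst nn_integral_distr[OF m]) (simp_all add: chol_col_def)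
    also have "\<dots> = (\<integral>\<^sup>+ d. \<integral>\<^sup>+ l. ennreal (gamma_density (shape j) (rate j) d * cond_density j d l) * indicator A d
       \<partial>PiM (succ_nbrs E j) (\<lambda>_. lborel) \<partial>lborel)"
      by (subst nn_integral_chol_col[OF j, of "\<lambda>y. indicator A (snd y)"]) simp_all
    \<comment> \<open>The indicator depends on \<open>d\<close> alone, so the Gaussian factor
      integrates to 1.\<close>
    also have "\<dots> = (\<integral>\<^sup>+ d. ?f d * indicator A d \<partial>lborel)"
    proof (rule nn_integral_joint)
      fix d :: real assume "d > 0"
      then show "(\<integral>\<^sup>+ l. ennreal (mvn_density (succ_nbrs E j) (e_vec E U j) (\<lambda>i i'. inv_on (succ_nbrs E j) U i i' / d) l) * indicator A d
        \<partial>PiM (succ_nbrs E j) (\<lambda>_. lborel)) = indicator A d"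
        using mvn_total[OF finite_succ_nbrs pos_def_succ_nbrs, of d j "e_vec E U j"]
        by (cases "d \<in> A") simp_all
    qed simp
    also have "\<dots> = emeasure (density lborel ?f) A"
      by (rule emeasure_density[OF fm A, symmetric])
    finally show "emeasure (distr M lborel ?D) A = emeasure (density lborel ?f) A" .
  qed simp
qed

end

section \<open>The expectation\<close>

text \<open>Absence of fill-in again, now for a given matrix instead of elimination coordinates. It
  yields zeros of L off the graph, without which the neighbours alone would not account for all of
  \<Omega>.\<close>

lemma (in peo_graph) elim_col_not_free:
  assumes "1 \<le> j" "j \<le> i" "i \<le> p" "(i, j) \<notin> free_idx p E"
  shows "elim_col (omega_of p E x) j i = 0"
  using assms
proof (induction j arbitrary: i rule: less_induct)
  case (less j)
  let ?A = "omega_of p E x"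
  have ij: "i \<noteq> j" using less.prems by (auto simp: free_idx_def)
  then have A: "?A i j = 0" using less.prems by (auto simp: omega_of_def free_idx_def)
  have "elim_col ?A k i * elim_col ?A k j / elim_col ?A k k = 0" if k: "k \<in> {1..<j}" for k
  proof -
    have "(i, k) \<notin> free_idx p E \<or> (j, k) \<notin> free_idx p E"
      using free_idx_common_nbr[of i k j] less.prems k by auto
    then have "elim_col ?A k i = 0 \<or> elim_col ?A k j = 0"
      using less.IH[of k i] less.IH[of k j] less.prems k by auto
    then show ?thesis by auto
  qed
  then have "(\<Sum>k\<in>{1..<j}. elim_col ?A k i * elim_col ?A k j / elim_col ?A k k) = 0"
    by (intro sum.neutral ballI)
  then show ?case by (subst elim_col.simps) (simp only: A)
qed

lemma sum_of_bool_mult: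
  fixes f :: "'a \<Rightarrow> real"
  assumes "finite S"
  shows "(\<Sum>i\<in>S. of_bool (i = a) * f i) = (if a \<in> S then f a else 0)"
proof -
  have "(\<Sum>i\<in>S. of_bool (i = a) * f i) = (\<Sum>i\<in>S. if i = a then f i else 0)"
    by (intro sum.cong) auto
  then show ?thesis using assms by simp
qed

lemma affine_sum_combine:
  fixes c c' s :: real
  shows "(c + s * c') + (\<Sum>i\<in>S. (v i + s * v' i) * x i) = (c + (\<Sum>i\<in>S. v i * x i)) + s * (c' + (\<Sum>i\<in>S. v' i * x i))"
  by (simp add: sum.distrib sum_distrib_left algebra_simps)

lemma quad_form_combine:
  fixes B :: rmat
  shows "(\<Sum>i\<in>S. \<Sum>j\<in>S. (u i + s * w i) * B i j * (u j + s * w j)) =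
    (\<Sum>i\<in>S. \<Sum>j\<in>S. u i * B i j * u j) + s * (\<Sum>i\<in>S. \<Sum>j\<in>S. u i * B i j * w j)
    + s * (\<Sum>i\<in>S. \<Sum>j\<in>S. w i * B i j * u j) + s\<^sup>2 * (\<Sum>i\<in>S. \<Sum>j\<in>S. w i * B i j * w j)"
  unfolding sum_distrib_left sum.distrib[symmetric]
  by (intro sum.cong refl) (simp add: algebra_simps power2_eq_square)

text \<open>Valid for all \<open>a\<close> and \<open>b\<close>: outside \<open>S\<close> the zero
  padding of \<open>B\<close> makes both sides vanish, which matches the padded inverses in the
  expectation.\<close>

lemma sum_indicator_quad:
  fixes B :: rmat
  assumes "finite S" and "\<And>i j. B i j \<noteq> 0 \<Longrightarrow> i \<in> S \<and> j \<in> S"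
  shows "(\<Sum>i\<in>S. \<Sum>j\<in>S. of_bool (i = a) * B i j * of_bool (j = b)) = B a b"
proof -
  have "(\<Sum>i\<in>S. \<Sum>j\<in>S. of_bool (i = a) * B i j * of_bool (j = b)) = (\<Sum>i\<in>S. if i = a then (\<Sum>j\<in>S. if j = b then B a j else 0) else 0)"
    by (intro sum.cong refl) (auto intro!: sum.cong)
  then show ?thesis using assms by auto
qed

section \<open>Second moments of the columns and the mean of \<Omega>\<close>

context gwishart_rv
begin

text \<open>The density is 0 off the cone, so the default values of the Cholesky factors are met
  only on a null set.\<close>

lemma AE_pos_def: "AE \<omega> in M. pos_def_on {1..p} (omega_of p E (X \<omega>))"
proof -
  have "AE x in gw_space p E. 0 < gw_density p E U \<delta> x \<longrightarrow> pos_def_on {1..p} (omega_of p E x)"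
    by (rule AE_I2) (auto simp: gw_density_def gw_unnorm_def Let_def split: if_splits)
  then show ?thesis
    using distributed_AE2[OF distr_X pos_def_measurable] by blast
qed

definition lin_L :: "nat \<Rightarrow> real \<Rightarrow> (nat \<Rightarrow> real) \<Rightarrow> 's \<Rightarrow> real" where
  "lin_L k c v \<omega> = c + (\<Sum>i\<in>succ_nbrs E k. v i * mcd_L p (omega_of p E (X \<omega>)) i k)"

lemma lin_L_measurable [measurable]: "lin_L k c v \<in> borel_measurable M"
  unfolding lin_L_def[abs_def] by measurable

text \<open>Given pivot d, the second moment of the linear form is m^2 + q / d, with m its
  conditional mean; the weight d turns this into d * m^2 + q. Hence only the mean of the pivot
  enters, and the inverse submatrix appears free of D. Since the integrand is nonnegative almost
  surely, one nonnegative integral gives both integrability and value.\<close>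

lemma quad_moment:
  assumes k: "k \<in> {1..p}"
  shows "has_bochner_integral M (\<lambda>\<omega>. mcd_D p (omega_of p E (X \<omega>)) k * (lin_L k c v \<omega>)\<^sup>2)
    ((c + (\<Sum>i\<in>succ_nbrs E k. v i * e_vec E U k i))\<^sup>2 * H_diag E U \<delta> k +
     (\<Sum>i\<in>succ_nbrs E k. \<Sum>j\<in>succ_nbrs E k. v i * inv_on (succ_nbrs E k) U i j * v j))"
proof (rule has_bochner_integral_nn_integral)
  let ?N = "succ_nbrs E k" and ?D = "\<lambda>\<omega>. mcd_D p (omega_of p E (X \<omega>)) k"
  let ?g = "gamma_density (shape k) (rate k)"
  let ?m = "(c + (\<Sum>i\<in>?N. v i * e_vec E U k i))\<^sup>2"
  let ?q = "\<Sum>i\<in>?N. \<Sum>j\<in>?N. v i * inv_on ?N U i j * v j"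
  have q: "?q \<ge> 0" by (rule inv_on_quad_nonneg[OF finite_succ_nbrs pos_def_succ_nbrs])
  have rate: "rate k > 0" using c_const_pos[OF k] by simp
  \<comment> \<open>\<open>H_diag\<close> is the mean of the Gamma law: the halves in shape and rate
    cancel, and the 1 in the shape becomes the 2.\<close>
  have H: "H_diag E U \<delta> k = shape k / rate k"
    using c_const_pos[OF k] by (simp add: H_diag_def field_simps)
  then have H0: "H_diag E U \<delta> k \<ge> 0" using shape_pos[OF k] rate by (metis divide_nonneg_nonneg less_imp_le)
  show "(\<lambda>\<omega>. ?D \<omega> * (lin_L k c v \<omega>)\<^sup>2) \<in> borel_measurable M" by measurable
  show "0 \<le> ?m * H_diag E U \<delta> k + ?q" using q H0 by simp
  show "AE \<omega> in M. 0 \<le> ?D \<omega> * (lin_L k c v \<omega>)\<^sup>2"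
    using AE_pos_def
  proof eventually_elim
    case (elim \<omega>)
    then have "?D \<omega> \<ge> 0" using k unfolding mcd_omega_of by (auto simp: elim_D_def less_imp_le)
    then show ?case by simp
  qed
  let ?G = "\<lambda>(l, d). ennreal (d * (c + (\<Sum>i\<in>?N. v i * l i))\<^sup>2)"
  have "(\<integral>\<^sup>+ \<omega>. ennreal (?D \<omega> * (lin_L k c v \<omega>)\<^sup>2) \<partial>M) = (\<integral>\<^sup>+ \<omega>. ?G (chol_col k (X \<omega>)) \<partial>M)"
    by (simp add: chol_col_def lin_L_def cong: sum.cong)
  also have "\<dots> = (\<integral>\<^sup>+ d. \<integral>\<^sup>+ l. ennreal (?g d * cond_density k d l) * ?G (l, d) \<partial>PiM ?N (\<lambda>_. lborel) \<partial>lborel)"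
    by (rule nn_integral_chol_col[OF k]) measurable
  also have "\<dots> = (\<integral>\<^sup>+ d. ennreal (?g d) * ennreal (d * ?m + ?q) \<partial>lborel)"
  proof (rule nn_integral_joint)
    fix d :: real assume d: "d > 0"
    let ?mvn = "mvn_density ?N (e_vec E U k) (\<lambda>i i'. inv_on ?N U i i' / d)"
    show "(\<lambda>l. ?G (l, d)) \<in> borel_measurable (PiM ?N (\<lambda>_. lborel))"
      unfolding prod.case by measurable
    have [measurable]: "?mvn \<in> borel_measurable (PiM ?N (\<lambda>_. lborel))"
      using cond_density_measurable1[of k d] by (subst measurable_cong[OF mvn_eq_cond_density[OF d]])
    have nonneg: "?mvn l \<ge> 0" for l by (rule mvn_density_nonneg[OF finite_succ_nbrs pos_def_succ_nbrs d])
    have "(\<integral>\<^sup>+ l. ennreal (?mvn l) * ?G (l, d) \<partial>PiM ?N (\<lambda>_. lborel)) =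
      (\<integral>\<^sup>+ l. ennreal d * ennreal ((c + (\<Sum>i\<in>?N. v i * l i))\<^sup>2 * ?mvn l) \<partial>PiM ?N (\<lambda>_. lborel))"
      using d nonneg by (intro nn_integral_cong) (simp add: ennreal_mult'[symmetric] mult_ac)
    also have "\<dots> = ennreal d * (\<integral>\<^sup>+ l. ennreal ((c + (\<Sum>i\<in>?N. v i * l i))\<^sup>2 * ?mvn l) \<partial>PiM ?N (\<lambda>_. lborel))"
      by (rule nn_integral_cmult) measurable
    also have "\<dots> = ennreal d * ennreal (?m + ?q / d)"
      by (subst mvn_second_moment[OF finite_succ_nbrs pos_def_succ_nbrs d]) simp
    also have "\<dots> = ennreal (d * ?m + ?q)"
      using d by (subst ennreal_mult'[symmetric]) (simp_all add: distrib_left)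
    finally show "(\<integral>\<^sup>+ l. ennreal (?mvn l) * ?G (l, d) \<partial>PiM ?N (\<lambda>_. lborel)) = ennreal (d * ?m + ?q)" .
  qed
  also have "\<dots> = (\<integral>\<^sup>+ d. ennreal ?m * ennreal (?g d * d) + ennreal ?q * ennreal (?g d) \<partial>lborel)"
  proof (rule nn_integral_cong)
    fix d :: real
    show "ennreal (?g d) * ennreal (d * ?m + ?q) = ennreal ?m * ennreal (?g d * d) + ennreal ?q * ennreal (?g d)"
    proof (cases "d > 0")
      case True
      have "?g d \<ge> 0"
        using shape_pos[OF k] by (auto simp: gamma_density_def intro!: divide_nonneg_nonneg less_imp_le[OF Gamma_real_pos])
      then show ?thesis
        using True q by (simp add: ennreal_mult'[symmetric] ennreal_plus[symmetric] algebra_simps del: ennreal_plus)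
    qed (simp add: gamma_density_def)
  qed
  also have "\<dots> = ennreal ?m * ennreal (shape k / rate k) + ennreal ?q * 1"
    using gamma_density_mean[OF shape_pos[OF k] rate] gamma_density_total[OF shape_pos[OF k] rate]
    by (subst nn_integral_add) (simp_all add: nn_integral_cmult)
  also have "\<dots> = ennreal (?m * H_diag E U \<delta> k + ?q)"
    unfolding H[symmetric] using q H0 by (simp add: ennreal_mult'[symmetric])
  finally show "(\<integral>\<^sup>+ \<omega>. ennreal (?D \<omega> * (lin_L k c v \<omega>)\<^sup>2) \<partial>M) = ennreal (?m * H_diag E U \<delta> k + ?q)" .
qed

text \<open>An affine form that covers all positions in column \<open>k\<close> at once: constant 1
  on the diagonal, a single coordinate at a neighbour, 0 elsewhere. This brings the entries of L
  under \<open>quad_moment\<close>.\<close>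

definition L_entry :: "nat \<Rightarrow> nat \<Rightarrow> 's \<Rightarrow> real" where
  "L_entry k a = lin_L k (of_bool (a = k)) (\<lambda>i. of_bool (i = a))"

lemma L_entry_eq:
  assumes pd: "pos_def_on {1..p} (omega_of p E (X \<omega>))" and k: "k \<in> {1..p}" and a: "a \<in> {1..p}"
  shows "mcd_L p (omega_of p E (X \<omega>)) a k = L_entry k a \<omega>"
proof -
  let ?L = "mcd_L p (omega_of p E (X \<omega>))"
  have P: "\<forall>j\<in>{1..p}. elim_col (omega_of p E (X \<omega>)) j j > 0" using pd unfolding mcd_omega_of(3) .
  have L: "?L = elim_L p (omega_of p E (X \<omega>))" using P by (simp add: mcd_omega_of)
  have "?L k k = 1" using k P unfolding L by (force simp: elim_L_def)
  moreover have "?L a k = 0" if "a \<notin> insert k (succ_nbrs E k)"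
    using that elim_col_not_free[of k a "X \<omega>"] k a unfolding L by (auto simp: elim_L_def free_idx_iff)
  moreover have "(\<Sum>i\<in>succ_nbrs E k. of_bool (i = a) * ?L i k) = (if a \<in> succ_nbrs E k then ?L a k else 0)"
    by (rule sum_of_bool_mult) simp
  ultimately show ?thesis by (auto simp: L_entry_def lin_L_def)
qed

lemma column_moment:
  assumes k: "k \<in> {1..p}"
  shows "has_bochner_integral M (\<lambda>\<omega>. L_entry k a \<omega> * mcd_D p (omega_of p E (X \<omega>)) k * L_entry k b \<omega>)
    (e_mat E U k a * H_diag E U \<delta> k * e_mat E U k b + inv_on (succ_nbrs E k) U a b)"
proof -
  let ?N = "succ_nbrs E k" and ?D = "\<lambda>\<omega>. mcd_D p (omega_of p E (X \<omega>)) k"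
  let ?B = "inv_on ?N U" and ?H = "H_diag E U \<delta> k"
  let ?c = "\<lambda>a. of_bool (a = k) :: real" and ?v = "\<lambda>a i. of_bool (i = a) :: real"
  have e: "?c a + (\<Sum>i\<in>?N. ?v a i * e_vec E U k i) = e_mat E U k a" for a
    unfolding sum_of_bool_mult[OF finite_succ_nbrs] by (auto simp: e_mat_def)
  have B: "(\<Sum>i\<in>?N. \<Sum>j\<in>?N. ?v a i * ?B i j * ?v b j) = ?B a b" for a b
    using inv_on_supp[OF finite_succ_nbrs pos_def_succ_nbrs] by (intro sum_indicator_quad) auto
  have sym: "?B b a = ?B a b" by (rule inv_on_sym[OF finite_succ_nbrs pos_def_succ_nbrs])
  have m: "has_bochner_integral M (\<lambda>\<omega>. ?D \<omega> * (L_entry k a \<omega> + s * L_entry k b \<omega>)\<^sup>2)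
     ((e_mat E U k a + s * e_mat E U k b)\<^sup>2 * ?H + (?B a a + 2 * s * ?B a b + s\<^sup>2 * ?B b b))" for s
  proof -
    have "lin_L k (?c a + s * ?c b) (\<lambda>i. ?v a i + s * ?v b i) \<omega> = L_entry k a \<omega> + s * L_entry k b \<omega>" for \<omega>
      unfolding L_entry_def lin_L_def by (rule affine_sum_combine)
    moreover have "(?c a + s * ?c b) + (\<Sum>i\<in>?N. (?v a i + s * ?v b i) * e_vec E U k i) = e_mat E U k a + s * e_mat E U k b"
      unfolding e[symmetric] by (rule affine_sum_combine)
    moreover have "(\<Sum>i\<in>?N. \<Sum>j\<in>?N. (?v a i + s * ?v b i) * ?B i j * (?v a j + s * ?v b j)) =
      ?B a a + 2 * s * ?B a b + s\<^sup>2 * ?B b b"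
      unfolding quad_form_combine B sym by simp
    ultimately show ?thesis
      using quad_moment[OF k, of "?c a + s * ?c b" "\<lambda>i. ?v a i + s * ?v b i"] by (simp only:)
  qed
  \<comment> \<open>Polarisation: a quarter of the difference between \<open>s = 1\<close> and
    \<open>s = -1\<close> leaves the mixed product.\<close>
  have "has_bochner_integral M (\<lambda>\<omega>. (?D \<omega> * (L_entry k a \<omega> + 1 * L_entry k b \<omega>)\<^sup>2 - ?D \<omega> * (L_entry k a \<omega> + (-1) * L_entry k b \<omega>)\<^sup>2) * (1/4))
    ((((e_mat E U k a + 1 * e_mat E U k b)\<^sup>2 * ?H + (?B a a + 2 * 1 * ?B a b + 1\<^sup>2 * ?B b b)) - 
     ((e_mat E U k a + (-1) * e_mat E U k b)\<^sup>2 * ?H + (?B a a + 2 * (-1) * ?B a b + (-1)\<^sup>2 * ?B b b))) * (1/4))"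
    by (intro has_bochner_integral_mult_left has_bochner_integral_diff m)
  then show ?thesis
    by (simp add: power2_eq_square algebra_simps)
qed

lemma omega_moment:
  assumes a: "a \<in> {1..p}" and b: "b \<in> {1..p}"
  shows "has_bochner_integral M (\<lambda>\<omega>. omega_of p E (X \<omega>) a b)
    ((\<Sum>k\<in>{1..<p}. inv_on (succ_nbrs E k) U a b) +
     (\<Sum>k\<in>{1..p}. e_mat E U k a * H_diag E U \<delta> k * e_mat E U k b))"
proof -
  have "has_bochner_integral M (\<lambda>\<omega>. \<Sum>k\<in>{1..p}. L_entry k a \<omega> * mcd_D p (omega_of p E (X \<omega>)) k * L_entry k b \<omega>)
    (\<Sum>k\<in>{1..p}. e_mat E U k a * H_diag E U \<delta> k * e_mat E U k b + inv_on (succ_nbrs E k) U a b)"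
    by (intro has_bochner_integral_sum column_moment)
  also have "(\<Sum>k\<in>{1..p}. e_mat E U k a * H_diag E U \<delta> k * e_mat E U k b + inv_on (succ_nbrs E k) U a b) =
    (\<Sum>k\<in>{1..<p}. inv_on (succ_nbrs E k) U a b) + (\<Sum>k\<in>{1..p}. e_mat E U k a * H_diag E U \<delta> k * e_mat E U k b)"
  proof -
    \<comment> \<open>The last vertex has no later neighbour, so its padded inverse is the zero
      matrix and the first sum stops before \<open>p\<close>; the second sum keeps the term of
      \<open>p\<close>.\<close>
    have "succ_nbrs E p = {}" using succ_nbrs_subset[of p] by (auto simp: succ_nbrs_def)
    then have "inv_on (succ_nbrs E p) U a b = 0"
      using inv_on_supp[OF finite_succ_nbrs pos_def_succ_nbrs[of p], of a b] by auto
    moreover have "{1..p} = insert p {1..<p}" using a by auto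
    ultimately have "(\<Sum>k\<in>{1..p}. inv_on (succ_nbrs E k) U a b) = (\<Sum>k\<in>{1..<p}. inv_on (succ_nbrs E k) U a b)"
      by simp
    then show ?thesis by (simp add: sum.distrib)
  qed
  finally have int: "has_bochner_integral M (\<lambda>\<omega>. \<Sum>k\<in>{1..p}. L_entry k a \<omega> * mcd_D p (omega_of p E (X \<omega>)) k * L_entry k b \<omega>)
    ((\<Sum>k\<in>{1..<p}. inv_on (succ_nbrs E k) U a b) +
     (\<Sum>k\<in>{1..p}. e_mat E U k a * H_diag E U \<delta> k * e_mat E U k b))" .
  \<comment> \<open>The decomposition exists only on the cone, so the two sides agree almost surely
    rather than everywhere.\<close>
  have AE: "AE \<omega> in M. omega_of p E (X \<omega>) a b =
    (\<Sum>k\<in>{1..p}. L_entry k a \<omega> * mcd_D p (omega_of p E (X \<omega>)) k * L_entry k b \<omega>)"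
    using AE_pos_def
  proof eventually_elim
    case (elim \<omega>)
    let ?A = "omega_of p E (X \<omega>)"
    have P: "\<forall>j\<in>{1..p}. elim_col ?A j j > 0" using elim unfolding mcd_omega_of(3) .
    then have "is_mcd p ?A (elim_L p ?A) (elim_D p ?A)" by (intro is_mcd_elim omega_of_sym) blast
    then have "is_mcd p ?A (mcd_L p ?A) (mcd_D p ?A)" using P by (simp add: mcd_omega_of)
    then show ?case
      using is_mcd_eq[of p ?A _ _ a b] a b L_entry_eq[OF elim] by simp
  qed
  show ?thesis
    using int AE has_bochner_integral_cong_AE[of "\<lambda>\<omega>. omega_of p E (X \<omega>) a b" M] 
    by (subst has_bochner_integral_cong_AE[OF _ _ AE]) (auto simp: has_bochner_integral_iff)
qed

end

theorem theorem5:
  fixes p :: nat and E :: "(nat \<times> nat) set" and U :: rmat and \<delta> :: "nat \<Rightarrow> real"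
    and M :: "'s measure" and X :: "'s \<Rightarrow> (nat \<times> nat \<Rightarrow> real)"
  assumes E_sub: "E \<subseteq> {1..p} \<times> {1..p}"
    and E_sym: "\<And>i j. (i, j) \<in> E \<Longrightarrow> (j, i) \<in> E"
    and E_irrefl: "\<And>i. (i, i) \<notin> E"
    and peo: "is_peo p E"
    and U_pd: "pos_def_on {1..p} U"
    and \<delta>_pos: "\<And>i. i \<in> {1..p} \<Longrightarrow> \<delta> i > 0"
    and prob: "prob_space M"
    and distr: "distributed M (gw_space p E) X (gw_density p E U \<delta>)"
  shows
    "(\<forall>j\<in>{1..p}.
        distributed M lborel (\<lambda>\<omega>. mcd_D p (omega_of p E (X \<omega>)) j)
          (\<lambda>d. ennreal (gamma_density ((real (nu E j) + \<delta> j) / 2 + 1) (c_const E U j / 2) d))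
      \<and> distributed M (PiM (succ_nbrs E j) (\<lambda>_. lborel) \<Otimes>\<^sub>M lborel)
          (\<lambda>\<omega>. (restrict (\<lambda>i. mcd_L p (omega_of p E (X \<omega>)) i j) (succ_nbrs E j),
                 mcd_D p (omega_of p E (X \<omega>)) j))
          (\<lambda>(l, d). ennreal (gamma_density ((real (nu E j) + \<delta> j) / 2 + 1) (c_const E U j / 2) d *
                     mvn_density (succ_nbrs E j) (e_vec E U j)
                       (\<lambda>i i'. inv_on (succ_nbrs E j) U i i' / d) l)))
   \<and> (\<forall>a\<in>{1..p}. \<forall>b\<in>{1..p}.
        integrable M (\<lambda>\<omega>. omega_of p E (X \<omega>) a b) \<and>
        prob_space.expectation M (\<lambda>\<omega>. omega_of p E (X \<omega>) a b) =
          (\<Sum>k\<in>{1..<p}. inv_on (succ_nbrs E k) U a b) +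
          (\<Sum>k\<in>{1..p}. e_mat E U k a * H_diag E U \<delta> k * e_mat E U k b))"
proof -
  interpret prob_space M by (rule prob)
  interpret gwishart_rv p E U \<delta> M X
    by unfold_locales (fact E_sub, fact E_irrefl, fact peo, fact U_pd, rule \<delta>_pos, assumption, fact distr)
  show ?thesis
    using distributed_mcd_D distributed_chol_col[unfolded chol_col_def] omega_moment
    by (auto simp: has_bochner_integral_iff)
qed

end
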